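(* Let $X$ be a compact connected abelian group with $\dim X<\infty$, let $s\ge 2$, and let $T_1,\ldots,T_{s-1}$ be epimorphisms of $X$ such that $T_1,\ldots,T_{s-1},id$ are pairwise distinct. Then the set $\{T_1,\ldots,T_{s-1},id\}$ is mixing if and only if every $T_i$ is mixing and the set $\{T_1,\ldots,T_{s-1}\}$ is mixing.
   Context: $m$ is the normalized Haar measure on $X$ and $\mathcal{B}$ is the completion of the Borel $\sigma$-algebra. An epimorphism of $X$ is a continuous surjective homomorphism $X\to X$. A single epimorphism $T$ is mixing if $m(A\cap T^{-n}B)\to m(A)m(B)$ as $n\to\infty$ for all $A,B\in\mathcal{B}$. A finite set $F$ of epimorphisms is called mixing if for every collection $B_\gamma\in\mathcal{B}$, $\gamma\in F$, one has $m\left(\bigcap_{\gamma\in F}\gamma^{-n}(B_\gamma)\right)\to\prod_{\gamma\in F}m(B_\gamma)$ as $n\to\infty$ (preimages); a one-element set satisfies this condition trivially, by invariance of $m$, and is counted as a mixing set (not to be confused with mixing of its single element). *)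

theory Defs
  imports "HOL-Analysis.Analysis"
begin

text \<open>
  Lebesgue covering dimension at most \<open>n\<close>: every finite open cover has a finite open refinement
  of order at most \<open>n\<close>, that is, no point lies in more than \<open>n + 1\<close> of its members.
\<close>
definition covering_dim_le :: "'a topology \<Rightarrow> nat \<Rightarrow> bool" where
  "covering_dim_le X n \<longleftrightarrow>
     (\<forall>\<U>. finite \<U> \<and> (\<forall>U\<in>\<U>. openin X U) \<and> \<Union>\<U> = topspace X \<longrightarrow>
       (\<exists>\<V>. finite \<V> \<and> (\<forall>V\<in>\<V>. openin X V) \<and> \<Union>\<V> = topspace X \<and>
            (\<forall>V\<in>\<V>. \<exists>U\<in>\<U>. V \<subseteq> U) \<and>
            (\<forall>x\<in>topspace X. card {V\<in>\<V>. x \<in> V} \<le> n + 1)))"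

definition finite_covering_dim :: "'a topology \<Rightarrow> bool" where
  "finite_covering_dim X \<longleftrightarrow> (\<exists>n. covering_dim_le X n)"

text \<open>
  A compact group need not be metrizable, so regularity is not automatic for a Borel measure
  and is part of the definition of Haar measure.
\<close>
definition normalized_haar :: "'a::{topological_ab_group_add, t2_space} measure \<Rightarrow> bool" where
  "normalized_haar m \<longleftrightarrow>
     sets m = sets borel \<and>
     emeasure m UNIV = 1 \<and>
     (\<forall>g. \<forall>A\<in>sets m. emeasure m ((\<lambda>x. g + x) ` A) = emeasure m A) \<and>
     (\<forall>A\<in>sets m. emeasure m A = (INF U\<in>{U. open U \<and> A \<subseteq> U}. emeasure m U)) \<and>
     (\<forall>U. open U \<longrightarrow> emeasure m U = (SUP K\<in>{K. compact K \<and> K \<subseteq> U}. emeasure m K))"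

definition epimorphism :: "('a::topological_ab_group_add \<Rightarrow> 'a) \<Rightarrow> bool" where
  "epimorphism T \<longleftrightarrow> continuous_on UNIV T \<and> surj T \<and> (\<forall>x y. T (x + y) = T x + T y)"

definition mixing :: "'a measure \<Rightarrow> ('a \<Rightarrow> 'a) \<Rightarrow> bool" where
  "mixing M T \<longleftrightarrow>
     (\<forall>A\<in>sets M. \<forall>B\<in>sets M.
        (\<lambda>n. measure M (A \<inter> (T ^^ n) -` B)) \<longlonglongrightarrow> measure M A * measure M B)"

definition mixing_set :: "'a measure \<Rightarrow> ('a \<Rightarrow> 'a) set \<Rightarrow> bool" where
  "mixing_set M F \<longleftrightarrow> finite F \<and>
     (\<forall>B. (\<forall>\<gamma>\<in>F. B \<gamma> \<in> sets M) \<longrightarrow>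
        (\<lambda>n. measure M (\<Inter>\<gamma>\<in>F. (\<gamma> ^^ n) -` B \<gamma>)) \<longlonglongrightarrow> (\<Prod>\<gamma>\<in>F. measure M (B \<gamma>)))"

end

theory Submission
  imports Defs
begin

text \<open>
  By Fourier analysis a finite set \<open>F\<close> of epimorphisms is mixing iff, for characters \<open>\<xi>\<^sub>\<gamma>\<close> that are
  not all trivial, \<open>\<Prod>\<gamma>\<in>F. \<xi>\<^sub>\<gamma> \<circ> \<gamma>\<^sup>n\<close> is trivial for only finitely many \<open>n\<close>. Suppose
  \<open>\<xi>\<^sub>0 \<cdot> (\<Prod>i. \<xi>\<^sub>i \<circ> T\<^sub>i\<^sup>n) = 1\<close> for infinitely many \<open>n\<close>. The dual group is torsion free by connectedness
  and of finite rank by finite dimensionality, so the relation becomes a vanishing sum of integer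
  matrix powers applied to vectors, and the Skolem--Mahler--Lech argument yields it on a whole
  arithmetic progression \<open>a + b n\<close>. Dividing consecutive relations eliminates \<open>\<xi>\<^sub>0\<close> and leaves
  \<open>\<Prod>i. \<zeta>\<^sub>i \<circ> T\<^sub>i\<^sup>a\<^sup>+\<^sup>b\<^sup>n = 1\<close> with \<open>\<zeta>\<^sub>i = \<xi>\<^sub>i \<circ> T\<^sub>i\<^sup>b / \<xi>\<^sub>i\<close>; mixing of the set forces \<open>\<zeta>\<^sub>i = 1\<close>, and then
  mixing of the single \<open>T\<^sub>i\<close> forces \<open>\<xi>\<^sub>i = 1\<close>.

  Haar measure on a possibly non-metrizable group is accessed through continuous functions only:
  characters are obtained as minimal idempotents of the convolution algebra. The rank bound is a
  Sperner argument, since independent characters map the group onto a torus.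
\<close>


section \<open>A case of the Skolem--Mahler--Lech theorem\<close>

text \<open>The dual group need not be finitely generated and the epimorphisms need not be
  injective. A maximal independent family of characters therefore spans the dual group only in the
  sense that every character has a power in its span, and each epimorphism becomes a rational
  matrix. A common denominator \<open>q\<close> turns these into integer matrices; their
  \<open>n\<close>-th powers all carry the same factor \<open>q ^ n\<close>, so the zero set of the
  sum does not change. The inverse matrices have a common denominator \<open>r\<close>, and a prime
  larger than \<open>q * r\<close> makes every integer matrix invertible modulo
  \<open>p ^ 2\<close>, hence of finite order there. The modulus is \<open>p ^ 2\<close> and not
  \<open>p\<close> because \<open>k!\<close> has at most \<open>k\<close> factors \<open>p\<close>,
  so that \<open>p ^ (2 * k) / k!\<close> keeps at least \<open>k\<close> of them, for
  \<open>p = 2\<close> as well.\<close>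

lemma fact_prime_part:
  fixes p :: nat
  assumes p: "prime p"
  shows "\<exists>v s. fact n = p ^ v * s \<and> \<not> p dvd s \<and> v \<le> n"
proof -
  have p2: "p \<ge> 2" using p by (rule prime_ge_2_nat)
  have step: "multiplicity p (fact n :: nat) \<le> n" for n :: nat
  proof (induction n rule: less_induct)
    case (less n)
    \<comment> \<open>Legendre's recursion: only the \<open>n div p\<close> multiples of
      \<open>p\<close> count, each with one factor \<open>p\<close> of its own plus those of its
      cofactor. By induction the total is at most \<open>2 * (n div p)\<close>, hence at most
      \<open>n\<close>.\<close>
    have "multiplicity p (fact n :: nat) = multiplicity p (\<Prod>{1..n})"
      by (simp add: fact_prod)
    also have "\<dots> = (\<Sum>j\<in>{1..n}. multiplicity p j)"
      by (rule prime_elem_multiplicity_prod_distrib) (use p in auto)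
    also have "\<dots> = (\<Sum>j\<in>{j. j \<in> {1..n} \<and> p dvd j}. multiplicity p j)"
      by (rule sum.mono_neutral_right) (auto simp: prime_multiplicity_gt_zero_iff p intro: ccontr not_dvd_imp_multiplicity_0)
    also have "{j. j \<in> {1..n} \<and> p dvd j} = (\<lambda>m. p * m) ` {1..n div p}"
    proof (intro equalityI subsetI)
      fix j assume "j \<in> {j. j \<in> {1..n} \<and> p dvd j}"
      then obtain m where m: "j = p * m" "1 \<le> p * m" "p * m \<le> n" by auto
      have "m \<ge> 1" using m by (cases m) auto
      moreover have "m \<le> n div p" using m p2 by (simp add: less_eq_div_iff_mult_less_eq mult.commute)
      ultimately show "j \<in> (\<lambda>m. p * m) ` {1..n div p}" using m by auto
    next
      fix j assume "j \<in> (\<lambda>m. p * m) ` {1..n div p}"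
      then obtain m where m0: "j = p * m" "m \<in> {1..n div p}" by (rule imageE)
      then have m: "j = p * m" "1 \<le> m" "m \<le> n div p" by simp_all
      then have "p * m \<le> n" using p2 by (simp add: less_eq_div_iff_mult_less_eq mult.commute)
      then show "j \<in> {j. j \<in> {1..n} \<and> p dvd j}" using m prime_gt_0_nat[OF p] by simp
    qed
    also have "(\<Sum>j\<in>(\<lambda>m. p * m) ` {1..n div p}. multiplicity p j) = (\<Sum>m\<in>{1..n div p}. multiplicity p (p * m))"
      by (subst sum.reindex) (use p2 in \<open>auto simp: inj_on_def\<close>)
    also have "\<dots> = (\<Sum>m\<in>{1..n div p}. Suc (multiplicity p m))"
      by (rule sum.cong) (use p prime_gt_0_nat[OF p] in \<open>auto intro!: multiplicity_times_same\<close>)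
    also have "\<dots> = n div p + (\<Sum>m\<in>{1..n div p}. multiplicity p m)"
      using sum.distrib[of "\<lambda>_. 1 :: nat" "multiplicity p" "{1..n div p}"] by simp
    also have "(\<Sum>m\<in>{1..n div p}. multiplicity p m) = multiplicity p (\<Prod>{1..n div p})"
      by (rule prime_elem_multiplicity_prod_distrib[symmetric]) (use p in auto)
    also have "\<dots> = multiplicity p (fact (n div p) :: nat)" by (simp add: fact_prod)
    also have "n div p + multiplicity p (fact (n div p) :: nat) \<le> n"
    proof (cases "n = 0")
      case False
      then have "n div p < n" using p2 by simp
      then have "multiplicity p (fact (n div p) :: nat) \<le> n div p" by (rule less.IH)
      moreover have "2 * (n div p) \<le> n"
        by (meson div_times_less_eq_dividend le_trans mult.commute mult_le_mono1 p2 times_div_less_eq_dividend)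
      ultimately show ?thesis by linarith
    qed simp
    finally show ?case .
  qed
  obtain y where y: "(fact n :: nat) = p ^ multiplicity p (fact n :: nat) * y" "\<not> p dvd y"
    using multiplicity_decompose'[of "fact n :: nat" p] p2 by auto
  then show ?thesis using step[of n] by blast
qed

text \<open>Synthetic division: \<open>coeff Q j\<close> is coefficient \<open>Suc j\<close> of the
  product plus \<open>t * coeff Q (Suc j)\<close>, so divisibility descends from the degree.
  Removing a linear factor lowers the threshold by one.\<close>

lemma coeff_dvd_synthetic_quotient:
  fixes Q :: "int poly"
  assumes "\<And>j. j \<ge> Suc k \<Longrightarrow> m dvd coeff ([:- t, 1:] * Q) j"
  shows "j \<ge> k \<Longrightarrow> m dvd coeff Q j"
proof (induction "degree Q + 1 - j" arbitrary: j rule: less_induct)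
  case less
  show ?case
  proof (cases "j > degree Q")
    case True then show ?thesis by (simp add: coeff_eq_0)
  next
    case False
    have "coeff ([:- t, 1:] * Q) (Suc j) = coeff Q j - t * coeff Q (Suc j)"
      by simp
    moreover have "m dvd coeff ([:- t, 1:] * Q) (Suc j)" using assms[of "Suc j"] less.prems by (simp only: Suc_le_mono)
    moreover have "m dvd coeff Q (Suc j)" using less False by (intro less.hyps) auto
    ultimately show ?thesis by (metis dvd_diff_right_iff dvd_mult diff_add_cancel dvd_add_right_iff add.commute)
  qed
qed

text \<open>Each root uses up one unit of the threshold, so \<open>card S\<close> roots bring it
  down to 0 and every coefficient of \<open>Q\<close> is covered.\<close>

lemma coeff_dvd_quotient_prod:
  fixes Q :: "int poly"
  assumes "finite S" "\<And>j. j \<ge> card S \<Longrightarrow> m dvd coeff ((\<Prod>t\<in>S. [:- t, 1:]) * Q) j"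
  shows "m dvd coeff Q j"
  using assms
proof (induction S arbitrary: Q j rule: finite_induct)
  case empty then show ?case by simp
next
  case (insert t S)
  have "m dvd coeff ((\<Prod>t\<in>S. [:- t, 1:]) * Q) j" if "j \<ge> card S" for j
  proof (rule coeff_dvd_synthetic_quotient)
    fix j assume "j \<ge> Suc (card S)"
    then have "m dvd coeff ((\<Prod>t\<in>insert t S. [:- t, 1:]) * Q) j"
      using insert by (intro insert.prems) auto
    then show "m dvd coeff ([:- t, 1:] * ((\<Prod>t\<in>S. [:- t, 1:]) * Q)) j"
      unfolding prod.insert[OF insert.hyps] mult.assoc .
  qed fact
  then show ?case by (rule insert.IH)
qed

lemma prod_linear_dvd:
  fixes R :: "int poly"
  assumes "finite S" "\<And>t. t \<in> S \<Longrightarrow> poly R t = 0"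
  shows "(\<Prod>t\<in>S. [:- t, 1:]) dvd R"
  using assms
proof (induction S arbitrary: R rule: finite_induct)
  case empty then show ?case by simp
next
  case (insert t S)
  then obtain Q where Q: "R = [:- t, 1:] * Q" by (metis dvdE insertI1 poly_eq_0_iff_dvd)
  have "poly Q u = 0" if "u \<in> S" for u
  proof -
    have "poly R u = 0" using insert.prems that by simp
    then show ?thesis using Q that insert.hyps by auto
  qed
  then have "(\<Prod>t\<in>S. [:- t, 1:]) dvd Q" by (rule insert.IH)
  then show ?case unfolding Q prod.insert[OF insert.hyps] by (rule mult_dvd_mono[OF dvd_refl])
qed

lemma coeff_prod_linear_eq_0:
  "j > i \<Longrightarrow> coeff (\<Prod>k<i. [:- int k, 1:]) j = 0"
  by (rule coeff_eq_0) (simp add: degree_prod_eq_sum_degree)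

lemma poly_falling_factorial:
  "poly (\<Prod>k<i. [:- int k, 1:]) (int t) = int (fact i * (t choose i))"
proof -
  have "poly (\<Prod>k<i. [:- int k, 1:]) (int t) = (\<Prod>k<i. int t - int k)"
    by (simp add: poly_prod)
  also have "\<dots> = int (fact i * (t choose i))"
  proof (cases "i \<le> t")
    case True
    have "real_of_int (\<Prod>k<i. int t - int k) = real_of_int (int (fact i * (t choose i)))"
      by (simp add: binomial_gbinomial gbinomial_prod_rev lessThan_atLeast0)
    then show ?thesis by (simp only: of_int_eq_iff)
  next
    case False
    then have "(\<Prod>k<i. int t - int k) = 0" by (intro prod_zero) auto
    then show ?thesis using False by (simp add: binomial_eq_0)
  qed
  finally show ?thesis .
qed

text \<open>
  Hansel's elementary form of Strassmann's theorem: the factors \<open>p ^ (2 * k)\<close> absorb the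
  denominators \<open>k!\<close> of the binomial coefficients, so that the interpolating polynomial has
  coefficients tending to zero \<open>p\<close>-adically, which survives division by linear factors.
\<close>
lemma binomial_sum_infinite_zeros:
  fixes d :: "nat \<Rightarrow> int" and p :: nat
  defines "b \<equiv> \<lambda>n. \<Sum>k\<le>n. int (n choose k) * int p ^ (2 * k) * d k"
  assumes p: "prime p" and inf: "infinite {n. b n = 0}"
  shows "b n = 0"
proof -
  \<comment> \<open>Any \<open>k\<close> zeros of \<open>b\<close> give \<open>k\<close> linear
    factors of an interpolating polynomial, which suffices for divisibility by \<open>p ^ k\<close>.
    As \<open>k\<close> is arbitrary, \<open>b n\<close> vanishes.\<close>
  have dvd: "int p ^ k dvd b n" for k
  proof -
    obtain S where S: "finite S" "card S = k" "S \<subseteq> {n. b n = 0}"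
      using inf infinite_arbitrarily_large by blast
    define N where "N = Max (insert n S)"
    have N: "n \<le> N" "\<And>t. t \<in> S \<Longrightarrow> t \<le> N" using S unfolding N_def by auto
    \<comment> \<open>Multiplying by the part \<open>s\<close> of \<open>N!\<close> prime to
      \<open>p\<close> clears the part of each denominator \<open>i!\<close> prime to
      \<open>p\<close>. The rest of \<open>i!\<close> is a power of \<open>p\<close> with exponent
      at most \<open>i\<close>, so \<open>p ^ (2 * i)\<close> absorbs it and still leaves
      \<open>p ^ i\<close>.\<close>
    obtain v s where vs: "fact N = p ^ v * s" "\<not> p dvd s" using fact_prime_part[OF p] by metis
    have fact_dvd: "fact i dvd s * p ^ i" if "i \<le> N" for i
    proof -
      obtain w r where wr: "fact i = p ^ w * r" "\<not> p dvd r" "w \<le> i" using fact_prime_part[OF p] by metis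
      have "r dvd p ^ v * s" using that wr(1) vs(1) by (metis dvd_triv_right fact_dvd dvd_trans)
      moreover have "coprime r (p ^ v)" using p wr(2) by (metis coprime_commute coprime_power_right_iff prime_imp_coprime)
      ultimately have "r dvd s" by (simp add: coprime_dvd_mult_right_iff)
      then show ?thesis using wr by (metis le_imp_power_dvd mult.commute mult_dvd_mono)
    qed
    \<comment> \<open>Newton's interpolation of \<open>s * b\<close> on the integers from 0 to
      \<open>N\<close>: a binomial coefficient is a falling factorial over
      \<open>i!\<close>.\<close>
    define R where "R = (\<Sum>i\<le>N. smult (d i * int (s * p ^ (2 * i) div fact i)) (\<Prod>k<i. [:- int k, 1:]))"
    have pdvd: "p ^ i dvd s * p ^ (2 * i) div fact i" "fact i dvd s * p ^ (2 * i)" if i: "i \<le> N" for i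
    proof -
      obtain c where c: "s * p ^ i = fact i * c" using fact_dvd[OF i] by auto
      have "p ^ (2 * i) = p ^ i * p ^ i" by (simp only: mult_2 power_add)
      with c have "s * p ^ (2 * i) = fact i * (c * p ^ i)" by (metis mult.assoc)
      then show "p ^ i dvd s * p ^ (2 * i) div fact i" "fact i dvd s * p ^ (2 * i)" by simp_all
    qed
    have eval: "poly R (int t) = int s * b t" if t: "t \<le> N" for t
    proof -
      have "poly R (int t) = (\<Sum>i\<le>N. d i * int (s * p ^ (2 * i) div fact i) * int (fact i * (t choose i)))"
        by (simp add: R_def poly_sum poly_falling_factorial)
      also have "\<dots> = (\<Sum>i\<le>N. int s * (int (t choose i) * int p ^ (2 * i) * d i))"
      proof (rule sum.cong)
        fix i assume "i \<in> {..N}"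
        then have "int (s * p ^ (2 * i) div fact i) * int (fact i) = int (s * p ^ (2 * i))"
          using pdvd(2)[of i] by (metis atMost_iff dvd_div_mult_self of_nat_mult)
        moreover have "d i * int (s * p ^ (2 * i) div fact i) * int (fact i * (t choose i))
            = d i * (int (s * p ^ (2 * i) div fact i) * int (fact i)) * int (t choose i)"
          by (simp only: of_nat_mult mult_ac)
        ultimately show "d i * int (s * p ^ (2 * i) div fact i) * int (fact i * (t choose i))
            = int s * (int (t choose i) * int p ^ (2 * i) * d i)"
          by (simp add: mult_ac)
      qed simp
      also have "\<dots> = (\<Sum>i\<le>t. int s * (int (t choose i) * int p ^ (2 * i) * d i))"
        by (rule sum.mono_neutral_right) (use t in \<open>auto simp: binomial_eq_0\<close>)
      finally show ?thesis by (simp add: b_def sum_distrib_left)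
    qed
    have "(\<Prod>t\<in>int ` S. [:- t, 1:]) dvd R"
    proof (rule prod_linear_dvd)
      fix t assume "t \<in> int ` S"
      then obtain u where "u \<in> S" "t = int u" by auto
      then show "poly R t = 0" using eval[of u] N(2)[of u] S by auto
    qed (use S in simp)
    then obtain Q where Q: "R = (\<Prod>t\<in>int ` S. [:- t, 1:]) * Q" by blast
    \<comment> \<open>The summand \<open>i\<close> has degree \<open>i\<close>, so for
      \<open>i < k\<close> it has no coefficient at \<open>j\<close>, and for
      \<open>i \<ge> k\<close> it contains the factor \<open>p ^ i\<close>.\<close>
    have "int p ^ k dvd coeff R j" if "j \<ge> k" for j
      unfolding R_def coeff_sum
    proof (rule dvd_sum)
      fix i assume i: "i \<in> {..N}"
      show "int p ^ k dvd coeff (smult (d i * int (s * p ^ (2 * i) div fact i)) (\<Prod>k<i. [:- int k, 1:])) j"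
      proof (cases "i \<ge> k")
        case True
        then have "int p ^ k dvd int (p ^ i)" by (simp add: le_imp_power_dvd)
        also have "int (p ^ i) dvd int (s * p ^ (2 * i) div fact i)"
          using pdvd(1)[of i] i by (simp only: of_nat_dvd_iff atMost_iff)
        finally show ?thesis by simp
      next
        case False
        then show ?thesis using that by (simp add: coeff_prod_linear_eq_0)
      qed
    qed
    note coeffs = this
    have card: "card (int ` S) = k" using S by (simp add: card_image)
    have "int p ^ k dvd coeff Q j" for j
    proof (rule coeff_dvd_quotient_prod)
      show "int p ^ k dvd coeff ((\<Prod>t\<in>int ` S. [:- t, 1:]) * Q) i" if "i \<ge> card (int ` S)" for i
        using coeffs[of i] that unfolding card Q[symmetric] .
    qed (use S in simp)
    then have "int p ^ k dvd poly Q (int n)"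
      unfolding poly_altdef by (intro dvd_sum) simp
    then have "int p ^ k dvd poly R (int n)" using Q by simp
    then have "int p ^ k dvd int s * b n" using eval N by simp
    moreover have "coprime (int p ^ k) (int s)"
      using vs(2) p by (simp add: prime_imp_coprime)
    ultimately show ?thesis by (simp add: coprime_dvd_mult_right_iff)
  qed
  show "b n = 0"
  proof (rule ccontr)
    assume nz: "b n \<noteq> 0"
    have "int (nat \<bar>b n\<bar>) < int p ^ nat \<bar>b n\<bar>"
      unfolding of_nat_power[symmetric] of_nat_less_iff
      by (rule power_gt_expt) (use prime_gt_1_nat[OF p] in simp)
    moreover have "int p ^ nat \<bar>b n\<bar> \<le> \<bar>b n\<bar>"
      using dvd_imp_le_int[OF nz dvd[of "nat \<bar>b n\<bar>"]] by simp
    ultimately show False by simp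
  qed
qed


section \<open>Integer vectors and linear maps modulo an integer\<close>

definition zvec :: "nat \<Rightarrow> (nat \<Rightarrow> int) set" where
  "zvec d = {v. \<forall>k\<ge>d. v k = 0}"

text \<open>The dimension is a rank found inside a later proof, so vectors are functions with zero
  tail and not elements of a type. One identity expresses additivity and homogeneity
  together.\<close>

definition zlinear :: "nat \<Rightarrow> ((nat \<Rightarrow> int) \<Rightarrow> nat \<Rightarrow> int) \<Rightarrow> bool" where
  "zlinear d f \<longleftrightarrow> (\<forall>v. f v \<in> zvec d) \<and>
     (\<forall>v w c. f (\<lambda>k. v k + c * w k) = (\<lambda>k. f v k + c * f w k))"

lemma zlinear_funpow_add:
  assumes "zlinear d f"
  shows "(f ^^ n) (\<lambda>k. v k + c * w k) = (\<lambda>k. (f ^^ n) v k + c * (f ^^ n) w k)"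
  using assms by (induction n) (simp_all add: zlinear_def)

lemma zlinear_funpow_zvec: "zlinear d f \<Longrightarrow> v \<in> zvec d \<Longrightarrow> (f ^^ n) v \<in> zvec d"
  by (cases n) (simp_all add: zlinear_def)

text \<open>A map that is injective modulo \<open>P\<close> permutes the finitely many residue
  vectors, so one of its powers is the identity modulo \<open>P\<close>. The pigeonhole principle
  gives two congruent powers, and injectivity cancels the smaller one.\<close>

lemma zlinear_funpow_periodic:
  fixes P :: nat
  assumes f: "zlinear d f" and P: "P > 0"
    and inj: "\<And>v. v \<in> zvec d \<Longrightarrow> (\<forall>k. int P dvd f v k) \<Longrightarrow> (\<forall>k. int P dvd v k)"
  shows "\<exists>b>0. \<forall>v\<in>zvec d. \<forall>k. int P dvd (f ^^ b) v k - v k"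
proof -
  define S where "S = {v :: nat \<Rightarrow> int. \<forall>k. (k \<in> {..<d} \<longrightarrow> v k \<in> {0..<int P}) \<and> (k \<notin> {..<d} \<longrightarrow> v k = 0)}"
  have finS: "finite S" unfolding S_def by (rule finite_set_of_finite_funs) auto
  \<comment> \<open>\<open>h n\<close> is the table of residues of \<open>f ^^ n\<close> on the
    representatives \<open>S\<close>; only finitely many tables exist.\<close>
  define h where "h n = restrict (\<lambda>(v, k). (f ^^ n) v k mod int P) (S \<times> {..<d})" for n
  have "h ` UNIV \<subseteq> (S \<times> {..<d}) \<rightarrow>\<^sub>E {0..<int P}"
    using P by (auto simp: h_def PiE_iff extensional_def split: if_splits)
  moreover have "finite ((S \<times> {..<d}) \<rightarrow>\<^sub>E {0..<int P})"
    using finS by (intro finite_PiE) auto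
  ultimately have "finite (range h)" by (rule finite_subset)
  then have "\<not> inj h" using finite_imageD by auto
  then obtain i j where ij: "i < j" "h i = h j"
    unfolding inj_def by (metis nat_neq_iff)
  have eq_S: "(f ^^ i) v k mod int P = (f ^^ j) v k mod int P" if "v \<in> S" for v k
  proof (cases "k < d")
    case True
    then show ?thesis using fun_cong[OF ij(2), of "(v, k)"] that by (simp add: h_def)
  next
    case False
    have "v \<in> zvec d" using that by (auto simp: S_def zvec_def)
    then have "(f ^^ i) v \<in> zvec d" "(f ^^ j) v \<in> zvec d"
      using f by (auto intro: zlinear_funpow_zvec)
    then show ?thesis using False by (simp add: zvec_def)
  qed
  have eq: "int P dvd (f ^^ j) v k - (f ^^ i) v k" if v: "v \<in> zvec d" for v k
  proof -
    define r where "r k = v k mod int P" for k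
    define q where "q k = v k div int P" for k
    have v_eq: "v = (\<lambda>k. r k + int P * q k)" by (simp add: r_def q_def fun_eq_iff)
    have "r \<in> S" using v P by (auto simp: S_def r_def zvec_def)
    then have "int P dvd (f ^^ j) r k - (f ^^ i) r k"
      by (metis eq_S mod_eq_dvd_iff)
    moreover have "(f ^^ n) v k = (f ^^ n) r k + int P * (f ^^ n) q k" for n
      unfolding v_eq zlinear_funpow_add[OF f] ..
    then have "(f ^^ j) v k - (f ^^ i) v k
        = ((f ^^ j) r k - (f ^^ i) r k) + int P * ((f ^^ j) q k - (f ^^ i) q k)"
      by (simp add: algebra_simps)
    ultimately show ?thesis by (simp only: dvd_add dvd_triv_left)
  qed
  have descend: "(\<forall>k. int P dvd (f ^^ n) v k) \<Longrightarrow> v \<in> zvec d \<Longrightarrow> (\<forall>k. int P dvd v k)" for n v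
  proof (induction n)
    case (Suc n)
    then show ?case
      using inj[of "(f ^^ n) v"] zlinear_funpow_zvec[OF f] by simp
  qed simp
  have "int P dvd (f ^^ (j - i)) v k - v k" if v: "v \<in> zvec d" for v k
  proof -
    define w where "w k = (f ^^ (j - i)) v k + (-1) * v k" for k
    have w: "w \<in> zvec d"
      using v zlinear_funpow_zvec[OF f v] by (auto simp: w_def zvec_def)
    have "(f ^^ i) w = (\<lambda>k. (f ^^ i) ((f ^^ (j - i)) v) k + (-1) * (f ^^ i) v k)"
      unfolding w_def zlinear_funpow_add[OF f] ..
    moreover have "(f ^^ i) ((f ^^ (j - i)) v) = (f ^^ j) v"
      using ij(1) by (metis comp_apply funpow_add le_add_diff_inverse less_imp_le)
    ultimately have "\<forall>k. int P dvd (f ^^ i) w k" using eq[OF v] by simp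
    then have "\<forall>k. int P dvd w k" using w by (rule descend)
    then show ?thesis by (simp add: w_def)
  qed
  then show ?thesis using ij(1) by (intro exI[of _ "j - i"]) auto
qed

lemma sum_choose_Suc:
  fixes x :: "nat \<Rightarrow> int"
  shows "(\<Sum>k\<le>Suc n. int (Suc n choose k) * x k)
    = (\<Sum>k\<le>n. int (n choose k) * x k) + (\<Sum>k\<le>n. int (n choose k) * x (Suc k))"
proof -
  have "(\<Sum>k\<le>Suc n. int (Suc n choose k) * x k)
      = x 0 + (\<Sum>k\<le>n. int (n choose k) * x (Suc k)) + (\<Sum>k\<le>n. int (n choose Suc k) * x (Suc k))"
    unfolding sum.atMost_Suc_shift by (simp add: sum.distrib algebra_simps)
  also have "x 0 + (\<Sum>k\<le>n. int (n choose Suc k) * x (Suc k)) = (\<Sum>k\<le>Suc n. int (n choose k) * x k)"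
    unfolding sum.atMost_Suc_shift by simp
  then have "x 0 + (\<Sum>k\<le>n. int (n choose k) * x (Suc k)) + (\<Sum>k\<le>n. int (n choose Suc k) * x (Suc k))
      = (\<Sum>k\<le>n. int (n choose k) * x k) + (\<Sum>k\<le>n. int (n choose k) * x (Suc k))"
    by simp
  finally show ?thesis .
qed

text \<open>The binomial theorem for \<open>f = 1 + q B\<close>. The induction splits off the
  innermost \<open>f\<close>, because linearity is assumed of \<open>f\<close> and not of
  \<open>B\<close>.\<close>

lemma funpow_binomial_expansion:
  fixes q :: int
  assumes f: "zlinear d f" and B: "\<And>v. v \<in> zvec d \<Longrightarrow> f v = (\<lambda>k. v k + q * B v k)"
    and B_zvec: "\<And>v. v \<in> zvec d \<Longrightarrow> B v \<in> zvec d"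
  shows "w \<in> zvec d \<Longrightarrow> (f ^^ n) w k = (\<Sum>l\<le>n. int (n choose l) * (q ^ l * (B ^^ l) w k))"
proof (induction n arbitrary: w)
  case 0 then show ?case by simp
next
  case (Suc n)
  have "(f ^^ Suc n) w k = (f ^^ n) (f w) k" by (simp add: funpow_swap1)
  also have "\<dots> = (f ^^ n) w k + q * (f ^^ n) (B w) k"
    unfolding B[OF Suc.prems] zlinear_funpow_add[OF f] ..
  also have "\<dots> = (\<Sum>l\<le>n. int (n choose l) * (q ^ l * (B ^^ l) w k))
      + q * (\<Sum>l\<le>n. int (n choose l) * (q ^ l * (B ^^ l) (B w) k))"
    using Suc.IH Suc.prems B_zvec by simp
  also have "q * (\<Sum>l\<le>n. int (n choose l) * (q ^ l * (B ^^ l) (B w) k))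
      = (\<Sum>l\<le>n. int (n choose l) * (q ^ Suc l * (B ^^ Suc l) w k))"
    by (simp add: sum_distrib_left funpow_swap1 mult_ac)
  finally show ?case
    unfolding sum_choose_Suc[of n "\<lambda>l. q ^ l * (B ^^ l) w k"] .
qed

lemma infinite_residue_class:
  assumes "infinite N" "b > (0::nat)"
  shows "\<exists>a. infinite {m. a + b * m \<in> N}"
proof (rule ccontr)
  assume "\<not> ?thesis"
  then have fin: "finite {m. a + b * m \<in> N}" for a by simp
  have "N \<subseteq> (\<Union>a<b. (\<lambda>m. a + b * m) ` {m. a + b * m \<in> N})"
  proof
    fix n assume "n \<in> N"
    then have "n = n mod b + b * (n div b)" "n mod b < b" "n mod b + b * (n div b) \<in> N"
      using assms(2) by simp_all
    then show "n \<in> (\<Union>a<b. (\<lambda>m. a + b * m) ` {m. a + b * m \<in> N})" by blast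
  qed
  then show False using fin assms(1) by (meson finite_UN_I finite_imageI finite_lessThan finite_subset)
qed

text \<open>A common power \<open>c\<close> makes every \<open>f i ^^ c\<close> the identity modulo
  \<open>p ^ 2\<close>. Some residue class modulo \<open>c\<close> contains infinitely many zeros;
  on it each coordinate of the sum is a binomial sum in powers of \<open>p ^ 2\<close>, and
  \<open>binomial_sum_infinite_zeros\<close> makes it vanish on the whole class.\<close>

lemma skolem_mahler_lech:
  fixes p :: nat and f :: "'i \<Rightarrow> (nat \<Rightarrow> int) \<Rightarrow> nat \<Rightarrow> int"
  assumes I: "finite I" and p: "prime p"
    and f: "\<And>i. i \<in> I \<Longrightarrow> zlinear d (f i)"
    and inj: "\<And>i v. i \<in> I \<Longrightarrow> v \<in> zvec d \<Longrightarrow> (\<forall>k. int (p ^ 2) dvd f i v k) \<Longrightarrow> (\<forall>k. int (p ^ 2) dvd v k)"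
    and v: "\<And>i. i \<in> I \<Longrightarrow> v i \<in> zvec d"
    and inf: "infinite {n. \<forall>k. (\<Sum>i\<in>I. (f i ^^ n) (v i) k) = 0}"
  shows "\<exists>a b. b > 0 \<and> (\<forall>n k. (\<Sum>i\<in>I. (f i ^^ (a + b * n)) (v i) k) = 0)"
proof -
  have "\<exists>b>0. \<forall>v\<in>zvec d. \<forall>k. int (p ^ 2) dvd (f i ^^ b) v k - v k" if "i \<in> I" for i
    using zlinear_funpow_periodic[OF f[OF that] _ inj[OF that]] prime_gt_0_nat[OF p] by simp
  then obtain b where b: "\<And>i. i \<in> I \<Longrightarrow> b i > 0"
      "\<And>i v k. i \<in> I \<Longrightarrow> v \<in> zvec d \<Longrightarrow> int (p ^ 2) dvd (f i ^^ b i) v k - v k"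
    by metis
  define c where "c = (\<Prod>i\<in>I. b i)"
  have c: "c > 0" using b(1) by (auto simp: c_def intro: prod_pos)
  have per: "int (p ^ 2) dvd (f i ^^ c) v k - v k" if i: "i \<in> I" and v: "v \<in> zvec d" for i v k
  proof -
    obtain e where e: "c = b i * e" using dvd_prodI[OF I i, of b] by (auto simp: c_def)
    have "int (p ^ 2) dvd ((f i ^^ b i) ^^ e) v k - v k" for e
    proof (induction e)
      case (Suc e)
      have "int (p ^ 2) dvd (f i ^^ b i) (((f i ^^ b i) ^^ e) v) k - ((f i ^^ b i) ^^ e) v k"
        using i v f by (intro b(2)) (auto simp: funpow_mult intro: zlinear_funpow_zvec)
      from dvd_add[OF this Suc] show ?case by simp
    qed simp
    then show ?thesis by (simp add: e funpow_mult)
  qed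
  \<comment> \<open>By \<open>per\<close> the division is exact on \<open>zvec d\<close>, where
    \<open>f i ^^ c\<close> is thus the identity plus \<open>p ^ 2\<close> times
    \<open>B i\<close>.\<close>
  define B where "B i v k = ((f i ^^ c) v k - v k) div int (p ^ 2)" for i v k
  obtain a where a: "infinite {m. a + c * m \<in> {n. \<forall>k. (\<Sum>i\<in>I. (f i ^^ n) (v i) k) = 0}}"
    using infinite_residue_class[OF inf c] by blast
  have lin: "zlinear d (f i ^^ c)" if "i \<in> I" for i
    using f[OF that] c zlinear_funpow_add[OF f[OF that]]
    by (cases c) (auto simp: zlinear_def)
  have expand: "(f i ^^ (a + c * m)) (v i) k
      = (\<Sum>l\<le>m. int (m choose l) * (int (p ^ 2) ^ l * (B i ^^ l) ((f i ^^ a) (v i)) k))"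
    if i: "i \<in> I" for i m k
  proof -
    have "(f i ^^ (a + c * m)) (v i) k = ((f i ^^ c) ^^ m) ((f i ^^ a) (v i)) k"
      unfolding funpow_mult add.commute[of a] by (simp add: funpow_add mult.commute)
    also have "\<dots> = (\<Sum>l\<le>m. int (m choose l) * (int (p ^ 2) ^ l * (B i ^^ l) ((f i ^^ a) (v i)) k))"
    proof (rule funpow_binomial_expansion[OF lin[OF i]])
      fix v assume v: "v \<in> zvec d"
      show "(f i ^^ c) v = (\<lambda>k. v k + int (p ^ 2) * B i v k)"
        using per[OF i v] by (simp add: B_def fun_eq_iff del: of_nat_power)
      show "B i v \<in> zvec d"
        using v lin[OF i] by (simp add: zvec_def B_def zlinear_def)
    next
      show "(f i ^^ a) (v i) \<in> zvec d" using f[OF i] v[OF i] by (rule zlinear_funpow_zvec)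
    qed
    finally show ?thesis .
  qed
  define D where "D k l = (\<Sum>i\<in>I. (B i ^^ l) ((f i ^^ a) (v i)) k)" for k l
  have sum_eq: "(\<Sum>i\<in>I. (f i ^^ (a + c * m)) (v i) k)
      = (\<Sum>l\<le>m. int (m choose l) * int p ^ (2 * l) * D k l)" for m k
  proof -
    have "(\<Sum>i\<in>I. (f i ^^ (a + c * m)) (v i) k)
        = (\<Sum>i\<in>I. \<Sum>l\<le>m. int (m choose l) * (int (p ^ 2) ^ l * (B i ^^ l) ((f i ^^ a) (v i)) k))"
      by (rule sum.cong[OF refl expand])
    also have "\<dots> = (\<Sum>l\<le>m. \<Sum>i\<in>I. int (m choose l) * (int (p ^ 2) ^ l * (B i ^^ l) ((f i ^^ a) (v i)) k))"
      by (rule sum.swap)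
    also have "\<dots> = (\<Sum>l\<le>m. int (m choose l) * int p ^ (2 * l) * D k l)"
      by (simp add: D_def sum_distrib_left power_mult mult.assoc)
    finally show ?thesis .
  qed
  have "(\<Sum>l\<le>m. int (m choose l) * int p ^ (2 * l) * D k l) = 0" for m k
  proof (rule binomial_sum_infinite_zeros[OF p])
    have "{m. a + c * m \<in> {n. \<forall>k. (\<Sum>i\<in>I. (f i ^^ n) (v i) k) = 0}}
        \<subseteq> {m. (\<Sum>l\<le>m. int (m choose l) * int p ^ (2 * l) * D k l) = 0}"
      by (auto simp flip: sum_eq)
    then show "infinite {m. (\<Sum>l\<le>m. int (m choose l) * int p ^ (2 * l) * D k l) = 0}"
      using a finite_subset by blast
  qed
  then show ?thesis using c sum_eq by auto
qed


section \<open>Haar measure, convolution and characters\<close>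

abbreviation cont :: "('a::topological_space \<Rightarrow> 'b::topological_space) \<Rightarrow> bool" where
  "cont f \<equiv> continuous_on UNIV f"

lemma continuous_on_UNIV_distI:
  fixes f :: "'a::topological_space \<Rightarrow> 'b::metric_space"
  assumes "\<And>x e. e > 0 \<Longrightarrow> \<exists>V. open V \<and> x \<in> V \<and> (\<forall>y\<in>V. dist (f y) (f x) \<le> e)"
  shows "cont f"
proof -
  have "(f \<longlongrightarrow> f x) (at x)" for x
  proof (rule tendstoI)
    fix e :: real assume "e > 0"
    then obtain V where "open V" "x \<in> V" "\<forall>y\<in>V. dist (f y) (f x) \<le> e / 2"
      using assms[of "e / 2" x] by auto
    then show "\<forall>\<^sub>F y in at x. dist (f y) (f x) < e"
      unfolding eventually_at_topological using \<open>e > 0\<close> by force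
  qed
  then show ?thesis by (simp add: continuous_on)
qed

text \<open>The model: \<open>a n\<close> is the sum of the powers \<open>Suc n\<close> of the
  eigenvalues of a positive operator, \<open>l\<close> is the largest eigenvalue and
  \<open>M\<close> its multiplicity. Log-convexity makes the ratios increase to \<open>l\<close>;
  submultiplicativity bounds them and keeps the normalised sequence, which decreases, above
  1.\<close>

lemma moment_ratio_limit:
  fixes a :: "nat \<Rightarrow> real"
  assumes pos: "\<And>n. a n > 0"
    and submult: "\<And>n k. a (n + k + 1) \<le> a n * a k"
    and logconvex: "\<And>n. (a (Suc n))\<^sup>2 \<le> a n * a (Suc (Suc n))"
  shows "\<exists>l>0. \<exists>M\<ge>1. (\<lambda>n. a n / l ^ Suc n) \<longlonglongrightarrow> M"
proof -
  define r where "r n = a (Suc n) / a n" for n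
  have r_pos: "r n > 0" for n using pos by (simp add: r_def)
  have "r n \<le> r (Suc n)" for n
    using logconvex[of n] pos[of n] pos[of "Suc n"]
    by (simp add: r_def field_simps power2_eq_square)
  then have r_mono: "incseq r" by (rule incseq_SucI)
  have "r n \<le> a 0" for n
    using submult[of n 0] pos[of n] by (simp add: r_def field_simps)
  then obtain l where l: "r \<longlonglongrightarrow> l" "\<And>n. r n \<le> l"
    using incseq_convergent[OF r_mono, of "a 0"] by blast
  have l_pos: "l > 0" using r_pos[of 0] l(2)[of 0] by linarith
  have lower: "l ^ Suc n \<le> a n" for n
  proof (rule LIMSEQ_le_const2)
    show "(\<lambda>k. r k ^ Suc n) \<longlonglongrightarrow> l ^ Suc n" by (intro tendsto_power l(1))
    \<comment> \<open>The ratios beyond \<open>k\<close> are at least \<open>r k\<close>, so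
      \<open>a k * r k ^ Suc n\<close> is at most \<open>a (k + Suc n)\<close>, and
      submultiplicativity lets \<open>a k\<close> cancel.\<close>
    have "r k ^ Suc n \<le> a n" for k
    proof -
      have "a k * r k ^ j \<le> a (k + j)" for j
      proof (induction j)
        case (Suc j)
        have "a k * r k ^ Suc j = (a k * r k ^ j) * r k" by simp
        also have "\<dots> \<le> a (k + j) * r (k + j)"
          using Suc r_pos[of k] pos[of "k + j"] incseqD[OF r_mono, of k "k + j"]
          by (intro mult_mono) (auto simp: less_imp_le)
        also have "\<dots> = a (k + Suc j)" using pos[of "k + j"] by (simp add: r_def)
        finally show ?case .
      qed simp
      from this[of "Suc n"] have "a k * r k ^ Suc n \<le> a k * a n"
        using submult[of k n] by simp
      then show ?thesis using pos[of k] by simp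
    qed
    then show "\<exists>N. \<forall>k\<ge>N. r k ^ Suc n \<le> a n" by blast
  qed
  define b where "b n = a n / l ^ Suc n" for n
  have "b (Suc n) \<le> b n" for n
  proof -
    have "a (Suc n) \<le> l * a n" using l(2)[of n] pos[of n] by (simp add: r_def field_simps)
    then show ?thesis using l_pos by (simp add: b_def field_simps)
  qed
  then have "decseq b" by (rule decseq_SucI)
  moreover have "\<forall>n. 1 \<le> b n" using lower l_pos by (simp add: b_def)
  ultimately obtain M where M: "b \<longlonglongrightarrow> M" using decseq_convergent by blast
  have "1 \<le> M" using \<open>\<forall>n. 1 \<le> b n\<close> by (intro LIMSEQ_le_const[OF M]) auto
  then show ?thesis using M l_pos unfolding b_def by blast
qed

section \<open>Characters and trigonometric polynomials\<close>

definition character :: "('a::topological_ab_group_add \<Rightarrow> complex) \<Rightarrow> bool" where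
  "character \<xi> \<longleftrightarrow> cont \<xi> \<and> (\<forall>x y. \<xi> (x + y) = \<xi> x * \<xi> y) \<and> (\<forall>x. norm (\<xi> x) = 1)"

lemma character_add: "character \<xi> \<Longrightarrow> \<xi> (x + y) = \<xi> x * \<xi> y"
  by (simp add: character_def)

lemma character_nonzero: "character \<xi> \<Longrightarrow> \<xi> x \<noteq> 0"
  by (metis character_def norm_zero zero_neq_one)

lemma character_0: "character \<xi> \<Longrightarrow> \<xi> 0 = 1"
  using character_add[of \<xi> 0 0] character_nonzero[of \<xi> 0] by simp

lemma character_cnj_mult: "character \<xi> \<Longrightarrow> cnj (\<xi> x) * \<xi> x = 1"
  by (metis character_def complex_norm_square mult.commute of_real_1 power_one)

lemma character_minus: "character \<xi> \<Longrightarrow> \<xi> (- x) = cnj (\<xi> x)"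
  using character_add[of \<xi> "- x" x] character_0[of \<xi>] character_cnj_mult[of \<xi> x] character_nonzero[of \<xi> x]
  by (metis add.left_inverse mult_cancel_right)

lemma character_one: "character (\<lambda>_. 1)"
  by (simp add: character_def)

lemma character_mult: "character \<xi> \<Longrightarrow> character \<psi> \<Longrightarrow> character (\<lambda>x. \<xi> x * \<psi> x)"
  by (auto simp: character_def norm_mult intro!: continuous_intros)

lemma character_cnj: "character \<xi> \<Longrightarrow> character (\<lambda>x. cnj (\<xi> x))"
  by (auto simp: character_def intro!: continuous_intros)

lemma character_prod: "(\<And>i. i \<in> I \<Longrightarrow> character (\<xi> i)) \<Longrightarrow> character (\<lambda>x. \<Prod>i\<in>I. \<xi> i x)"
  by (induction I rule: infinite_finite_induct) (auto intro: character_one character_mult)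

lemma character_powi: "character \<xi> \<Longrightarrow> character (\<lambda>x. \<xi> x powi k)"
  using character_nonzero[of \<xi>]
  by (auto simp: character_def power_int_mult_distrib norm_power_int intro!: continuous_intros)

lemma character_epimorphism: "character \<xi> \<Longrightarrow> epimorphism T \<Longrightarrow> character (\<lambda>x. \<xi> (T x))"
  unfolding character_def epimorphism_def
  by (auto intro: continuous_on_compose2[of UNIV \<xi> UNIV T])

inductive trig :: "('a::topological_ab_group_add \<Rightarrow> complex) \<Rightarrow> bool" where
  monomial: "character \<xi> \<Longrightarrow> trig (\<lambda>x. c * \<xi> x)"
| add: "trig f \<Longrightarrow> trig g \<Longrightarrow> trig (\<lambda>x. f x + g x)"

lemma trig_continuous: "trig f \<Longrightarrow> cont f"
proof (induction rule: trig.induct)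
  case (monomial \<xi> c)
  then show ?case unfolding character_def by (elim conjE) (intro continuous_intros)
next
  case (add f g)
  then show ?case by (intro continuous_intros)
qed

lemma trig_mult: "trig f \<Longrightarrow> trig g \<Longrightarrow> trig (\<lambda>x. f x * g x)"
proof (induction rule: trig.induct)
  case (monomial \<xi> c)
  show ?case
    using monomial(2)
  proof (induction rule: trig.induct)
    case (monomial \<psi> d)
    have "trig (\<lambda>x. (c * d) * (\<xi> x * \<psi> x))"
      using character_mult[OF \<open>character \<xi>\<close> monomial] by (rule trig.monomial)
    then show ?case by (simp add: mult_ac)
  next
    case (add f g)
    from trig.add[OF add.IH] show ?case by (simp add: distrib_left)
  qed
next
  case (add f g)
  from trig.add[OF add.IH] add.prems show ?case by (simp add: distrib_right)
qed

lemma trig_eq_sum: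
  assumes "trig f"
  shows "\<exists>K c. finite K \<and> (\<forall>\<xi>\<in>K. character \<xi>) \<and> f = (\<lambda>x. \<Sum>\<xi>\<in>K. c \<xi> * \<xi> x)"
  using assms
proof (induction rule: trig.induct)
  case (monomial \<xi> c)
  then show ?case by (intro exI[of _ "{\<xi>}"] exI[of _ "\<lambda>_. c"]) simp
next
  case (add f g)
  from add.IH(1) obtain K c where K: "finite K" "\<forall>\<xi>\<in>K. character \<xi>" "f = (\<lambda>x. \<Sum>\<xi>\<in>K. c \<xi> * \<xi> x)"
    by blast
  from add.IH(2) obtain L d where L: "finite L" "\<forall>\<xi>\<in>L. character \<xi>" "g = (\<lambda>x. \<Sum>\<xi>\<in>L. d \<xi> * \<xi> x)"
    by blast
  define e where "e \<xi> = (if \<xi> \<in> K then c \<xi> else 0) + (if \<xi> \<in> L then d \<xi> else 0)" for \<xi>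
  have "(\<Sum>\<xi>\<in>K. c \<xi> * \<xi> x) = (\<Sum>\<xi>\<in>K \<union> L. (if \<xi> \<in> K then c \<xi> else 0) * \<xi> x)" for x
    using K(1) L(1) by (intro sum.mono_neutral_cong_left) auto
  moreover have "(\<Sum>\<xi>\<in>L. d \<xi> * \<xi> x) = (\<Sum>\<xi>\<in>K \<union> L. (if \<xi> \<in> L then d \<xi> else 0) * \<xi> x)" for x
    using K(1) L(1) by (intro sum.mono_neutral_cong_left) auto
  ultimately have "(\<lambda>x. f x + g x) = (\<lambda>x. \<Sum>\<xi>\<in>K \<union> L. e \<xi> * \<xi> x)"
    unfolding K(3) L(3) by (simp add: e_def sum.distrib distrib_right)
  then show ?case using K L by (intro exI[of _ "K \<union> L"] exI[of _ e]) auto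
qed

section \<open>Integration of continuous functions against Haar measure\<close>

locale haar_group =
  fixes m :: "'a::{topological_ab_group_add, t2_space} measure"
  assumes compact_UNIV: "compact (UNIV :: 'a set)"
    and haar: "normalized_haar m"
begin

lemma sets_m [measurable_cong, simp]: "sets m = sets borel"
  using haar unfolding normalized_haar_def by (elim conjE) assumption

lemma space_m [simp]: "space m = UNIV"
  using sets_eq_imp_space_eq[OF sets_m] by simp

lemma emeasure_UNIV: "emeasure m UNIV = 1"
  using haar unfolding normalized_haar_def by (elim conjE) assumption

lemma emeasure_translation:
  assumes "A \<in> sets m"
  shows "emeasure m ((\<lambda>x. g + x) ` A) = emeasure m A"
proof -
  have "\<forall>g. \<forall>A\<in>sets m. emeasure m ((\<lambda>x. g + x) ` A) = emeasure m A"
    using haar unfolding normalized_haar_def by (elim conjE) assumption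
  then show ?thesis using assms by blast
qed

lemma outer_regular:
  assumes "A \<in> sets m"
  shows "emeasure m A = (INF U\<in>{U. open U \<and> A \<subseteq> U}. emeasure m U)"
proof -
  have "\<forall>A\<in>sets m. emeasure m A = (INF U\<in>{U. open U \<and> A \<subseteq> U}. emeasure m U)"
    using haar unfolding normalized_haar_def by (elim conjE) assumption
  then show ?thesis using assms by (rule bspec)
qed

lemma inner_regular:
  assumes "open U"
  shows "emeasure m U = (SUP K\<in>{K. compact K \<and> K \<subseteq> U}. emeasure m K)"
proof -
  have "\<forall>U. open U \<longrightarrow> emeasure m U = (SUP K\<in>{K. compact K \<and> K \<subseteq> U}. emeasure m K)"
    using haar unfolding normalized_haar_def by (elim conjE) assumption
  then show ?thesis using assms by blast
qed

sublocale finite_measure m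
  by (rule finite_measureI) (simp add: emeasure_UNIV)

lemma measure_UNIV [simp]: "measure m UNIV = 1"
  by (simp add: measure_def emeasure_UNIV)

lemma continuous_measurable [measurable (raw)]:
  "cont f \<Longrightarrow> f \<in> borel_measurable m"
  using borel_measurable_continuous_onI by (simp add: measurable_cong_sets[OF sets_m refl])

lemma continuous_bounded:
  fixes f :: "'a \<Rightarrow> 'b::real_normed_vector"
  assumes "cont f"
  obtains B where "B > 0" "\<And>x. norm (f x) \<le> B"
proof -
  have "bounded (range f)"
    using compact_continuous_image[OF assms compact_UNIV] by (rule compact_imp_bounded)
  then show ?thesis using that unfolding bounded_pos by auto
qed

lemma continuous_integrable:
  fixes f :: "'a \<Rightarrow> 'b::{banach, second_countable_topology}"
  assumes "cont f"
  shows "integrable m f"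
proof -
  obtain B where "\<And>x. norm (f x) \<le> B" using continuous_bounded[OF assms] by blast
  then show ?thesis
    using continuous_measurable[OF assms] by (intro integrable_const_bound[of _ B]) auto
qed

lemma norm_integral_le:
  fixes f :: "'a \<Rightarrow> 'b::{banach, second_countable_topology}"
  assumes "f \<in> borel_measurable m" "\<And>x. norm (f x) \<le> B"
  shows "norm (\<integral>x. f x \<partial>m) \<le> B"
proof -
  have int: "integrable m f" using assms by (intro integrable_const_bound[of _ B]) auto
  have "norm (\<integral>x. f x \<partial>m) \<le> (\<integral>x. norm (f x) \<partial>m)" by (rule integral_norm_bound)
  also have "\<dots> \<le> (\<integral>x. B \<partial>m)" using int assms(2) by (intro integral_mono) auto
  finally show ?thesis by simp
qed

lemma integrable_indicator_set: "A \<in> sets m \<Longrightarrow> integrable m (indicator A :: 'a \<Rightarrow> real)"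
  by (intro integrable_const_bound[of _ 1] borel_measurable_indicator) (auto simp: indicator_def)

lemma distr_translation: "distr m m (\<lambda>x. a + x) = m"
proof (rule measure_eqI)
  fix A assume "A \<in> sets (distr m m (\<lambda>x. a + x))"
  then have A: "A \<in> sets m" by simp
  have [measurable]: "(\<lambda>x. a + x) \<in> measurable m m"
    by (simp add: measurable_cong_sets[OF sets_m sets_m] borel_measurable_continuous_onI continuous_intros)
  have "(\<lambda>x. a + x) -` A = (\<lambda>x. - a + x) ` A"
    by (force simp: image_iff)
  then have "emeasure (distr m m (\<lambda>x. a + x)) A = emeasure m ((\<lambda>x. - a + x) ` A)"
    using A by (simp add: emeasure_distr)
  also have "\<dots> = emeasure m A" using A by (rule emeasure_translation)
  finally show "emeasure (distr m m (\<lambda>x. a + x)) A = emeasure m A" .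
qed simp

lemma integral_translation:
  fixes f :: "'a \<Rightarrow> 'b::{banach, second_countable_topology}"
  assumes "cont f"
  shows "(\<integral>x. f (a + x) \<partial>m) = (\<integral>x. f x \<partial>m)"
proof -
  have "(\<lambda>x. a + x) \<in> measurable m m"
    by (simp add: measurable_cong_sets[OF sets_m sets_m] borel_measurable_continuous_onI continuous_intros)
  from integral_distr[OF this continuous_measurable[OF assms]] show ?thesis
    by (simp add: distr_translation)
qed

text \<open>The tube lemma: compactness of the second factor makes continuity in the first variable
  uniform in the second.\<close>

lemma uniform_slice:
  fixes F :: "'a \<times> 'a \<Rightarrow> 'b::metric_space"
  assumes "cont F" "e > 0"
  obtains V where "open V" "x0 \<in> V" "\<And>x y. x \<in> V \<Longrightarrow> dist (F (x, y)) (F (x0, y)) \<le> e"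
proof (rule continuous_on_prod_compactE[of UNIV UNIV F x0 e])
  show "continuous_on (UNIV \<times> UNIV) F" using assms by simp
  fix V assume "x0 \<in> V" "open V" "\<forall>x\<in>V \<inter> UNIV. \<forall>t\<in>UNIV. dist (F (x, t)) (F (x0, t)) \<le> e"
  then show thesis by (intro that[of V]) auto
qed (use assms compact_UNIV in auto)

text \<open>
  Without second countability the Borel sets of \<open>'a \<times> 'a\<close> need not belong to the product
  \<open>\<sigma>\<close>-algebra; continuous functions are nevertheless product measurable, as uniform limits of
  functions that are piecewise independent of the first coordinate.
\<close>
lemma continuous_pair_measurable:
  fixes F :: "'a \<times> 'a \<Rightarrow> complex"
  assumes F: "cont F"
  shows "F \<in> borel_measurable (m \<Otimes>\<^sub>M m)"
proof -
  have step: "\<exists>s \<in> borel_measurable (m \<Otimes>\<^sub>M m). \<forall>z. dist (s z) (F z) \<le> e" if e: "e > 0" for e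
  proof -
    have "\<exists>V. open V \<and> x0 \<in> V \<and> (\<forall>x\<in>V. \<forall>y. dist (F (x, y)) (F (x0, y)) \<le> e)" for x0
      using uniform_slice[OF F e, of x0] by metis
    then obtain V where V: "\<And>x0. open (V x0)" "\<And>x0. x0 \<in> V x0"
        "\<And>x0 x y. x \<in> V x0 \<Longrightarrow> dist (F (x, y)) (F (x0, y)) \<le> e"
      by metis
    obtain I where I: "finite I" "UNIV \<subseteq> (\<Union>i\<in>I. V i)"
      by (rule compactE_image[OF compact_UNIV, of UNIV V]) (use V in auto)
    have slice: "(\<lambda>z. F (i, snd z)) \<in> borel_measurable (m \<Otimes>\<^sub>M m)" for i
    proof -
      have "cont (\<lambda>y. F (i, y))"
        by (intro continuous_on_compose2[OF F]) (auto intro!: continuous_intros)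
      then have "(\<lambda>y. F (i, y)) \<in> borel_measurable m" by (rule continuous_measurable)
      then show ?thesis by measurable
    qed
    have "finite J \<Longrightarrow> \<exists>s \<in> borel_measurable (m \<Otimes>\<^sub>M m).
        \<forall>x\<in>(\<Union>i\<in>J. V i). \<forall>y. dist (s (x, y)) (F (x, y)) \<le> e" for J
    proof (induction J rule: finite_induct)
      case empty
      show ?case by (rule bexI[of _ "\<lambda>_. 0"]) auto
    next
      case (insert i J)
      then obtain s where s: "s \<in> borel_measurable (m \<Otimes>\<^sub>M m)"
          "\<And>x y. x \<in> (\<Union>i\<in>J. V i) \<Longrightarrow> dist (s (x, y)) (F (x, y)) \<le> e" by blast
      have "V i \<in> sets m" using V(1) by simp
      then have P: "{z \<in> space (m \<Otimes>\<^sub>M m). fst z \<in> V i} \<in> sets (m \<Otimes>\<^sub>M m)" by measurable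
      \<comment> \<open>Where neighbourhoods overlap, the one added last takes precedence; either
        choice is within \<open>e\<close> of \<open>F\<close>.\<close>
      define s' where "s' z = (if fst z \<in> V i then F (i, snd z) else s z)" for z
      have "s' \<in> borel_measurable (m \<Otimes>\<^sub>M m)"
        unfolding s'_def[abs_def] using slice s(1) P by (rule measurable_If)
      moreover have "dist (s' (x, y)) (F (x, y)) \<le> e" if x: "x \<in> (\<Union>i\<in>insert i J. V i)" for x y
      proof (cases "x \<in> V i")
        case True
        then show ?thesis using V(3)[of x i y] by (simp add: s'_def dist_commute)
      next
        case False
        then show ?thesis using x s(2)[of x y] by (simp add: s'_def)
      qed
      ultimately show ?case by blast
    qed
    from this[OF I(1)] I(2) show ?thesis by (metis UNIV_I subsetD surj_pair)
  qed
  have "\<forall>n::nat. \<exists>s. s \<in> borel_measurable (m \<Otimes>\<^sub>M m) \<and> (\<forall>z. dist (s z) (F z) \<le> inverse (Suc n))"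
    using step by (metis of_nat_0_less_iff positive_imp_inverse_positive zero_less_Suc)
  then obtain s where s: "\<And>n::nat. s n \<in> borel_measurable (m \<Otimes>\<^sub>M m)"
      "\<And>n z. dist (s n z) (F z) \<le> inverse (Suc n)" by metis
  show ?thesis
  proof (rule borel_measurable_LIMSEQ_metric[OF s(1)])
    fix z
    show "(\<lambda>n. s n z) \<longlonglongrightarrow> F z"
    proof (subst tendsto_dist_iff, rule tendsto_sandwich[OF _ _ tendsto_const LIMSEQ_inverse_real_of_nat])
      show "\<forall>\<^sub>F n in sequentially. dist (s n z) (F z) \<le> inverse (real (Suc n))"
        using s(2) by (intro always_eventually allI)
    qed simp
  qed
qed

lemma integral_swap:
  fixes F :: "'a \<times> 'a \<Rightarrow> complex"
  assumes F: "cont F"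
  shows "(\<integral>x. \<integral>y. F (x, y) \<partial>m \<partial>m) = (\<integral>y. \<integral>x. F (x, y) \<partial>m \<partial>m)"
proof -
  interpret P: pair_sigma_finite m m ..
  interpret Q: finite_measure "m \<Otimes>\<^sub>M m" by (intro finite_measure_pair_measure finite_measure_axioms)
  have "compact (UNIV :: ('a \<times> 'a) set)" using compact_Times[OF compact_UNIV compact_UNIV] by simp
  then have "bounded (range F)" by (rule compact_imp_bounded[OF compact_continuous_image[OF F]])
  then obtain B where "\<And>z. norm (F z) \<le> B" unfolding bounded_iff by (meson rangeI)
  then have "integrable (m \<Otimes>\<^sub>M m) F"
    using continuous_pair_measurable[OF F] by (intro Q.integrable_const_bound[of _ B]) auto
  then have "integrable (m \<Otimes>\<^sub>M m) (case_prod (\<lambda>x y. F (x, y)))" by (simp add: case_prod_unfold)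
  from P.Fubini_integral[OF this] show ?thesis by simp
qed

lemma continuous_integral:
  fixes F :: "'a \<times> 'a \<Rightarrow> complex"
  assumes F: "cont F"
  shows "cont (\<lambda>x. \<integral>y. F (x, y) \<partial>m)"
proof (rule continuous_on_UNIV_distI)
  fix x0 :: 'a and e :: real assume e: "e > 0"
  obtain V where V: "open V" "x0 \<in> V" "\<And>x y. x \<in> V \<Longrightarrow> dist (F (x, y)) (F (x0, y)) \<le> e"
    using uniform_slice[OF F e] by blast
  have slice: "cont (\<lambda>y. F (x, y))" for x
    by (intro continuous_on_compose2[OF F]) (auto intro!: continuous_intros)
  have "dist (\<integral>y. F (x, y) \<partial>m) (\<integral>y. F (x0, y) \<partial>m) \<le> e" if "x \<in> V" for x
  proof -
    have "dist (\<integral>y. F (x, y) \<partial>m) (\<integral>y. F (x0, y) \<partial>m) = norm (\<integral>y. F (x, y) - F (x0, y) \<partial>m)"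
      by (simp add: dist_norm continuous_integrable slice)
    also have "\<dots> \<le> e"
      using V(3)[OF that] slice
      by (intro norm_integral_le) (auto simp: dist_norm intro!: continuous_measurable continuous_intros)
    finally show ?thesis .
  qed
  then show "\<exists>V. open V \<and> x0 \<in> V \<and> (\<forall>x\<in>V. dist (\<integral>y. F (x, y) \<partial>m) (\<integral>y. F (x0, y) \<partial>m) \<le> e)"
    using V by blast
qed

lemma continuous_UNIV_compose:
  "cont f \<Longrightarrow> cont g \<Longrightarrow> cont (\<lambda>x. f (g x))"
  by (rule continuous_on_compose2) auto

text \<open>Integrate \<open>f (x - y)\<close> over both variables: taking \<open>x\<close> first
  gives the integral of \<open>f\<close>, taking \<open>y\<close> first gives that of
  \<open>f (- y)\<close>.\<close>

lemma integral_reflect: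
  fixes f :: "'a \<Rightarrow> complex"
  assumes f: "cont f"
  shows "(\<integral>x. f (- x) \<partial>m) = (\<integral>x. f x \<partial>m)"
proof -
  have c: "cont (\<lambda>z :: 'a \<times> 'a. f (fst z - snd z))"
    by (intro continuous_UNIV_compose[OF f] continuous_intros)
  have "(\<integral>x. f (x - y) \<partial>m) = (\<integral>x. f x \<partial>m)" for y
    using integral_translation[OF f, of "- y"] by (simp add: add.commute)
  moreover have "(\<integral>y. f (x - y) \<partial>m) = (\<integral>y. f (- y) \<partial>m)" for x
  proof -
    have "cont (\<lambda>y. f (- y))"
      by (intro continuous_UNIV_compose[OF f] continuous_intros)
    from integral_translation[OF this, of "- x"] show ?thesis by simp
  qed
  ultimately show ?thesis using integral_swap[OF c] by simp
qed

section \<open>The convolution algebra\<close>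

definition conv :: "('a \<Rightarrow> complex) \<Rightarrow> ('a \<Rightarrow> complex) \<Rightarrow> 'a \<Rightarrow> complex" where
  "conv f g x = (\<integral>y. f (x - y) * g y \<partial>m)"

text \<open>The involution of the algebra: convolution with \<open>adj f\<close> is the Hilbert
  space adjoint of convolution with \<open>f\<close>.\<close>

definition adj :: "('a \<Rightarrow> complex) \<Rightarrow> 'a \<Rightarrow> complex" where
  "adj f x = cnj (f (- x))"

definition nsq :: "('a \<Rightarrow> complex) \<Rightarrow> real" where
  "nsq f = (\<integral>x. (norm (f x))\<^sup>2 \<partial>m)"

lemma conv_integrand_continuous:
  fixes f g :: "'a \<Rightarrow> complex"
  assumes "cont f" "cont g"
  shows "cont (\<lambda>y. f (x - y) * g y)"
  by (intro continuous_on_mult continuous_UNIV_compose[OF assms(1)] assms(2) continuous_intros)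

lemma continuous_conv:
  assumes "cont f" "cont g"
  shows "cont (conv f g)"
proof -
  have "cont (\<lambda>z :: 'a \<times> 'a. f (fst z - snd z) * g (snd z))"
    by (intro continuous_intros continuous_UNIV_compose[OF assms(1)] continuous_UNIV_compose[OF assms(2)])
  from continuous_integral[OF this] show ?thesis by (simp add: conv_def[abs_def])
qed

lemma continuous_adj:
  assumes "cont f"
  shows "cont (adj f)"
  unfolding adj_def[abs_def] by (intro continuous_intros continuous_UNIV_compose[OF assms])

lemma conv_commute:
  assumes "cont f" "cont g"
  shows "conv f g = conv g f"
proof
  fix x
  have c: "cont (\<lambda>y. g (x - y) * f y)"
    using assms by (intro conv_integrand_continuous)
  then have c': "cont (\<lambda>y. g (x - (x + y)) * f (x + y))"
    by (rule continuous_UNIV_compose) (intro continuous_intros)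
  have "conv g f x = (\<integral>y. g (x - (x + y)) * f (x + y) \<partial>m)"
    unfolding conv_def using integral_translation[OF c, of x] by simp
  also have "\<dots> = (\<integral>y. g (x - (x + - y)) * f (x + - y) \<partial>m)"
    using integral_reflect[OF c'] by simp
  also have "\<dots> = conv f g x" by (simp add: conv_def mult.commute)
  finally show "conv f g x = conv g f x" by simp
qed

lemma conv_assoc:
  assumes f: "cont f" and g: "cont g" and h: "cont h"
  shows "conv (conv f g) h = conv f (conv g h)"
proof
  fix x
  have c: "cont (\<lambda>p :: 'a \<times> 'a. f (x - snd p) * g (snd p - fst p) * h (fst p))"
    by (intro continuous_intros continuous_UNIV_compose[OF f] continuous_UNIV_compose[OF g]
        continuous_UNIV_compose[OF h])
  have "conv f g (x - y) = (\<integral>z. f (x - z) * g (z - y) \<partial>m)" for y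
  proof -
    have "cont (\<lambda>z. f (x - y - z) * g z)"
      using f g by (intro conv_integrand_continuous)
    from integral_translation[OF this, of "- y"]
    have "conv f g (x - y) = (\<integral>z. f (x - y - (- y + z)) * g (- y + z) \<partial>m)"
      by (simp only: conv_def)
    also have "(\<lambda>z. f (x - y - (- y + z)) * g (- y + z)) = (\<lambda>z. f (x - z) * g (z - y))"
      by (simp add: fun_eq_iff)
    finally show ?thesis .
  qed
  then have "conv (conv f g) h x = (\<integral>y. (\<integral>z. f (x - z) * g (z - y) * h y \<partial>m) \<partial>m)"
    by (simp add: conv_def[of "conv f g"])
  also have "\<dots> = (\<integral>z. (\<integral>y. f (x - z) * g (z - y) * h y \<partial>m) \<partial>m)"
    using integral_swap[OF c] by simp
  also have "\<dots> = conv f (conv g h) x"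
    by (simp add: conv_def mult.assoc)
  finally show "conv (conv f g) h x = conv f (conv g h) x" .
qed

lemma adj_conv:
  assumes "cont f" "cont g"
  shows "adj (conv f g) = conv (adj f) (adj g)"
proof
  fix x
  have c: "cont (\<lambda>y. adj f (x - y) * adj g y)"
    using assms by (intro conv_integrand_continuous continuous_adj)
  have "adj (conv f g) x = (\<integral>y. cnj (f (- x - y) * g y) \<partial>m)"
    unfolding adj_def conv_def by (rule Bochner_Integration.integral_cnj[symmetric])
  also have "\<dots> = (\<integral>y. adj f (x - - y) * adj g (- y) \<partial>m)"
    by (simp add: adj_def)
  also have "\<dots> = conv (adj f) (adj g) x"
    unfolding conv_def using integral_reflect[OF c] by simp
  finally show "adj (conv f g) x = conv (adj f) (adj g) x" .
qed

lemma conv_add_right: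
  assumes "cont f" "cont g" "cont h"
  shows "conv f (\<lambda>x. g x + c * h x) = (\<lambda>x. conv f g x + c * conv f h x)"
proof
  fix x
  have "(\<integral>y. f (x - y) * (g y + c * h y) \<partial>m) = (\<integral>y. f (x - y) * g y + c * (f (x - y) * h y) \<partial>m)"
    by (simp add: algebra_simps)
  also have "\<dots> = (\<integral>y. f (x - y) * g y \<partial>m) + c * (\<integral>y. f (x - y) * h y \<partial>m)"
    using assms by (subst Bochner_Integration.integral_add)
      (auto intro!: continuous_integrable continuous_intros conv_integrand_continuous)
  finally show "conv f (\<lambda>x. g x + c * h x) x = conv f g x + c * conv f h x"
    by (simp add: conv_def)
qed

lemma conv_scale_right: "conv f (\<lambda>x. c * g x) = (\<lambda>x. c * conv f g x)"
  by (simp add: conv_def fun_eq_iff mult.left_commute)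

lemma nsq_nonneg: "nsq f \<ge> 0"
  unfolding nsq_def by simp

text \<open>Finitely many translates of a nonempty open set cover the compact group, and all of them
  have the same measure.\<close>

lemma open_null_empty:
  assumes U: "open U" and null: "measure m U = 0"
  shows "U = {}"
proof (rule ccontr)
  assume "U \<noteq> {}"
  then obtain u where u: "u \<in> U" by blast
  have op: "open ((\<lambda>x. g + x) ` U)" for g
  proof -
    have "(\<lambda>x. g + x) ` U = (\<lambda>x. - g + x) -` U" by (force simp: image_iff)
    then show ?thesis using U by (simp add: open_vimage continuous_intros)
  qed
  have cover: "UNIV \<subseteq> (\<Union>g. (\<lambda>x. g + x) ` U)"
  proof
    fix x show "x \<in> (\<Union>g. (\<lambda>x. g + x) ` U)"
      using u by (intro UN_I[of "x - u"] image_eqI[of _ _ u]) auto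
  qed
  obtain I where I: "finite I" "UNIV \<subseteq> (\<Union>g\<in>I. (\<lambda>x. g + x) ` U)"
  proof (rule compactE_image[OF compact_UNIV])
    show "UNIV \<subseteq> (\<Union>g\<in>UNIV. (\<lambda>x. g + x) ` U)" by (rule cover)
  qed (use op in auto)
  have "measure m ((\<lambda>x. g + x) ` U) = 0" for g
    using emeasure_translation[of U g] U null by (simp add: measure_def)
  then have "measure m (\<Union>g\<in>I. (\<lambda>x. g + x) ` U) \<le> 0"
    using finite_measure_subadditive_finite[OF I(1), of "\<lambda>g. (\<lambda>x. g + x) ` U"] op
    by (simp add: image_subset_iff)
  moreover have "(\<Union>g\<in>I. (\<lambda>x. g + x) ` U) = UNIV" using I(2) by blast
  ultimately show False by simp
qed

lemma nsq_eq_0: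
  assumes f: "cont f" and z: "nsq f = 0"
  shows "f = (\<lambda>_. 0)"
proof -
  have c: "cont (\<lambda>x. (norm (f x))\<^sup>2)" using f by (intro continuous_intros)
  have "AE x in m. (norm (f x))\<^sup>2 = 0"
    using z integral_nonneg_eq_0_iff_AE[OF continuous_integrable[OF c]] by (simp add: nsq_def)
  then have "AE x in m. x \<notin> {x. f x \<noteq> 0}" by simp
  moreover have op: "open {x. f x \<noteq> 0}"
    using f by (intro open_Collect_neq continuous_intros)
  ultimately have "emeasure m {x. f x \<noteq> 0} = 0"
    by (subst (asm) AE_iff_measurable[of "{x. f x \<noteq> 0}"]) auto
  then have "{x. f x \<noteq> 0} = {}" using op by (intro open_null_empty) (auto simp: measure_def)
  then show ?thesis by auto
qed

lemma cauchy_schwarz: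
  assumes f: "cont f" and g: "cont g"
  shows "norm (\<integral>x. f x * g x \<partial>m) \<le> sqrt (nsq f * nsq g)"
proof -
  have cf: "cont (\<lambda>x. norm (f x))" and cg: "cont (\<lambda>x. norm (g x))"
    using f g by (auto intro!: continuous_intros)
  define C where "C = (\<integral>x. norm (f x) * norm (g x) \<partial>m)"
  have C: "C \<ge> 0" by (simp add: C_def)
  have quad: "nsq f * s\<^sup>2 - 2 * s * t * C + nsq g * t\<^sup>2 \<ge> 0" for s t
  proof -
    have "0 \<le> (\<integral>x. (s * norm (f x) - t * norm (g x))\<^sup>2 \<partial>m)" by simp
    also have "\<dots> = (\<integral>x. s\<^sup>2 * (norm (f x))\<^sup>2 - 2 * s * t * (norm (f x) * norm (g x)) + t\<^sup>2 * (norm (g x))\<^sup>2 \<partial>m)"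
      by (intro Bochner_Integration.integral_cong) (auto simp: power2_eq_square algebra_simps)
    also have "\<dots> = s\<^sup>2 * nsq f - 2 * s * t * C + t\<^sup>2 * nsq g"
      unfolding nsq_def C_def
      using cf cg by (simp add: continuous_integrable continuous_intros)
    finally show ?thesis by (simp only: mult.commute mult.left_commute)
  qed
  have "C\<^sup>2 \<le> nsq f * nsq g"
  proof (cases "nsq f = 0")
    case True
    then have "f = (\<lambda>_. 0)" using nsq_eq_0 f by blast
    then show ?thesis using True by (simp add: C_def)
  next
    case False
    then have pos: "nsq f > 0" using nsq_nonneg[of f] by simp
    \<comment> \<open>For fixed \<open>t = nsq f\<close> the value \<open>s = C\<close> minimises
      the quadratic form.\<close>
    have "nsq f * (nsq f * nsq g - C\<^sup>2) \<ge> 0"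
      using quad[of C "nsq f"] by (simp add: power2_eq_square algebra_simps)
    then show ?thesis using pos by (simp add: zero_le_mult_iff)
  qed
  then have "C \<le> sqrt (nsq f * nsq g)" by (rule real_le_rsqrt)
  moreover have "norm (\<integral>x. f x * g x \<partial>m) \<le> C"
    unfolding C_def norm_mult[symmetric] by (rule integral_norm_bound)
  ultimately show ?thesis by linarith
qed

lemma nsq_translate_reflect:
  assumes f: "cont f"
  shows "nsq (\<lambda>y. f (x - y)) = nsq f"
proof -
  have c: "cont (\<lambda>y. complex_of_real ((norm (f y))\<^sup>2))"
    using f by (intro continuous_intros)
  have c': "cont (\<lambda>y. complex_of_real ((norm (f (x + y)))\<^sup>2))"
    using f by (intro continuous_intros continuous_UNIV_compose[OF f])
  have "complex_of_real (nsq (\<lambda>y. f (x - y))) = (\<integral>y. complex_of_real ((norm (f (x + - y)))\<^sup>2) \<partial>m)"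
    unfolding nsq_def by (subst integral_complex_of_real) simp
  also have "\<dots> = (\<integral>y. complex_of_real ((norm (f (x + y)))\<^sup>2) \<partial>m)"
    by (rule integral_reflect[OF c'])
  also have "\<dots> = (\<integral>y. complex_of_real ((norm (f y))\<^sup>2) \<partial>m)"
    by (rule integral_translation[OF c])
  also have "\<dots> = complex_of_real (nsq f)"
    unfolding nsq_def by (rule integral_complex_of_real)
  finally show ?thesis by simp
qed

text \<open>A supremum bound by mean square norms: convolving with a fixed function turns mean
  square convergence into uniform convergence, so that limits stay continuous.\<close>

lemma norm_conv_le:
  assumes "cont f" "cont g"
  shows "norm (conv f g x) \<le> sqrt (nsq f * nsq g)"
proof -
  have "cont (\<lambda>y. f (x - y))"
    by (intro continuous_UNIV_compose[OF assms(1)] continuous_intros)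
  from cauchy_schwarz[OF this assms(2)] show ?thesis
    by (simp add: conv_def nsq_translate_reflect[OF assms(1)])
qed

lemma conv_adj_0:
  assumes f: "cont f"
  shows "conv f (adj f) 0 = of_real (nsq f)"
proof -
  have c: "cont (\<lambda>y. complex_of_real ((norm (f y))\<^sup>2))"
    using f by (intro continuous_intros)
  have "conv f (adj f) 0 = (\<integral>y. complex_of_real ((norm (f (- y)))\<^sup>2) \<partial>m)"
    unfolding conv_def adj_def complex_norm_square by simp
  also have "\<dots> = (\<integral>y. complex_of_real ((norm (f y))\<^sup>2) \<partial>m)"
    using integral_reflect[OF c] .
  finally show ?thesis unfolding nsq_def by (simp only: integral_complex_of_real)
qed

lemma conv_tendsto:
  assumes f: "cont f" and h: "\<And>n. cont (h n)"
    and g: "cont g" and lim: "uniform_limit UNIV h g sequentially"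
  shows "(\<lambda>n. conv f (h n) x) \<longlonglongrightarrow> conv f g x"
proof (rule LIMSEQ_I)
  fix r :: real assume r: "r > 0"
  obtain B where B: "B > 0" "\<And>x. norm (f x) \<le> B" using continuous_bounded[OF f] by blast
  have "\<forall>\<^sub>F n in sequentially. \<forall>x\<in>UNIV. dist (h n x) (g x) < r / (2 * B)"
    using uniform_limitD[OF lim, of "r / (2 * B)"] r B(1) by simp
  then obtain N where N: "\<And>n y. n \<ge> N \<Longrightarrow> norm (h n y - g y) < r / (2 * B)"
    unfolding eventually_sequentially dist_norm by auto
  have "norm (conv f (h n) x - conv f g x) < r" if n: "n \<ge> N" for n
  proof -
    have c: "cont (\<lambda>y. f (x - y) * (h n y - g y))"
      using f g h by (intro continuous_intros conv_integrand_continuous)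
    have "conv f (h n) x - conv f g x = (\<integral>y. f (x - y) * (h n y - g y) \<partial>m)"
      unfolding conv_def right_diff_distrib
      using f g h by (simp add: continuous_integrable conv_integrand_continuous)
    also have "norm \<dots> \<le> r / 2"
    proof (rule norm_integral_le[OF continuous_measurable[OF c]])
      fix y
      have "norm (f (x - y)) * norm (h n y - g y) \<le> B * (r / (2 * B))"
        using B N[OF n, of y] by (intro mult_mono) (auto simp: less_imp_le)
      then show "norm (f (x - y) * (h n y - g y)) \<le> r / 2"
        using B(1) by (simp add: norm_mult)
    qed
    finally show ?thesis using r by simp
  qed
  then show "\<exists>N. \<forall>n\<ge>N. norm (conv f (h n) x - conv f g x) < r" by blast
qed


section \<open>Idempotents of the convolution algebra and characters\<close>

definition idem :: "('a \<Rightarrow> complex) \<Rightarrow> bool" where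
  "idem e \<longleftrightarrow> cont e \<and> adj e = e \<and> conv e e = e \<and> e \<noteq> (\<lambda>_. 0)"

lemma conv_self_0:
  assumes "cont f" "adj f = f"
  shows "conv f f 0 = of_real (nsq f)"
  using conv_adj_0[OF assms(1)] assms(2) by simp

text \<open>Convolution with \<open>e\<close> is a projection whose trace, hence rank, is
  \<open>e 0\<close>; this explains the lower bound 1. It is obtained by squaring and integrating
  the pointwise bound of \<open>norm (e x)\<close> by \<open>nsq e\<close>.\<close>

lemma idem_0:
  assumes "idem e"
  shows "e 0 = of_real (nsq e)" "nsq e \<ge> 1"
proof -
  have e: "cont e" "adj e = e" "conv e e = e" "e \<noteq> (\<lambda>_. 0)"
    using assms by (auto simp: idem_def)
  show "e 0 = of_real (nsq e)" using conv_self_0[OF e(1,2)] e(3) by simp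
  have bound: "norm (e x) \<le> nsq e" for x
    using norm_conv_le[OF e(1,1), of x] e(3) nsq_nonneg[of e] by simp
  have "norm (nsq e) \<le> (nsq e)\<^sup>2"
    unfolding nsq_def[of e]
  proof (rule norm_integral_le)
    show "(\<lambda>x. (norm (e x))\<^sup>2) \<in> borel_measurable m"
      using e(1) by (intro continuous_measurable continuous_intros)
    show "norm ((norm (e x))\<^sup>2) \<le> (\<integral>x. (norm (e x))\<^sup>2 \<partial>m)\<^sup>2" for x
      using power_mono[OF bound[of x], of 2] by (simp add: nsq_def)
  qed
  moreover have "nsq e > 0" using nsq_eq_0[OF e(1)] nsq_nonneg[of e] e(4) by fastforce
  ultimately show "nsq e \<ge> 1" by (simp add: power2_eq_square)
qed

text \<open>
  Power iteration: for the convolution powers of a self-adjoint \<open>\<phi>\<close>, suitably rescaled, the values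
  at \<open>0\<close> converge, hence so do the functions; the limit is the spectral projection belonging to
  the largest eigenvalue of convolution with \<open>\<phi> * \<phi>\<close>.
\<close>
lemma spectral_idempotent:
  assumes \<phi>: "cont \<phi>" "adj \<phi> = \<phi>" "\<phi> \<noteq> (\<lambda>_. 0)"
  shows "\<exists>g l. idem g \<and> l > 0 \<and> conv (conv \<phi> \<phi>) g = (\<lambda>x. of_real l * g x) \<and>
    (\<forall>e. cont e \<longrightarrow> conv e \<phi> = \<phi> \<longrightarrow> conv e g = g)"
proof -
  \<comment> \<open>\<open>q n\<close> is the convolution power with exponent \<open>n + 1\<close>,
    since a unit for convolution need not exist. This accounts for the shifts by one that
    follow.\<close>
  define q where "q n = (conv \<phi> ^^ n) \<phi>" for n
  have q_Suc: "q (Suc n) = conv \<phi> (q n)" for n by (simp add: q_def)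
  have q_0: "q 0 = \<phi>" by (simp add: q_def)
  have q_cont: "cont (q n)" for n
    by (induction n) (auto simp: q_0 q_Suc intro: \<phi>(1) continuous_conv)
  have q_conv: "conv (q n) (q k) = q (n + k + 1)" for n k
  proof (induction n)
    case 0 then show ?case by (simp add: q_0 q_Suc)
  next
    case (Suc n)
    then show ?case using conv_assoc[OF \<phi>(1) q_cont q_cont] by (simp add: q_Suc)
  qed
  have q_adj: "adj (q n) = q n" for n
    by (induction n) (simp_all add: q_0 q_Suc \<phi> adj_conv q_cont)
  have q_nz: "q n \<noteq> (\<lambda>_. 0)" for n
  proof (induction n)
    case 0 then show ?case using \<phi> by (simp add: q_0)
  next
    case (Suc n)
    show ?case
    proof
      \<comment> \<open>A nonzero self-adjoint element is not nilpotent: if this power vanishes, so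
        does \<open>q (2 * n + 1) = conv (q n) (q n)\<close>, whose value at 0 is
        \<open>nsq (q n)\<close>.\<close>
      assume z: "q (Suc n) = (\<lambda>_. 0)"
      have "q (2 * n + 1) = (\<lambda>_. 0)"
      proof (cases n)
        case 0 then show ?thesis using z by simp
      next
        case (Suc k)
        then have "q (2 * n + 1) = conv (q (Suc n)) (q k)" by (simp add: q_conv mult_2)
        then show ?thesis using z by (simp add: conv_def fun_eq_iff)
      qed
      then have "conv (q n) (q n) 0 = 0" by (simp add: q_conv mult_2)
      then have "nsq (q n) = 0" using conv_self_0[OF q_cont q_adj] by simp
      then show False using nsq_eq_0[OF q_cont] Suc.IH by blast
    qed
  qed
  \<comment> \<open>The even powers: \<open>p n\<close> is \<open>conv (q n) (adj (q n))\<close>, so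
    its value at 0 is positive and bounds it everywhere.\<close>
  define p where "p n = q (2 * n + 1)" for n
  have p_cont: "cont (p n)" for n by (simp add: p_def q_cont)
  have p_adj: "adj (p n) = p n" for n by (simp add: p_def q_adj)
  have p_conv: "conv (p n) (p k) = p (n + k + 1)" for n k
    by (simp add: p_def q_conv algebra_simps)
  define a where "a n = nsq (q n)" for n
  have p_0: "p n 0 = of_real (a n)" for n
    using conv_self_0[OF q_cont q_adj, of n] by (simp add: p_def a_def q_conv mult_2)
  have p_le: "norm (p n x) \<le> a n" for n x
    using norm_conv_le[OF q_cont q_cont, of n n x] nsq_nonneg[of "q n"]
    by (simp add: p_def a_def q_conv mult_2)
  have a_pos: "a n > 0" for n
    unfolding a_def using nsq_eq_0[OF q_cont] nsq_nonneg[of "q n"] q_nz[of n] by fastforce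
  have "\<exists>l>0. \<exists>M\<ge>1. (\<lambda>n. a n / l ^ Suc n) \<longlonglongrightarrow> M"
  proof (rule moment_ratio_limit[OF a_pos])
    fix n k
    have "norm (conv (p n) (p k) 0) \<le> a n * a k"
      unfolding conv_def
    proof (rule norm_integral_le)
      show "(\<lambda>y. p n (0 - y) * p k y) \<in> borel_measurable m"
        by (intro continuous_measurable conv_integrand_continuous p_cont)
      show "norm (p n (0 - y) * p k y) \<le> a n * a k" for y
        unfolding norm_mult by (intro mult_mono p_le) (auto simp: less_imp_le a_pos)
    qed
    then show "a (n + k + 1) \<le> a n * a k"
      using a_pos[of "n + k + 1"] by (simp add: p_conv p_0)
  next
    fix n
    have "norm (conv (q n) (q (Suc (Suc n))) 0) \<le> sqrt (a n * a (Suc (Suc n)))"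
      unfolding a_def by (rule norm_conv_le[OF q_cont q_cont])
    moreover have "conv (q n) (q (Suc (Suc n))) = p (Suc n)" by (simp add: q_conv p_def mult_2)
    ultimately have "a (Suc n) \<le> sqrt (a n * a (Suc (Suc n)))"
      using p_0[of "Suc n"] a_pos[of "Suc n"] by simp
    then show "(a (Suc n))\<^sup>2 \<le> a n * a (Suc (Suc n))"
      using power_mono[of "a (Suc n)" _ 2] a_pos by (fastforce simp: less_imp_le)
  qed
  then obtain l M where l: "l > 0" and M: "M \<ge> 1" "(\<lambda>n. a n / l ^ Suc n) \<longlonglongrightarrow> M" by blast
  define b where "b n = a n / l ^ Suc n" for n
  \<comment> \<open>Rescaled so that the top eigenvalue becomes 1; the \<open>g n\<close> still
    multiply like powers, and their values at 0 converge.\<close>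
  define g where "g n x = of_real (1 / l ^ Suc n) * p n x" for n x
  have g_cont: "cont (g n)" for n
    unfolding g_def[abs_def] by (intro continuous_intros p_cont)
  have g_adj: "adj (g n) = g n" for n
    using p_adj[of n] by (auto simp: adj_def g_def fun_eq_iff)
  have g_conv: "conv (g n) (g k) = g (n + k + 1)" for n k
  proof -
    have "conv (g n) (g k) = (\<lambda>x. of_real (1 / l ^ Suc k) * conv (g n) (p k) x)"
      unfolding g_def[of k] g_def[of k, abs_def] by (rule conv_scale_right)
    also have "conv (g n) (p k) = conv (p k) (g n)" by (rule conv_commute[OF g_cont p_cont])
    also have "conv (p k) (g n) = (\<lambda>x. of_real (1 / l ^ Suc n) * conv (p k) (p n) x)"
      unfolding g_def[of n, abs_def] by (rule conv_scale_right)
    also have "conv (p k) (p n) = p (n + k + 1)" by (simp add: p_conv add.commute)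
    finally have eq: "conv (g n) (g k)
        = (\<lambda>x. of_real (1 / l ^ Suc k) * (of_real (1 / l ^ Suc n) * p (n + k + 1) x))" .
    show ?thesis
      by (subst eq) (simp add: g_def fun_eq_iff power_add mult_ac)
  qed
  \<comment> \<open>The squared distance of two powers is a combination of values at 0, which are
    already known to converge.\<close>
  have g_diff: "nsq (\<lambda>x. g n x - g k x) = b (n + n + 1) - 2 * b (n + k + 1) + b (k + k + 1)" for n k
  proof -
    let ?h = "\<lambda>x. g n x + (- 1) * g k x"
    have h: "cont ?h" by (intro continuous_intros g_cont)
    have "adj ?h = ?h"
      using g_adj[of n] g_adj[of k] by (auto simp: adj_def fun_eq_iff)
    then have "of_real (nsq ?h) = conv ?h ?h 0" using conv_self_0[OF h] by simp
    also have "\<dots> = conv ?h (g n) 0 + (- 1) * conv ?h (g k) 0"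
      using conv_add_right[OF h g_cont g_cont, of n "-1" k] by (rule fun_cong)
    also have "\<dots> = of_real (b (n + n + 1) - 2 * b (n + k + 1) + b (k + k + 1))"
    proof -
      have "conv ?h (g i) 0 = conv (g i) (g n) 0 + (- 1) * conv (g i) (g k) 0" for i
        unfolding conv_commute[OF h g_cont]
        using conv_add_right[OF g_cont g_cont g_cont, of i n "-1" k] by (rule fun_cong)
      moreover have "conv (g i) (g j) 0 = of_real (b (i + j + 1))" for i j
        unfolding g_conv by (simp add: g_def b_def p_0)
      ultimately show ?thesis by (simp add: add.commute)
    qed
    finally have "complex_of_real (nsq ?h) = of_real (b (n + n + 1) - 2 * b (n + k + 1) + b (k + k + 1))" .
    then show ?thesis unfolding of_real_eq_iff by simp
  qed
  have "uniformly_Cauchy_on UNIV (\<lambda>n. g (Suc n))"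
  proof (rule uniformly_Cauchy_onI')
    fix \<epsilon> :: real assume \<epsilon>: "\<epsilon> > 0"
    define B where "B = nsq (g 0) + 1"
    have B: "B > 0" "nsq (g 0) \<le> B" using nsq_nonneg[of "g 0"] by (auto simp: B_def)
    have bM: "b \<longlonglongrightarrow> M" using M(2) by (simp add: b_def[abs_def])
    \<comment> \<open>One convolution with \<open>g 0\<close> turns the mean square estimate into a
      uniform one, hence \<open>g (Suc n)\<close>. The combination in \<open>g_diff\<close> contains
      four deviations of \<open>b\<close> from \<open>M\<close>, each below \<open>\<delta>\<close>,
      and \<open>B * (4 * \<delta>)\<close> is half the square of \<open>\<epsilon>\<close>.\<close>
    define \<delta> where "\<delta> = \<epsilon>\<^sup>2 / (8 * B)"
    have \<delta>: "\<delta> > 0" using \<epsilon> B by (simp add: \<delta>_def)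
    then obtain N where N: "\<And>n. n \<ge> N \<Longrightarrow> \<bar>b n - M\<bar> < \<delta>"
      using LIMSEQ_D[OF bM \<delta>] by auto
    have "dist (g (Suc n) x) (g (Suc k) x) < \<epsilon>" if nk: "n \<ge> N" "k > n" for x n k
    proof -
      have c: "cont (\<lambda>x. g n x + (- 1) * g k x)" by (intro continuous_intros g_cont)
      have "g (Suc n) x - g (Suc k) x = conv (g 0) (\<lambda>x. g n x + (- 1) * g k x) x"
        unfolding conv_add_right[OF g_cont g_cont g_cont] by (simp add: g_conv)
      then have "norm (g (Suc n) x - g (Suc k) x) \<le> sqrt (nsq (g 0) * nsq (\<lambda>x. g n x + (- 1) * g k x))"
        using norm_conv_le[OF g_cont c] by simp
      also have "nsq (\<lambda>x. g n x + (- 1) * g k x) = b (n + n + 1) - 2 * b (n + k + 1) + b (k + k + 1)"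
        using g_diff[of n k] by simp
      also have "\<dots> \<le> 4 * \<delta>"
        using N[of "n + n + 1"] N[of "n + k + 1"] N[of "k + k + 1"] nk by linarith
      then have "sqrt (nsq (g 0) * (b (n + n + 1) - 2 * b (n + k + 1) + b (k + k + 1))) \<le> sqrt (B * (4 * \<delta>))"
        using B \<delta> nsq_nonneg[of "g 0"] nsq_nonneg[of "\<lambda>x. g n x - g k x"]
        unfolding g_diff by (intro real_sqrt_le_mono mult_mono) auto
      also have "B * (4 * \<delta>) = \<epsilon>\<^sup>2 / 2" using B(1) by (simp add: \<delta>_def field_simps)
      also have "sqrt (\<epsilon>\<^sup>2 / 2) < \<epsilon>"
        using \<epsilon> by (intro real_less_lsqrt) auto
      finally show ?thesis by (simp add: dist_norm)
    qed
    then show "\<exists>N. \<forall>x\<in>UNIV. \<forall>n\<ge>N. \<forall>k>n. dist (g (Suc n) x) (g (Suc k) x) < \<epsilon>" by blast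
  qed
  then obtain G where G: "uniform_limit UNIV (\<lambda>n. g (Suc n)) G sequentially"
    using Cauchy_uniformly_convergent uniformly_convergent_on_def by blast
  have G_cont: "cont G"
    using G by (rule uniform_limit_theorem[rotated]) (auto simp: g_cont)
  have G_lim: "(\<lambda>n. g (Suc n) x) \<longlonglongrightarrow> G x" for x
    using tendsto_uniform_limitI[OF G] by simp
  have G_shift: "(\<lambda>n. g (n + k + 1) x) \<longlonglongrightarrow> G x" for x k
    using LIMSEQ_ignore_initial_segment[OF G_lim[of x], of k] by simp
  have conv_G: "(\<lambda>n. conv f (g (Suc n)) x) \<longlonglongrightarrow> conv f G x" if "cont f" for f x
    using that g_cont G_cont G by (rule conv_tendsto)
  have gG: "conv (g k) G = G" for k
  proof
    fix x
    have "(\<lambda>n. conv (g k) (g (Suc n)) x) \<longlonglongrightarrow> G x"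
      using LIMSEQ_ignore_initial_segment[OF G_shift[of k x], of 1] by (simp add: g_conv add_ac)
    then show "conv (g k) G x = G x" using conv_G[OF g_cont] LIMSEQ_unique by blast
  qed
  have GG: "conv G G = G"
  proof
    fix x
    have "(\<lambda>n. conv G (g (Suc n)) x) \<longlonglongrightarrow> G x"
      unfolding conv_commute[OF G_cont g_cont] gG by simp
    then show "conv G G x = G x" using conv_G[OF G_cont] LIMSEQ_unique by blast
  qed
  have "b \<longlonglongrightarrow> M" using M(2) by (simp add: b_def[abs_def])
  then have "(\<lambda>n. complex_of_real (b (Suc n))) \<longlonglongrightarrow> of_real M"
    by (intro tendsto_of_real LIMSEQ_Suc)
  then have "(\<lambda>n. g (Suc n) 0) \<longlonglongrightarrow> of_real M" by (simp add: g_def b_def p_0)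
  then have "G 0 = of_real M" using G_lim LIMSEQ_unique by blast
  then have G_nz: "G \<noteq> (\<lambda>_. 0)" using M(1) by auto
  have G_adj: "adj G = G"
  proof
    fix x
    have "(\<lambda>n. adj (g (Suc n)) x) \<longlonglongrightarrow> adj G x"
      unfolding adj_def by (intro tendsto_cnj G_lim)
    then show "adj G x = G x" unfolding g_adj using G_lim LIMSEQ_unique by blast
  qed
  have "conv (conv \<phi> \<phi>) G = (\<lambda>x. of_real l * G x)"
  proof -
    have "p 0 = conv \<phi> \<phi>" by (simp add: p_def q_Suc q_0)
    then have eq: "conv \<phi> \<phi> = (\<lambda>x. of_real l * g 0 x)" using l by (simp add: g_def fun_eq_iff)
    have "conv (conv \<phi> \<phi>) G = conv G (\<lambda>x. of_real l * g 0 x)"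
      using eq conv_commute[OF continuous_conv[OF \<phi>(1) \<phi>(1)] G_cont] by simp
    also have "\<dots> = (\<lambda>x. of_real l * G x)"
      unfolding conv_scale_right conv_commute[OF G_cont g_cont] gG ..
    finally show ?thesis .
  qed
  moreover have "conv e G = G" if e: "cont e" "conv e \<phi> = \<phi>" for e
  proof
    fix x
    have "conv e (q n) = q n" for n
    proof (cases n)
      case (Suc k)
      then show ?thesis using conv_assoc[OF e(1) \<phi>(1) q_cont[of k]] e(2) by (simp add: q_Suc)
    qed (simp add: q_0 e)
    then have "conv e (g n) = g n" for n
      unfolding g_def[abs_def] conv_scale_right by (simp add: p_def)
    then show "conv e G x = G x" using conv_G[OF e(1), of x] G_lim[of x] LIMSEQ_unique by simp
  qed
  moreover have "idem G" unfolding idem_def using G_cont G_adj GG G_nz by simp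
  ultimately show ?thesis using l by blast
qed

text \<open>\<open>nsq\<close> is a rank: it drops by at least 1 when a smaller idempotent takes the
  place of a larger one. An idempotent whose \<open>nsq\<close> is less than 1 above the infimum is
  therefore minimal.\<close>

lemma minimal_idempotent:
  assumes g: "idem g"
  shows "\<exists>e. idem e \<and> conv e g = e \<and> (\<forall>e'. idem e' \<and> conv e' e = e' \<longrightarrow> e' = e)"
proof -
  define S where "S = {nsq e |e. idem e \<and> conv e g = e}"
  have S: "S \<noteq> {}" "bdd_below S"
    using g nsq_nonneg by (auto simp: S_def idem_def intro!: bdd_belowI[of _ 0])
  then obtain e where e: "idem e" "conv e g = e" "nsq e < Inf S + 1"
    using cInf_lessD[OF S(1), of "Inf S + 1"] by (auto simp: S_def)
  have "e' = e" if e': "idem e'" "conv e' e = e'" for e'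
  proof (rule ccontr)
    assume ne: "e' \<noteq> e"
    have c: "cont e" "cont e'" "cont g"
      using e e' g by (auto simp: idem_def)
    have "conv e' g = e'"
      using conv_assoc[OF c(2,1,3)] e(2) e'(2) by simp
    then have "nsq e' \<in> S" using e' by (auto simp: S_def)
    then have inf: "Inf S \<le> nsq e'" using S(2) by (rule cInf_lower)
    let ?d = "\<lambda>x. e x + (- 1) * e' x"
    have d_cont: "cont ?d" using c by (intro continuous_intros)
    have ee: "conv e e = e" "conv e' e' = e'" "conv e e' = e'" "conv e' e = e'"
      using e e' conv_commute[OF c(1,2)] by (auto simp: idem_def)
    have "conv e ?d = ?d" "conv e' ?d = (\<lambda>x. 0)"
      using conv_add_right[OF c(1) c(1) c(2), of "-1"] conv_add_right[OF c(2) c(1) c(2), of "-1"]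
      by (simp_all add: ee)
    moreover have "conv ?d ?d = (\<lambda>x. conv ?d e x + (- 1) * conv ?d e' x)"
      by (rule conv_add_right[OF d_cont c(1,2)])
    ultimately have "conv ?d ?d = ?d"
      unfolding conv_commute[OF d_cont c(1)] conv_commute[OF d_cont c(2)] by simp
    moreover have "adj ?d = ?d" using e(1) e'(1) by (auto simp: idem_def adj_def fun_eq_iff)
    moreover have "?d \<noteq> (\<lambda>_. 0)"
    proof
      assume "?d = (\<lambda>_. 0)"
      then have "e x = e' x" for x using fun_cong[of ?d "\<lambda>_. 0" x] by simp
      then show False using ne by (simp add: fun_eq_iff)
    qed
    ultimately have "idem ?d" using d_cont by (simp add: idem_def)
    from idem_0[OF this] have d: "?d 0 = of_real (nsq ?d)" "nsq ?d \<ge> 1" by auto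
    then have "complex_of_real (nsq e) - of_real (nsq e') = of_real (nsq ?d)"
      using idem_0(1)[OF e(1)] idem_0(1)[OF e'(1)] by simp
    then have "nsq e - nsq e' = nsq ?d" unfolding of_real_diff[symmetric] of_real_eq_iff .
    then show False using d(2) e(3) inf by linarith
  qed
  then show ?thesis using e by blast
qed

text \<open>
  Every self-adjoint element of the corner cut out by a minimal idempotent \<open>e\<close> squares to a multiple
  of \<open>e\<close>; polarizing with \<open>e\<close> itself, it is a multiple of \<open>e\<close>.
\<close>
lemma minimal_idempotent_corner:
  assumes e: "idem e" and min: "\<And>e'. idem e' \<Longrightarrow> conv e' e = e' \<Longrightarrow> e' = e"
    and h: "cont h" "conv e h = h"
  shows "\<exists>c. h = (\<lambda>x. c * e x)"
proof -
  have ec: "cont e" "adj e = e" "conv e e = e" using e by (auto simp: idem_def)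
  have square: "\<exists>l::complex. conv f f = (\<lambda>x. l * e x)"
    if f: "cont f" "adj f = f" "conv e f = f" for f
  proof (cases "f = (\<lambda>_. 0)")
    case True
    then show ?thesis by (intro exI[of _ 0]) (simp add: conv_def fun_eq_iff)
  next
    case False
    then obtain g l where g: "idem g" "conv (conv f f) g = (\<lambda>x. of_real l * g x)" "conv e g = g"
      using spectral_idempotent[OF f(1,2)] ec(1) f(3) by blast
    have gc: "cont g" using g by (simp add: idem_def)
    \<comment> \<open>The spectral idempotent of \<open>f\<close> lies below \<open>e\<close>, so
      minimality leaves only \<open>e\<close>.\<close>
    have "g = e" using min[OF g(1)] g(3) conv_commute[OF ec(1) gc] by simp
    have ff: "cont (conv f f)" using f by (intro continuous_conv)
    have "conv (conv f f) e = conv f f"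
      using conv_assoc[OF ec(1) f(1,1)] f(3) conv_commute[OF ff ec(1)] by simp
    then show ?thesis using g(2) \<open>g = e\<close> by metis
  qed
  have herm: "\<exists>c. f = (\<lambda>x. c * e x)" if f: "cont f" "adj f = f" "conv e f = f" for f
  proof -
    let ?k = "\<lambda>x. f x + 1 * e x"
    have kc: "cont ?k" using f ec by (intro continuous_intros)
    have "adj ?k = ?k" using f(2) ec(2) by (auto simp: adj_def fun_eq_iff)
    moreover have ek: "conv e ?k = ?k"
      using conv_add_right[OF ec(1) f(1) ec(1), of 1] f(3) ec(3) by simp
    ultimately obtain l' where l': "conv ?k ?k = (\<lambda>x. l' * e x)" using square[OF kc] by blast
    obtain l where l: "conv f f = (\<lambda>x. l * e x)" using square[OF f] by blast
    have "conv ?k ?k = (\<lambda>x. conv ?k f x + 1 * conv ?k e x)"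
      by (rule conv_add_right[OF kc f(1) ec(1)])
    also have "conv ?k e = ?k" using ek conv_commute[OF kc ec(1)] by simp
    also have "conv ?k f = (\<lambda>x. conv f f x + 1 * conv f e x)"
      unfolding conv_commute[OF kc f(1)] by (rule conv_add_right[OF f(1,1) ec(1)])
    also have "conv f e = f" using f(3) conv_commute[OF f(1) ec(1)] by simp
    finally have eq: "l' * e x = l * e x + 2 * f x + e x" for x
      using l l' by (simp add: fun_eq_iff add_ac)
    have "f x = ((l' - l - 1) / 2) * e x" for x
      using eq[of x] by (simp add: field_simps)
    then show ?thesis by blast
  qed
  have hc: "cont (adj h)" using h by (intro continuous_adj)
  have eh: "conv e (adj h) = adj h" using adj_conv[OF ec(1) h(1)] h(2) ec(2) by simp
  \<comment> \<open>A general \<open>h\<close> is a combination of two self-adjoint elements of the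
    corner, \<open>h + adj h\<close> and \<open>\<i> * (h - adj h)\<close>.\<close>
  let ?u = "\<lambda>x. h x + 1 * adj h x"
  have "\<exists>c. ?u = (\<lambda>x. c * e x)"
  proof (rule herm)
    show "cont ?u" using h hc by (intro continuous_intros)
    show "adj ?u = ?u" by (simp add: adj_def fun_eq_iff)
    show "conv e ?u = ?u" using conv_add_right[OF ec(1) h(1) hc, of 1] h(2) eh by simp
  qed
  moreover have "\<exists>c. (\<lambda>x. \<i> * (h x + (- 1) * adj h x)) = (\<lambda>x. c * e x)"
  proof (rule herm)
    show "cont (\<lambda>x. \<i> * (h x + (- 1) * adj h x))" using h hc by (intro continuous_intros)
    show "adj (\<lambda>x. \<i> * (h x + (- 1) * adj h x)) = (\<lambda>x. \<i> * (h x + (- 1) * adj h x))"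
      by (simp add: adj_def fun_eq_iff algebra_simps)
    show "conv e (\<lambda>x. \<i> * (h x + (- 1) * adj h x)) = (\<lambda>x. \<i> * (h x + (- 1) * adj h x))"
      unfolding conv_scale_right conv_add_right[OF ec(1) h(1) hc] h(2) eh ..
  qed
  ultimately obtain c d where cd: "\<And>x. h x + adj h x = c * e x" "\<And>x. \<i> * (h x - adj h x) = d * e x"
    by (auto simp: fun_eq_iff)
  have "h x = ((c - \<i> * d) / 2) * e x" for x
  proof -
    have "h x - adj h x = - \<i> * (d * e x)" unfolding cd(2)[symmetric] by simp
    have "2 * h x = (h x + adj h x) + (h x - adj h x)" by simp
    also have "\<dots> = c * e x + - \<i> * (d * e x)" by (simp only: cd(1) \<open>h x - adj h x = - \<i> * (d * e x)\<close>)
    finally show ?thesis by (simp add: field_simps)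
  qed
  then show ?thesis by blast
qed


text \<open>A translate of \<open>e\<close> is again in the corner of \<open>e\<close>, hence a
  multiple of \<open>e\<close>. Thus \<open>e\<close> spans a translation invariant line, and the
  factor by which translations act on it is a character.\<close>

lemma minimal_idempotent_character:
  assumes e: "idem e" and min: "\<And>e'. idem e' \<Longrightarrow> conv e' e = e' \<Longrightarrow> e' = e"
  shows "character (\<lambda>x. e x / e 0)" "e 0 \<noteq> 0"
proof -
  have ec: "cont e" "adj e = e" "conv e e = e" using e by (auto simp: idem_def)
  have bound: "norm (e x) \<le> nsq e" for x
    using norm_conv_le[OF ec(1,1), of x] ec(3) nsq_nonneg[of e] by simp
  show e0: "e 0 \<noteq> 0" using idem_0[OF e] by auto
  have translate: "e (x + a) = e a / e 0 * e x" for x a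
  proof -
    have c: "cont (\<lambda>x. e (x + a))"
      by (intro continuous_UNIV_compose[OF ec(1)] continuous_intros)
    have "conv e (\<lambda>x. e (x + a)) x = e (x + a)" for x
    proof -
      have "conv e (\<lambda>x. e (x + a)) x = conv (\<lambda>x. e (x + a)) e x"
        using conv_commute[OF ec(1) c] by simp
      also have "\<dots> = conv e e (x + a)"
        unfolding conv_def by (simp add: algebra_simps)
      finally show ?thesis by (simp add: ec(3))
    qed
    then obtain k where k: "\<And>x. e (x + a) = k * e x"
      using minimal_idempotent_corner[OF e min c] by (metis ext)
    from k[of 0] have "k = e a / e 0" using e0 by simp
    then show ?thesis using k by simp
  qed
  define \<xi> where "\<xi> x = e x / e 0" for x
  have mult: "\<xi> (x + y) = \<xi> x * \<xi> y" for x y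
    unfolding \<xi>_def translate[of x y] by simp
  have le: "norm (\<xi> x) \<le> 1" for x
    using bound[of x] idem_0[OF e] by (simp add: \<xi>_def norm_divide)
  have "norm (\<xi> x) = 1" for x
  proof (rule antisym[OF le])
    have "\<xi> x * \<xi> (- x) = 1" unfolding mult[symmetric] using e0 by (simp add: \<xi>_def)
    then have "1 = norm (\<xi> x) * norm (\<xi> (- x))" by (metis norm_mult norm_one)
    also have "\<dots> \<le> norm (\<xi> x) * 1" using le by (intro mult_left_mono) auto
    finally show "1 \<le> norm (\<xi> x)" by simp
  qed
  moreover have "cont \<xi>" unfolding \<xi>_def[abs_def] by (intro continuous_on_divide continuous_on_const ec(1)) (simp add: e0)
  ultimately show "character (\<lambda>x. e x / e 0)"
    using mult unfolding \<xi>_def[symmetric] character_def by auto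
qed

text \<open>For nonzero \<open>F\<close> the element \<open>\<phi> = conv F (adj F)\<close> is
  nonzero, and convolution with \<open>conv \<phi> \<phi>\<close> acts on some minimal idempotent
  \<open>e\<close> as a positive scalar. But \<open>e\<close> is a multiple of a character, which
  convolution with \<open>F\<close> kills by orthogonality, so the scalar would have to be
  0.\<close>

lemma character_completeness:
  assumes F: "cont F" and orth: "\<And>\<xi>. character \<xi> \<Longrightarrow> (\<integral>x. F x * cnj (\<xi> x) \<partial>m) = 0"
  shows "F = (\<lambda>_. 0)"
proof (rule ccontr)
  assume nz: "F \<noteq> (\<lambda>_. 0)"
  define \<phi> where "\<phi> = conv F (adj F)"
  have Fa: "cont (adj F)" by (rule continuous_adj[OF F])
  have \<phi>c: "cont \<phi>" unfolding \<phi>_def by (rule continuous_conv[OF F Fa])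
  have "adj (adj F) = F" by (simp add: adj_def fun_eq_iff)
  then have \<phi>a: "adj \<phi> = \<phi>"
    unfolding \<phi>_def using adj_conv[OF F Fa] conv_commute[OF Fa F] by simp
  have "\<phi> 0 \<noteq> 0"
    using conv_adj_0[OF F] nsq_eq_0[OF F] nz by (auto simp: \<phi>_def)
  then obtain g l where g: "idem g" "l > 0" "conv (conv \<phi> \<phi>) g = (\<lambda>x. of_real l * g x)"
    using spectral_idempotent[OF \<phi>c \<phi>a] by fastforce
  obtain e where e: "idem e" "conv e g = e" "\<And>e'. idem e' \<Longrightarrow> conv e' e = e' \<Longrightarrow> e' = e"
    using minimal_idempotent[OF g(1)] by blast
  have ec: "cont e" and gc: "cont g" using e g by (auto simp: idem_def)
  define \<xi> where "\<xi> x = e x / e 0" for x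
  have \<xi>: "character \<xi>" and e0: "e 0 \<noteq> 0"
    using minimal_idempotent_character[OF e(1,3)] unfolding \<xi>_def[abs_def] by auto
  have \<xi>c: "cont \<xi>" using \<xi> by (simp add: character_def)
  have "conv F \<xi> = (\<lambda>_. 0)"
  proof
    fix x
    have "conv F \<xi> x = conv \<xi> F x" using conv_commute[OF F \<xi>c] by simp
    also have "\<dots> = (\<integral>y. \<xi> x * (F y * cnj (\<xi> y)) \<partial>m)"
      unfolding conv_def diff_conv_add_uminus character_add[OF \<xi>] character_minus[OF \<xi>]
      by (simp add: mult_ac)
    also have "\<dots> = 0" using orth[OF \<xi>] by simp
    finally show "conv F \<xi> x = 0" .
  qed
  moreover have "e = (\<lambda>x. e 0 * \<xi> x)" using e0 by (simp add: \<xi>_def fun_eq_iff)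
  ultimately have Fe: "conv F e = (\<lambda>_. 0)"
    using conv_scale_right[of F "e 0" \<xi>] by simp
  have "conv \<phi> e = conv (adj F) (conv F e)"
    unfolding \<phi>_def conv_commute[OF F Fa] by (rule conv_assoc[OF Fa F ec])
  then have \<phi>e: "conv \<phi> e = (\<lambda>_. 0)" unfolding Fe by (simp add: conv_def fun_eq_iff)
  have pp: "cont (conv \<phi> \<phi>)" by (rule continuous_conv[OF \<phi>c \<phi>c])
  have "conv (conv \<phi> \<phi>) e = (\<lambda>_. 0)"
    unfolding conv_assoc[OF \<phi>c \<phi>c ec] \<phi>e by (simp add: conv_def fun_eq_iff)
  moreover have "conv (conv \<phi> \<phi>) e = (\<lambda>x. of_real l * e x)"
  proof -
    have "conv (conv \<phi> \<phi>) e = conv (conv \<phi> \<phi>) (conv g e)"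
      using e(2) conv_commute[OF ec gc] by simp
    also have "\<dots> = conv (conv (conv \<phi> \<phi>) g) e" by (rule conv_assoc[OF pp gc ec, symmetric])
    also have "\<dots> = conv e (\<lambda>x. of_real l * g x)"
      unfolding g(3) by (rule conv_commute) (auto intro!: continuous_intros gc ec)
    also have "\<dots> = (\<lambda>x. of_real l * e x)" unfolding conv_scale_right e(2) ..
    finally show ?thesis .
  qed
  ultimately have "of_real l * e 0 = 0" by (metis (mono_tags))
  then show False using e0 g(2) by simp
qed

section \<open>Separation of points and density of trigonometric polynomials\<close>

lemma normal_space_UNIV: "normal_space (euclidean :: 'a topology)"
proof (rule compact_Hausdorff_or_regular_imp_normal_space)
  show "compact_space (euclidean :: 'a topology)"
    using compact_UNIV by (simp add: compact_space_def)
  have "Hausdorff_space (euclidean :: 'a topology)"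
    unfolding Hausdorff_space_def using hausdorff by (fastforce simp: disjnt_def)
  then show "Hausdorff_space (euclidean :: 'a topology) \<or> regular_space (euclidean :: 'a topology)" ..
qed

lemma urysohn:
  fixes K L :: "'a set"
  assumes "closed K" "closed L" "K \<inter> L = {}"
  shows "\<exists>f :: 'a \<Rightarrow> real. cont f \<and> (\<forall>x. 0 \<le> f x) \<and> (\<forall>x. f x \<le> 1) \<and>
    (\<forall>x\<in>K. f x = 0) \<and> (\<forall>x\<in>L. f x = 1)"
proof -
  obtain f where f: "continuous_map euclidean (top_of_set {0..1::real}) f" "f ` K \<subseteq> {0}" "f ` L \<subseteq> {1}"
    using Urysohn_lemma[OF normal_space_UNIV, of K L 0 1] assms by (auto simp: disjnt_def)
  then have "cont f" "f \<in> UNIV \<rightarrow> {0..1}"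
    by (auto simp: continuous_map_in_subtopology)
  then show ?thesis using f by (intro exI[of _ f]) auto
qed

text \<open>If all characters agreed at \<open>a\<close> and \<open>b\<close>, the translates of any
  continuous function by \<open>a\<close> and by \<open>b\<close> would have the same Fourier
  coefficients and so coincide. A Urysohn function with different values at \<open>a\<close> and
  \<open>b\<close> refutes this.\<close>

lemma character_separates:
  fixes a b :: 'a
  assumes "a \<noteq> b"
  shows "\<exists>\<xi>. character \<xi> \<and> \<xi> a \<noteq> \<xi> b"
proof (rule ccontr)
  assume "\<not> ?thesis"
  then have eq: "\<xi> a = \<xi> b" if "character \<xi>" for \<xi> using that by blast
  have "closed {a}" "closed {b}" "{a} \<inter> {b} = {}" using assms by simp_all
  from urysohn[OF this] obtain f :: "'a \<Rightarrow> real" where f0: "cont f"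
    "\<forall>x. 0 \<le> f x" "\<forall>x. f x \<le> 1" "\<forall>x\<in>{a}. f x = 0" "\<forall>x\<in>{b}. f x = 1"
    by (elim exE conjE)
  note f = f0(1) spec[OF f0(2)] spec[OF f0(3)] bspec[OF f0(4)] bspec[OF f0(5)]
  define h where "h x = complex_of_real (f x)" for x
  have h: "cont h" unfolding h_def[abs_def] by (intro continuous_intros f)
  have tr: "(\<integral>x. h (c + x) * cnj (\<xi> x) \<partial>m) = \<xi> c * (\<integral>x. h x * cnj (\<xi> x) \<partial>m)"
    if \<xi>: "character \<xi>" for c \<xi>
  proof -
    have \<xi>c: "cont \<xi>" using \<xi> by (simp add: character_def)
    have cc: "cont (\<lambda>x. h x * cnj (\<xi> (- c + x)))"
      by (intro continuous_intros h continuous_UNIV_compose[OF \<xi>c])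
    have "(\<integral>x. h (c + x) * cnj (\<xi> x) \<partial>m) = (\<integral>x. h x * cnj (\<xi> (- c + x)) \<partial>m)"
      using integral_translation[OF cc, of c] by simp
    also have "\<dots> = (\<integral>x. \<xi> c * (h x * cnj (\<xi> x)) \<partial>m)"
      unfolding character_add[OF \<xi>] character_minus[OF \<xi>] by (simp add: mult_ac)
    finally show ?thesis by simp
  qed
  have ca: "cont (\<lambda>x. h (c + x))" for c
    by (intro continuous_UNIV_compose[OF h] continuous_intros)
  have "(\<lambda>x. h (a + x) - h (b + x)) = (\<lambda>_. 0)"
  proof (rule character_completeness)
    show "cont (\<lambda>x. h (a + x) - h (b + x))" by (intro continuous_intros ca)
    fix \<xi> :: "'a \<Rightarrow> complex" assume \<xi>: "character \<xi>"
    have "cont \<xi>" using \<xi> by (simp add: character_def)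
    then have "(\<integral>x. (h (a + x) - h (b + x)) * cnj (\<xi> x) \<partial>m)
        = (\<integral>x. h (a + x) * cnj (\<xi> x) \<partial>m) - (\<integral>x. h (b + x) * cnj (\<xi> x) \<partial>m)"
      unfolding left_diff_distrib
      by (intro Bochner_Integration.integral_diff continuous_integrable continuous_intros ca)
    then show "(\<integral>x. (h (a + x) - h (b + x)) * cnj (\<xi> x) \<partial>m) = 0"
      using tr[OF \<xi>] eq[OF \<xi>] by simp
  qed
  from fun_cong[OF this, of 0] show False using f(4,5) by (simp add: h_def)
qed

lemma trig_dense:
  fixes f :: "'a \<Rightarrow> real"
  assumes f: "cont f" and e: "e > 0"
  obtains g where "trig (\<lambda>x. complex_of_real (g x))" "\<And>x. \<bar>f x - g x\<bar> < e"
proof -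
  have "\<exists>g. trig (\<lambda>x. complex_of_real (g x)) \<and> (\<forall>x\<in>UNIV. \<bar>f x - g x\<bar> < e)"
  proof (rule Stone_Weierstrass_HOL[OF compact_UNIV])
    show "trig (\<lambda>x. complex_of_real c)" for c
      using trig.monomial[OF character_one, of "of_real c"] by simp
    show "cont g" if "trig (\<lambda>x. complex_of_real (g x))" for g
      using continuous_on_Re[OF trig_continuous[OF that]] by simp
    show "trig (\<lambda>x. complex_of_real (g x + h x))"
      if "trig (\<lambda>x. complex_of_real (g x)) \<and> trig (\<lambda>x. complex_of_real (h x))" for g h
      using trig.add that by fastforce
    show "trig (\<lambda>x. complex_of_real (g x * h x))"
      if "trig (\<lambda>x. complex_of_real (g x)) \<and> trig (\<lambda>x. complex_of_real (h x))" for g h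
      using trig_mult that by fastforce
    fix x y :: 'a assume xy: "x \<in> UNIV \<and> y \<in> UNIV \<and> x \<noteq> y"
    then obtain \<xi> where \<xi>: "character \<xi>" "\<xi> x \<noteq> \<xi> y" using character_separates by blast
    \<comment> \<open>Stone-Weierstrass is applied to real functions. The factor 1 exhibits the real
      part of a character, the factor \<open>- \<i>\<close> its imaginary part.\<close>
    have Re: "trig (\<lambda>x. complex_of_real (Re (c * \<xi> x)))" for c
    proof -
      have "trig (\<lambda>x. c / 2 * \<xi> x + cnj c / 2 * cnj (\<xi> x))"
        using trig.add[OF trig.monomial[OF \<xi>(1)] trig.monomial[OF character_cnj[OF \<xi>(1)]]] .
      moreover have "c / 2 * z + cnj c / 2 * cnj z = complex_of_real (Re (c * z))" for z
        by (simp add: complex_eq_iff field_simps)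
      ultimately show ?thesis by simp
    qed
    show "\<exists>g. trig (\<lambda>x. complex_of_real (g x)) \<and> g x \<noteq> g y"
    proof -
      have "\<exists>c. Re (c * \<xi> x) \<noteq> Re (c * \<xi> y)"
      proof (cases "Re (\<xi> x) = Re (\<xi> y)")
        case True
        then have "Re (- \<i> * \<xi> x) \<noteq> Re (- \<i> * \<xi> y)" using \<xi>(2) by (simp add: complex_eq_iff)
        then show ?thesis by (rule exI)
      next
        case False
        then show ?thesis by (intro exI[of _ 1]) simp
      qed
      then obtain c where "Re (c * \<xi> x) \<noteq> Re (c * \<xi> y)" ..
      with Re[of c] show ?thesis by (intro exI[of _ "\<lambda>x. Re (c * \<xi> x)"] conjI)
    qed
  qed (use f e in auto)
  then show ?thesis using that by blast
qed

lemma integral_character: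
  assumes \<xi>: "character \<xi>" and a: "\<xi> a \<noteq> 1"
  shows "(\<integral>x. \<xi> x \<partial>m) = 0"
proof -
  have c: "cont \<xi>" using \<xi> by (simp add: character_def)
  have "(\<integral>x. \<xi> x \<partial>m) = \<xi> a * (\<integral>x. \<xi> x \<partial>m)"
    using integral_translation[OF c, of a] by (simp add: character_add[OF \<xi>])
  then have "(1 - \<xi> a) * (\<integral>x. \<xi> x \<partial>m) = 0" by (simp add: algebra_simps)
  then show ?thesis using a by simp
qed


section \<open>Regularity and invariance under epimorphisms\<close>

lemma outer_approx:
  assumes A: "A \<in> sets m" and e: "e > 0"
  obtains U where "open U" "A \<subseteq> U" "measure m U < measure m A + e"
proof -
  have "emeasure m A < ennreal (measure m A + e)"
    unfolding emeasure_eq_measure using e by (intro ennreal_lessI) (auto simp: add_nonneg_pos)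
  then have "(INF U\<in>{U. open U \<and> A \<subseteq> U}. emeasure m U) < ennreal (measure m A + e)"
    by (simp only: outer_regular[OF A, symmetric])
  then obtain U where U: "open U" "A \<subseteq> U" "emeasure m U < ennreal (measure m A + e)"
    unfolding INF_less_iff by blast
  then have "measure m U < measure m A + e"
    by (simp add: emeasure_eq_measure ennreal_less_iff)
  then show ?thesis using U that by blast
qed

lemma inner_approx:
  assumes A: "A \<in> sets m" and e: "e > 0"
  obtains K where "closed K" "K \<subseteq> A" "measure m A < measure m K + e"
proof -
  have "- A \<in> sets m" using A sets.compl_sets[of A m] by (simp add: Compl_eq_Diff_UNIV)
  then obtain U where U: "open U" "- A \<subseteq> U" "measure m U < measure m (- A) + e"
    using outer_approx e by blast
  have "measure m (- A) = 1 - measure m A" "measure m (- U) = 1 - measure m U"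
    using A U(1) finite_measure_compl[of A] finite_measure_compl[of U] by (simp_all add: Compl_eq_Diff_UNIV)
  then have "measure m A < measure m (- U) + e" using U(3) by simp
  then show ?thesis using U by (intro that[of "- U"]) auto
qed

lemma indicator_approx:
  assumes A: "A \<in> sets m" and e: "e > 0"
  obtains g :: "'a \<Rightarrow> real" where "cont g" "\<And>x. 0 \<le> g x" "\<And>x. g x \<le> 1"
    "(\<integral>x. \<bar>indicator A x - g x\<bar> \<partial>m) < e"
proof -
  have e2: "e / 2 > 0" using e by simp
  obtain U where U: "open U" "A \<subseteq> U" "measure m U < measure m A + e / 2"
    by (rule outer_approx[OF A e2])
  obtain K where K: "closed K" "K \<subseteq> A" "measure m A < measure m K + e / 2"
    by (rule inner_approx[OF A e2])
  have "closed (- U)" "closed K" "- U \<inter> K = {}" using U K by auto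
  from urysohn[OF this] obtain g :: "'a \<Rightarrow> real" where g0: "cont g"
    "\<forall>x. 0 \<le> g x" "\<forall>x. g x \<le> 1" "\<forall>x\<in>- U. g x = 0" "\<forall>x\<in>K. g x = 1"
    by (elim exE conjE)
  note g = g0(1) spec[OF g0(2)] spec[OF g0(3)] bspec[OF g0(4)] bspec[OF g0(5)]
  have sets: "K \<in> sets m" "U \<in> sets m" using K U by simp_all
  have gm: "g \<in> borel_measurable m" by (rule continuous_measurable[OF g(1)])
  have "(\<integral>x. \<bar>indicator A x - g x\<bar> \<partial>m) \<le> (\<integral>x. indicator (U - K) x \<partial>m)"
  proof (rule integral_mono)
    show "integrable m (\<lambda>x. \<bar>indicator A x - g x\<bar>)"
      using A gm g(2,3) by (intro integrable_const_bound[of _ 1]) (auto simp: indicator_def)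
    show "integrable m (indicator (U - K) :: 'a \<Rightarrow> real)"
      using sets by (intro integrable_indicator_set) simp
    show "\<bar>indicator A x - g x\<bar> \<le> indicator (U - K) x" for x
      using g(2,3)[of x] g(4,5)[of x] K(2) U(2) by (auto simp: indicator_def)
  qed
  also have "\<dots> = measure m U - measure m K"
    using sets K(2) U(2) by (simp add: finite_measure_Diff)
  also have "\<dots> < e" using U(3) K(3) by linarith
  finally show ?thesis using g that by blast
qed

lemma epimorphism_measurable: "epimorphism T \<Longrightarrow> T \<in> measurable m m"
  by (simp add: epimorphism_def measurable_cong_sets[OF sets_m sets_m] borel_measurable_continuous_onI)

text \<open>By surjectivity of \<open>T\<close> the character \<open>\<xi> (T x)\<close> is trivial
  only if \<open>\<xi>\<close> is, so the two integrals agree on characters; density extends this to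
  continuous functions.\<close>

lemma integral_epimorphism:
  fixes f :: "'a \<Rightarrow> real"
  assumes T: "epimorphism T" and f: "cont f"
  shows "(\<integral>x. f (T x) \<partial>m) = (\<integral>x. f x \<partial>m)"
proof -
  have Tc: "cont T" using T by (simp add: epimorphism_def)
  have trig_T: "(\<integral>x. g (T x) \<partial>m) = (\<integral>x. g x \<partial>m)" if "trig g" for g
    using that
  proof (induction rule: trig.induct)
    case (monomial \<xi> c)
    show ?case
    proof (cases "\<forall>x. \<xi> x = 1")
      case False
      then obtain a where a: "\<xi> a \<noteq> 1" by blast
      obtain b where "a = T b" using T unfolding epimorphism_def by (metis surjD)
      then have "\<xi> (T b) \<noteq> 1" using a by simp
      then show ?thesis
        using integral_character[OF monomial a]
          integral_character[OF character_epimorphism[OF monomial T]] by simp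
    qed simp
  next
    case (add f g)
    then show ?case
      by (simp add: continuous_integrable continuous_UNIV_compose[OF _ Tc] trig_continuous)
  qed
  have "\<bar>(\<integral>x. f (T x) \<partial>m) - (\<integral>x. f x \<partial>m)\<bar> \<le> 2 * e" if e: "e > 0" for e
  proof -
    obtain g where g: "trig (\<lambda>x. complex_of_real (g x))" "\<And>x. \<bar>f x - g x\<bar> < e"
      using trig_dense[OF f e] by blast
    have gc: "cont g" using continuous_on_Re[OF trig_continuous[OF g(1)]] by simp
    have "(\<integral>x. g (T x) \<partial>m) = (\<integral>x. g x \<partial>m)"
      using trig_T[OF g(1)] unfolding integral_complex_of_real of_real_eq_iff .
    moreover have "\<bar>(\<integral>x. f (S x) \<partial>m) - (\<integral>x. g (S x) \<partial>m)\<bar> \<le> e" if S: "cont S" for S :: "'a \<Rightarrow> 'a"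
    proof -
      have c: "cont (\<lambda>x. f (S x))" "cont (\<lambda>x. g (S x))"
        by (intro continuous_UNIV_compose[OF f S] continuous_UNIV_compose[OF gc S])+
      have "norm (\<integral>x. f (S x) - g (S x) \<partial>m) \<le> e"
        using c g(2) by (intro norm_integral_le continuous_measurable continuous_intros) (auto simp: less_imp_le)
      then show ?thesis using c by (simp add: continuous_integrable)
    qed
    note this[OF continuous_on_id] this[OF Tc]
    ultimately show ?thesis by linarith
  qed
  note bound = this
  have "\<bar>(\<integral>x. f (T x) \<partial>m) - (\<integral>x. f x \<partial>m)\<bar> \<le> 0"
  proof (rule field_le_epsilon)
    fix e :: real assume "e > 0"
    then have "e / 2 > 0" by simp
    from bound[OF this] show "\<bar>(\<integral>x. f (T x) \<partial>m) - (\<integral>x. f x \<partial>m)\<bar> \<le> 0 + e" by linarith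
  qed
  then show ?thesis by simp
qed

text \<open>Invariance is available for continuous functions only. For open \<open>U\<close>, inner
  regularity of the preimage reduces to a compact \<open>C\<close>, and a Urysohn function that is 1
  on the image of \<open>C\<close> and 0 outside \<open>U\<close> compares the measures. Outer
  regularity passes from open to Borel sets.\<close>

lemma measure_vimage_le:
  assumes T: "epimorphism T" and A: "A \<in> sets m"
  shows "measure m (T -` A) \<le> measure m A"
proof (rule field_le_epsilon)
  fix e :: real assume e: "e > 0"
  have Tc: "cont T" using T by (simp add: epimorphism_def)
  obtain U where U: "open U" "A \<subseteq> U" "measure m U < measure m A + e"
    using outer_approx[OF A e] by blast
  have TU: "open (T -` U)" using U(1) Tc by (simp add: open_vimage)
  have "measure m (T -` A) \<le> measure m (T -` U)"
    using U(2) TU by (intro finite_measure_mono) auto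
  also have "emeasure m (T -` U) \<le> emeasure m U"
    unfolding inner_regular[OF TU]
  proof (rule SUP_least)
    fix C assume "C \<in> {K. compact K \<and> K \<subseteq> T -` U}"
    then have C: "compact C" "C \<subseteq> T -` U" by auto
    have TC: "compact (T ` C)" using C Tc by (meson compact_continuous_image continuous_on_subset subset_UNIV)
    have "closed (- U)" "closed (T ` C)" "- U \<inter> T ` C = {}"
      using U(1) TC C(2) by (auto simp: compact_imp_closed)
    from urysohn[OF this] obtain f :: "'a \<Rightarrow> real" where f0: "cont f"
    "\<forall>x. 0 \<le> f x" "\<forall>x. f x \<le> 1" "\<forall>x\<in>- U. f x = 0" "\<forall>x\<in>T ` C. f x = 1"
    by (elim exE conjE)
  note f = f0(1) spec[OF f0(2)] spec[OF f0(3)] bspec[OF f0(4)] bspec[OF f0(5)]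
    have Cs: "C \<in> sets m" using C(1) by (simp add: compact_imp_closed)
    have "measure m C = (\<integral>x. indicator C x \<partial>m)" using Cs by simp
    also have "\<dots> \<le> (\<integral>x. f (T x) \<partial>m)"
    proof (rule integral_mono)
      show "integrable m (indicator C :: 'a \<Rightarrow> real)" using Cs by (rule integrable_indicator_set)
      show "integrable m (\<lambda>x. f (T x))"
        by (intro continuous_integrable continuous_UNIV_compose[OF f(1) Tc])
      show "indicator C x \<le> f (T x)" for x
        using f(2,5)[of "T x"] by (auto simp: indicator_def)
    qed
    also have "\<dots> = (\<integral>x. f x \<partial>m)" by (rule integral_epimorphism[OF T f(1)])
    also have "\<dots> \<le> (\<integral>x. indicator U x \<partial>m)"
    proof (rule integral_mono)
      show "integrable m (indicator U :: 'a \<Rightarrow> real)"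
        using U(1) by (intro integrable_indicator_set) simp
      show "integrable m f" by (intro continuous_integrable f)
      show "f x \<le> indicator U x" for x
        using f(3,4)[of x] by (auto simp: indicator_def)
    qed
    also have "\<dots> = measure m U" using U by simp
    finally show "emeasure m C \<le> emeasure m U" by (simp add: emeasure_eq_measure)
  qed
  then have "measure m (T -` U) \<le> measure m U" by (simp add: emeasure_eq_measure)
  finally show "measure m (T -` A) \<le> measure m A + e" using U(3) by linarith
qed

text \<open>The inequality for the complement is the reverse inequality.\<close>

lemma measure_vimage_epimorphism:
  assumes T: "epimorphism T" and A: "A \<in> sets m"
  shows "measure m (T -` A) = measure m A"
proof (rule antisym[OF measure_vimage_le[OF T A]])
  have A': "- A \<in> sets m" using A sets.compl_sets[of A m] by (simp add: Compl_eq_Diff_UNIV)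
  have TA: "T -` A \<in> sets m" using measurable_sets[OF epimorphism_measurable[OF T] A] by simp
  have "measure m (- (T -` A)) \<le> measure m (- A)"
    using measure_vimage_le[OF T A'] by (simp add: vimage_Compl)
  then show "measure m A \<le> measure m (T -` A)"
    using A TA finite_measure_compl[of A] finite_measure_compl[of "T -` A"]
    by (simp add: Compl_eq_Diff_UNIV)
qed

end


section \<open>Independent characters and covering dimension\<close>

text \<open>An integer linear combination in the dual group, which is written multiplicatively
  here.\<close>

definition char_comb :: "nat \<Rightarrow> (nat \<Rightarrow> 'a \<Rightarrow> complex) \<Rightarrow> (nat \<Rightarrow> int) \<Rightarrow> 'a \<Rightarrow> complex" where
  "char_comb n \<xi> v x = (\<Prod>j<n. \<xi> j x powi v j)"

definition char_indep :: "nat \<Rightarrow> (nat \<Rightarrow> 'a \<Rightarrow> complex) \<Rightarrow> bool" where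
  "char_indep n \<xi> \<longleftrightarrow> (\<forall>v\<in>zvec n. (\<forall>x. char_comb n \<xi> v x = 1) \<longrightarrow> v = (\<lambda>_. 0))"

primrec nmul :: "nat \<Rightarrow> 'a::ab_group_add \<Rightarrow> 'a" where
  "nmul 0 x = 0"
| "nmul (Suc t) x = x + nmul t x"

lemma nmul_add: "nmul (s + t) x = nmul s x + nmul t x"
  by (induction s) (simp_all add: add.assoc)

lemma character_nmul: "character \<xi> \<Longrightarrow> \<xi> (nmul t x) = \<xi> x ^ t"
  by (induction t) (simp_all add: character_0 character_add)

lemma character_sum: "character \<xi> \<Longrightarrow> \<xi> (\<Sum>i\<in>I. f i) = (\<Prod>i\<in>I. \<xi> (f i))"
  by (induction I rule: infinite_finite_induct) (simp_all add: character_0 character_add)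

lemma open_add_split:
  fixes W :: "'a::topological_ab_group_add set"
  assumes "open W" "x + y \<in> W"
  shows "\<exists>A B. open A \<and> open B \<and> x \<in> A \<and> y \<in> B \<and> (\<forall>a\<in>A. \<forall>b\<in>B. a + b \<in> W)"
proof -
  have "open ((\<lambda>z :: 'a \<times> 'a. fst z + snd z) -` W)"
    using assms(1) by (intro open_vimage continuous_intros)
  then obtain A B where "open A" "open B" "(x, y) \<in> A \<times> B" "A \<times> B \<subseteq> (\<lambda>z. fst z + snd z) -` W"
    using assms(2) by (auto elim!: open_prod_elim[of _ "(x, y)"])
  then show ?thesis by (intro exI[of _ A] exI[of _ B]) auto
qed

text \<open>One neighbourhood serves all partial sums at once; in the grid argument these are the
  differences between the top corner of a cell and the vertices of a simplex in it.\<close>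

lemma open_subset_sums:
  fixes W :: "'a::topological_ab_group_add set" and n :: nat
  assumes "open W" "0 \<in> W"
  shows "\<exists>U. open U \<and> 0 \<in> U \<and> (\<forall>A\<subseteq>{..<n}. \<forall>u. (\<forall>k\<in>A. u k \<in> U) \<longrightarrow> (\<Sum>k\<in>A. u k) \<in> W)"
  using assms
proof (induction n arbitrary: W)
  case 0
  then show ?case by (intro exI[of _ W]) auto
next
  case (Suc n)
  have "0 + 0 \<in> W" using Suc.prems by simp
  from open_add_split[OF Suc.prems(1) this] obtain A B
    where AB: "open A" "open B" "0 \<in> A" "0 \<in> B" "\<forall>a\<in>A. \<forall>b\<in>B. a + b \<in> W"
    by (elim exE conjE)
  from Suc.IH[OF AB(1,3)] obtain U where U: "open U" "0 \<in> U"
      "\<forall>C\<subseteq>{..<n}. \<forall>u. (\<forall>k\<in>C. u k \<in> U) \<longrightarrow> (\<Sum>k\<in>C. u k) \<in> A"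
    by (elim exE conjE)
  have "(\<Sum>k\<in>C. u k) \<in> W" if C: "C \<subseteq> {..<Suc n}" "\<And>k. k \<in> C \<Longrightarrow> u k \<in> U \<inter> B" for C u
  proof -
    have fin: "finite C" using C(1) finite_subset by blast
    have "(\<Sum>k\<in>C - {n}. u k) \<in> A"
      by (rule U(3)[rule_format]) (use C in \<open>auto simp: less_Suc_eq\<close>)
    moreover have "(\<Sum>k\<in>C. u k) = (\<Sum>k\<in>C - {n}. u k) + (if n \<in> C then u n else 0)"
      using fin by (auto simp: sum.remove add.commute)
    moreover have "(if n \<in> C then u n else 0) \<in> B" using C(2) AB(4) by auto
    ultimately show ?thesis using AB(5) by simp
  qed
  then show ?case using U AB by (intro exI[of _ "U \<inter> B"]) auto
qed

text \<open>A neighbourhood of 0 takes the place of the radius, as the group need not carry a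
  metric.\<close>

lemma compact_group_lebesgue_number:
  fixes V :: "'a::topological_ab_group_add set set"
  assumes comp: "compact (UNIV :: 'a set)" and op: "\<And>S. S \<in> V \<Longrightarrow> open S" and cover: "\<Union>V = UNIV"
  shows "\<exists>W. open W \<and> 0 \<in> W \<and> (\<forall>x. \<exists>S\<in>V. \<forall>w\<in>W. x + w \<in> S)"
proof -
  have "\<exists>S A B. S \<in> V \<and> open A \<and> open B \<and> x \<in> A \<and> 0 \<in> B \<and> (\<forall>a\<in>A. \<forall>b\<in>B. a + b \<in> S)" for x
  proof -
    have "x \<in> \<Union>V" using cover by simp
    then obtain S where "S \<in> V" "x \<in> S" by (elim UnionE)
    then have S: "S \<in> V" "x + 0 \<in> S" by simp_all
    from open_add_split[OF op[OF S(1)] S(2)] S(1) show ?thesis by blast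
  qed
  then obtain S A B where SAB: "\<And>x. S x \<in> V" "\<And>x. open (A x)" "\<And>x. open (B x)" "\<And>x. x \<in> A x"
      "\<And>x. 0 \<in> B x" "\<And>x. \<forall>a\<in>A x. \<forall>b\<in>B x. a + b \<in> S x" by metis
  obtain I where I: "finite I" "UNIV \<subseteq> (\<Union>i\<in>I. A i)"
    by (rule compactE_image[OF comp, of UNIV A]) (use SAB in auto)
  show ?thesis
  proof (intro exI[of _ "\<Inter>i\<in>I. B i"] conjI allI)
    fix x
    obtain i where "i \<in> I" "x \<in> A i" using I(2) by blast
    then show "\<exists>S\<in>V. \<forall>w\<in>(\<Inter>i\<in>I. B i). x + w \<in> S"
      using SAB by (intro bexI[of _ "S i"]) auto
  qed (use I SAB in auto)
qed

text \<open>Dirichlet's pigeonhole argument: among the multiples 0 to \<open>card I\<close> of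
  \<open>x\<close> two lie in the same translate of \<open>C\<close>, and their difference lies in
  \<open>U\<close>. The bound must not depend on \<open>x\<close>, because the grid size is derived
  from it before the grid points are chosen.\<close>

lemma compact_group_small_multiple:
  fixes U :: "'a::topological_ab_group_add set"
  assumes comp: "compact (UNIV :: 'a set)" and U: "open U" "0 \<in> U"
  shows "\<exists>M>0. \<forall>x. \<exists>c\<in>{1..M}. nmul c x \<in> U"
proof -
  have "0 + 0 \<in> U" using U by simp
  from open_add_split[OF U(1) this] obtain A B
    where AB: "open A" "open B" "0 \<in> A" "0 \<in> B" "\<forall>a\<in>A. \<forall>b\<in>B. a + b \<in> U"
    by (elim exE conjE)
  define C where "C = A \<inter> uminus -` B"
  have C: "open C" "0 \<in> C"
    unfolding C_def using AB by (auto intro!: open_Int open_vimage continuous_intros)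
  have diff: "a - b \<in> U" if "a \<in> C" "b \<in> C" for a b
    using bspec[OF bspec[OF AB(5)], of a "- b"] that by (simp add: C_def)
  have op: "open ((\<lambda>x. - g + x) -` C)" for g :: 'a
    using C by (intro open_vimage continuous_intros)
  obtain I where I: "finite I" "UNIV \<subseteq> (\<Union>g\<in>I. (\<lambda>x. - g + x) -` C)"
    by (rule compactE_image[OF comp, of UNIV "\<lambda>g. (\<lambda>x. - g + x) -` C"]) (use op C in auto)
  then have "I \<noteq> {}" by auto
  have "\<exists>c\<in>{1..card I}. nmul c x \<in> U" for x
  proof -
    obtain i where i: "\<And>t. i t \<in> I" "\<And>t. - i t + nmul t x \<in> C" 
    proof -
      have "\<forall>t. \<exists>i. i \<in> I \<and> - i + nmul t x \<in> C" using I(2) by blast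
      then show thesis using that by metis
    qed
    have "\<not> inj_on i {0..card I}"
    proof
      assume "inj_on i {0..card I}"
      then have "card {0..card I} \<le> card I" using i(1) I(1) by (intro card_inj_on_le[of i]) auto
      then show False by simp
    qed
    then obtain s t where st: "s < t" "t \<le> card I" "i s = i t"
      unfolding inj_on_def by (metis atLeastAtMost_iff nat_neq_iff)
    have "nmul t x = nmul s x + nmul (t - s) x" using st(1) nmul_add[of s "t - s" x] by simp
    then have "nmul (t - s) x = (- i t + nmul t x) - (- i s + nmul s x)" using st(3) by simp
    then have "nmul (t - s) x \<in> U" using diff[OF i(2) i(2)] by metis
    then show ?thesis using st by (intro bexI[of _ "t - s"]) auto
  qed
  then show ?thesis using \<open>I \<noteq> {}\<close> I(1) by (intro exI[of _ "card I"]) (auto simp: card_gt_0_iff)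
qed

section \<open>Independent characters map onto the torus\<close>

context haar_group
begin

text \<open>The integrand is a kernel that peaks where every \<open>\<xi> j x\<close> equals
  \<open>z j\<close>. When it is expanded into characters, independence leaves only the constant
  term in the integral, to which each factor contributes its central binomial coefficient.\<close>

lemma integral_fejer:
  fixes \<xi> :: "nat \<Rightarrow> 'a \<Rightarrow> complex"
  assumes ch: "\<And>j. j < n \<Longrightarrow> character (\<xi> j)" and ind: "char_indep n \<xi>"
    and z: "\<And>j. j < n \<Longrightarrow> norm (z j) = 1"
  shows "(\<integral>x. (\<Prod>j<n. (norm (1 + \<xi> j x * cnj (z j))) ^ (2 * N)) \<partial>m) = real ((2 * N) choose N) ^ n"
proof -
  have expand: "complex_of_real (norm (1 + u) ^ (2 * N)) = (\<Sum>k\<le>2 * N. of_nat ((2 * N) choose k) * u powi (int k - int N))"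
    if u: "norm u = 1" for u :: complex
  proof -
    have u0: "u \<noteq> 0" using u by auto
    have "cnj u * u = 1" using u by (metis complex_norm_square mult.commute of_real_1 power_one)
    then have cu: "cnj u = inverse u" using u0 by (metis inverse_unique mult.commute)
    have "complex_of_real (norm (1 + u) ^ (2 * N)) = ((1 + u) * cnj (1 + u)) ^ N"
      by (simp only: power_mult complex_norm_square[symmetric] of_real_power)
    also have "(1 + u) * cnj (1 + u) = (1 + u) ^ 2 * inverse u"
      using u0 by (simp add: cu power2_eq_square field_simps)
    also have "((1 + u) ^ 2 * inverse u) ^ N = (u + 1) ^ (2 * N) * inverse u ^ N"
      by (simp add: power_mult_distrib power_mult add.commute)
    also have "\<dots> = (\<Sum>k\<le>2 * N. of_nat ((2 * N) choose k) * (u ^ k * inverse u ^ N))"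
      by (simp add: binomial_ring sum_distrib_right mult.assoc)
    also have "\<dots> = (\<Sum>k\<le>2 * N. of_nat ((2 * N) choose k) * u powi (int k - int N))"
      using u0 by (simp add: power_int_diff power_inverse divide_inverse)
    finally show ?thesis .
  qed
  define w where "w g j = int (g j) - int N" for g :: "nat \<Rightarrow> nat" and j :: nat
  define K where "K g = (\<Prod>j<n. of_nat ((2 * N) choose g j) * cnj (z j) powi w g j)" for g
  have nz: "norm (\<xi> j x) = 1" if "j < n" for j x using ch[OF that] by (simp add: character_def)
  have eq: "complex_of_real (\<Prod>j<n. norm (1 + \<xi> j x * cnj (z j)) ^ (2 * N))
      = (\<Sum>g\<in>{..<n} \<rightarrow>\<^sub>E {..2 * N}. K g * (\<Prod>j<n. \<xi> j x powi w g j))" for x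
  proof -
    have "complex_of_real (\<Prod>j<n. norm (1 + \<xi> j x * cnj (z j)) ^ (2 * N))
        = (\<Prod>j<n. \<Sum>k\<le>2 * N. of_nat ((2 * N) choose k) * (\<xi> j x * cnj (z j)) powi (int k - int N))"
      unfolding of_real_prod by (intro prod.cong refl expand) (simp add: norm_mult nz z)
    also have "\<dots> = (\<Sum>g\<in>{..<n} \<rightarrow>\<^sub>E {..2 * N}.
        \<Prod>j<n. of_nat ((2 * N) choose g j) * (\<xi> j x * cnj (z j)) powi (int (g j) - int N))"
      by (rule prod_sum_PiE) auto
    also have "\<dots> = (\<Sum>g\<in>{..<n} \<rightarrow>\<^sub>E {..2 * N}. K g * (\<Prod>j<n. \<xi> j x powi w g j))"
      unfolding K_def w_def by (simp add: power_int_mult_distrib prod.distrib mult_ac)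
    finally show ?thesis .
  qed
  have chg: "character (\<lambda>x. \<Prod>j<n. \<xi> j x powi w g j)" for g
    by (intro character_prod character_powi ch) simp
  then have cont: "cont (\<lambda>x. \<Prod>j<n. \<xi> j x powi w g j)" for g
    by (simp add: character_def)
  define g0 where "g0 = restrict (\<lambda>_. N) {..<n}"
  have g0: "g0 \<in> {..<n} \<rightarrow>\<^sub>E {..2 * N}" by (auto simp: g0_def)
  have int_g: "(\<integral>x. (\<Prod>j<n. \<xi> j x powi w g j) \<partial>m) = 0" if g: "g \<in> {..<n} \<rightarrow>\<^sub>E {..2 * N}" "g \<noteq> g0" for g
  proof -
    define v where "v j = (if j < n then w g j else 0)" for j
    have "\<exists>j<n. g j \<noteq> N"
    proof (rule ccontr)
      assume "\<not> ?thesis"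
      then have "g = g0" using g(1) by (intro PiE_ext[OF g(1) g0]) (auto simp: g0_def)
      then show False using g(2) by simp
    qed
    then have "v \<noteq> (\<lambda>_. 0)" by (auto simp: v_def w_def fun_eq_iff)
    moreover have "v \<in> zvec n" by (simp add: v_def zvec_def)
    ultimately obtain a where "char_comb n \<xi> v a \<noteq> 1" using ind unfolding char_indep_def by blast
    then have "(\<Prod>j<n. \<xi> j a powi w g j) \<noteq> 1" by (simp add: char_comb_def v_def)
    with integral_character[OF chg] show ?thesis by blast
  qed
  have fin: "finite ({..<n} \<rightarrow>\<^sub>E {..2 * N})" by (intro finite_PiE) auto
  have "complex_of_real (\<integral>x. (\<Prod>j<n. (norm (1 + \<xi> j x * cnj (z j))) ^ (2 * N)) \<partial>m)
      = (\<integral>x. (\<Sum>g\<in>{..<n} \<rightarrow>\<^sub>E {..2 * N}. K g * (\<Prod>j<n. \<xi> j x powi w g j)) \<partial>m)"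
    unfolding eq[symmetric] by (rule integral_complex_of_real[symmetric])
  also have "\<dots> = (\<Sum>g\<in>{..<n} \<rightarrow>\<^sub>E {..2 * N}. K g * (\<integral>x. (\<Prod>j<n. \<xi> j x powi w g j) \<partial>m))"
    by (subst Bochner_Integration.integral_sum)
      (auto intro: continuous_integrable[OF continuous_on_mult[OF continuous_on_const cont]])
  also have "\<dots> = (\<Sum>g\<in>{g0}. K g * (\<integral>x. (\<Prod>j<n. \<xi> j x powi w g j) \<partial>m))"
    using fin g0 int_g by (intro sum.mono_neutral_right) auto
  also have "\<dots> = complex_of_real (real ((2 * N) choose N) ^ n)"
    by (simp add: K_def g0_def w_def)
  finally show ?thesis unfolding of_real_eq_iff .
qed

text \<open>If \<open>z\<close> is missed, compactness keeps the image away from it, and the kernel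
  of \<open>integral_fejer\<close> is everywhere exponentially smaller than
  \<open>4 ^ (N * n)\<close>. Its integral, a power of the central binomial coefficient, falls short
  of that number by a polynomial factor at most.\<close>

lemma independent_characters_surjective:
  fixes \<xi> :: "nat \<Rightarrow> 'a \<Rightarrow> complex"
  assumes ch: "\<And>j. j < n \<Longrightarrow> character (\<xi> j)" and ind: "char_indep n \<xi>"
    and z: "\<And>j. j < n \<Longrightarrow> norm (z j) = 1"
  shows "\<exists>x. \<forall>j<n. \<xi> j x = z j"
proof (rule ccontr)
  assume no: "\<not> ?thesis"
  then have n: "n > 0" by (cases n) auto
  have cont: "cont (\<xi> j)" if "j < n" for j using ch[OF that] by (simp add: character_def)
  define D where "D x = (\<Sum>j<n. norm (\<xi> j x - z j))" for x
  have "cont D" unfolding D_def[abs_def] by (intro continuous_intros cont) simp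
  then obtain x0 where x0: "\<And>x. D x0 \<le> D x"
    using continuous_attains_inf[OF compact_UNIV, of D] by auto
  have "D x0 > 0"
  proof -
    obtain j where "j < n" "\<xi> j x0 \<noteq> z j" using no by blast
    then have "norm (\<xi> j x0 - z j) > 0" by simp
    also have "norm (\<xi> j x0 - z j) \<le> D x0"
      unfolding D_def using \<open>j < n\<close> by (intro member_le_sum) auto
    finally show ?thesis .
  qed
  \<comment> \<open>At every point some coordinate is at least as far off as the average of the
    minimal total distance.\<close>
  define \<delta> where "\<delta> = D x0 / n"
  have \<delta>: "\<delta> > 0" using \<open>D x0 > 0\<close> n by (simp add: \<delta>_def)
  have far: "\<exists>j<n. norm (\<xi> j x - z j) \<ge> \<delta>" for x
  proof (rule ccontr)
    assume "\<not> ?thesis"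
    then have "D x < (\<Sum>j<n. \<delta>)"
      unfolding D_def using n by (intro sum_strict_mono) auto
    also have "\<dots> = D x0" using n by (simp add: \<delta>_def)
    finally show False using x0[of x] by simp
  qed
  \<comment> \<open>The parallelogram law for the unit vectors \<open>\<xi> j x\<close> and
    \<open>z j\<close>, after \<open>cnj (z j)\<close> is factored out.\<close>
  have id: "(norm (1 + \<xi> j x * cnj (z j)))\<^sup>2 = 4 - (norm (\<xi> j x - z j))\<^sup>2" if j: "j < n" for j x
  proof -
    define a where "a = \<xi> j x"
    have na: "(norm a)\<^sup>2 = 1" "(norm (z j))\<^sup>2 = 1" using ch[OF j] z[OF j] by (auto simp: character_def a_def)
    have "norm (1 + a * cnj (z j)) = norm (z j * cnj (z j) + a * cnj (z j))"
    proof -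
      have "z j * cnj (z j) = 1" using na(2) by (metis complex_norm_square of_real_1)
      then show ?thesis by simp
    qed
    also have "z j * cnj (z j) + a * cnj (z j) = (a + z j) * cnj (z j)" by (simp add: algebra_simps)
    also have "norm \<dots> = norm (a + z j)" using z[OF j] by (simp add: norm_mult)
    finally have "(norm (1 + a * cnj (z j)))\<^sup>2 = (norm (a + z j))\<^sup>2" by simp
    also have "\<dots> = 4 - (norm (a - z j))\<^sup>2"
    proof -
      have "(Re a)\<^sup>2 + (Im a)\<^sup>2 = 1" "(Re (z j))\<^sup>2 + (Im (z j))\<^sup>2 = 1"
        using na by (simp_all add: cmod_power2)
      then show ?thesis
        unfolding cmod_power2 minus_complex.sel plus_complex.sel power2_sum power2_diff by linarith
    qed
    finally show ?thesis by (simp add: a_def)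
  qed
  define \<rho> where "\<rho> = 1 - \<delta>\<^sup>2 / 4"
  have \<delta>2: "\<delta>\<^sup>2 \<le> 4"
  proof -
    obtain j where j: "j < n" "norm (\<xi> j 0 - z j) \<ge> \<delta>" using far by blast
    then have "norm (\<xi> j 0 - z j) \<le> 2"
      using norm_triangle_ineq4[of "\<xi> j 0" "z j"] z[of j] ch[of j] by (simp add: character_def)
    then have "\<delta> \<le> 2" using j by simp
    then show ?thesis using power_mono[of \<delta> 2 2] \<delta> by simp
  qed
  have \<rho>: "0 \<le> \<rho>" "\<rho> < 1" using \<delta>2 \<delta> by (auto simp: \<rho>_def)
  have bound: "(\<Prod>j<n. norm (1 + \<xi> j x * cnj (z j)) ^ (2 * N)) \<le> 4 ^ (N * n) * \<rho> ^ N" for x N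
  proof -
    obtain i where i: "i < n" "norm (\<xi> i x - z i) \<ge> \<delta>" using far by blast
    have le4: "norm (1 + \<xi> j x * cnj (z j)) ^ (2 * N) \<le> 4 ^ N" if "j < n" for j
    proof -
      have "(norm (1 + \<xi> j x * cnj (z j)))\<^sup>2 \<le> 4" unfolding id[OF that] by simp
      then show ?thesis unfolding power_mult by (intro power_mono) auto
    qed
    have "(norm (\<xi> i x - z i))\<^sup>2 \<ge> \<delta>\<^sup>2" using i \<delta> by (intro power_mono) auto
    then have "(norm (1 + \<xi> i x * cnj (z i)))\<^sup>2 \<le> 4 * \<rho>" unfolding id[OF i(1)] by (simp add: \<rho>_def)
    then have lei: "norm (1 + \<xi> i x * cnj (z i)) ^ (2 * N) \<le> (4 * \<rho>) ^ N"
      unfolding power_mult by (intro power_mono) auto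
    have "(\<Prod>j<n. norm (1 + \<xi> j x * cnj (z j)) ^ (2 * N))
        = norm (1 + \<xi> i x * cnj (z i)) ^ (2 * N) * (\<Prod>j\<in>{..<n} - {i}. norm (1 + \<xi> j x * cnj (z j)) ^ (2 * N))"
      using i by (intro prod.remove) auto
    also have "\<dots> \<le> (4 * \<rho>) ^ N * (\<Prod>j\<in>{..<n} - {i}. 4 ^ N)"
      using lei le4 \<rho> by (intro mult_mono prod_mono prod_nonneg) auto
    also have "\<dots> = 4 ^ (N * n) * \<rho> ^ N"
      using i by (simp add: power_mult_distrib power_mult[symmetric] mult_ac power_add[symmetric] flip: mult_Suc)
        (metis Suc_pred add.commute mult.commute mult_Suc_right n power_add)
    finally show ?thesis .
  qed
  have ineq: "1 \<le> (2 * real n * (real M * \<rho> ^ M))" if M: "M > 0" for M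
  proof -
    \<comment> \<open>A multiple of \<open>n\<close> makes the right-hand side of the estimate an
      \<open>n\<close>-th power, so that a root can be taken.\<close>
    define N where "N = n * M"
    have N: "N > 0" using M n by (simp add: N_def)
    have P_cont: "cont (\<lambda>x. \<Prod>j<n. norm (1 + \<xi> j x * cnj (z j)) ^ (2 * N))"
      by (intro continuous_intros cont) simp
    have "4 ^ N / (2 * real N) \<le> real ((2 * N) choose N)"
      using central_binomial_lower_bound[OF N] by simp
    then have "(4 ^ N / (2 * real N)) ^ n \<le> real ((2 * N) choose N) ^ n"
      by (intro power_mono) auto
    also have "\<dots> = (\<integral>x. (\<Prod>j<n. (norm (1 + \<xi> j x * cnj (z j))) ^ (2 * N)) \<partial>m)"
      using integral_fejer[OF ch ind z] by simp
    also have "\<dots> \<le> norm \<dots>" by simp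
    also have "\<dots> \<le> 4 ^ (N * n) * \<rho> ^ N"
    proof (rule norm_integral_le[OF continuous_measurable[OF P_cont]])
      fix x
      have "0 \<le> (\<Prod>j<n. norm (1 + \<xi> j x * cnj (z j)) ^ (2 * N))" by (intro prod_nonneg) auto
      then show "norm (\<Prod>j<n. norm (1 + \<xi> j x * cnj (z j)) ^ (2 * N)) \<le> 4 ^ (N * n) * \<rho> ^ N"
        using bound by simp
    qed
    finally have "4 ^ (N * n) / (2 * real N) ^ n \<le> 4 ^ (N * n) * \<rho> ^ N"
      by (simp add: power_divide power_mult)
    then have "1 \<le> (2 * real N) ^ n * \<rho> ^ N"
      using N by (simp add: field_simps)
    also have "\<dots> = (2 * real n * (real M * \<rho> ^ M)) ^ n"
      by (simp add: N_def power_mult_distrib power_mult mult_ac)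
    finally have "1 \<le> (2 * real n * (real M * \<rho> ^ M)) ^ n" .
    moreover have "0 \<le> 2 * real n * (real M * \<rho> ^ M)" using \<rho> by simp
    ultimately show ?thesis
      using n power_strict_mono[of "2 * real n * (real M * \<rho> ^ M)" 1 n] by force
  qed
  have "(\<lambda>M. 2 * real n * (real M * \<rho> ^ M)) \<longlonglongrightarrow> 2 * real n * 0"
    using \<rho> by (intro tendsto_mult_left powser_times_n_limit_0) simp
  moreover have "\<forall>\<^sub>F M in sequentially. 1 \<le> 2 * real n * (real M * \<rho> ^ M)"
    using ineq by (auto simp: eventually_sequentially intro!: exI[of _ 1])
  ultimately have "1 \<le> 2 * real n * (0 :: real)" by (intro tendsto_lowerbound) auto
  then show False by simp
qed

text \<open>
  Sperner-type argument on a grid inside the group: \<open>grid\<close> maps the combinatorial cube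
  \<open>{0..p} ^ n\<close> into the group so that neighbouring grid points are close and opposite
  faces are separated by the characters.
\<close>
lemma covering_dim_ge_independent:
  fixes \<xi> :: "nat \<Rightarrow> 'a \<Rightarrow> complex"
  assumes ch: "\<And>j. j < n \<Longrightarrow> character (\<xi> j)" and ind: "char_indep n \<xi>"
    and dim: "covering_dim_le (euclidean :: 'a topology) d"
  shows "n \<le> d"
proof -
  have cont: "cont (\<xi> j)" if "j < n" for j using ch[OF that] by (simp add: character_def)
  \<comment> \<open>For \<open>k < n\<close> no set \<open>B s\<close> meets both of the faces
    \<open>\<xi> k = 1\<close> and \<open>\<xi> k = -1\<close>; every member of a refinement
    inherits this.\<close>
  define B where "B s = {x. \<forall>k<n. (k \<in> s \<longrightarrow> \<xi> k x \<noteq> 1) \<and> (k \<notin> s \<longrightarrow> \<xi> k x \<noteq> -1)}" for s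
  have opB: "open (B s)" for s
  proof -
    have "B s = (\<Inter>k\<in>{..<n}. if k \<in> s then {x. \<xi> k x \<noteq> 1} else {x. \<xi> k x \<noteq> -1})"
      unfolding B_def by auto
    also have "open \<dots>"
      using cont by (intro open_INT) (auto intro!: open_Collect_neq continuous_intros)
    finally show ?thesis .
  qed
  have coverB: "\<Union>(B ` Pow {..<n}) = UNIV"
  proof -
    have "x \<in> \<Union>(B ` Pow {..<n})" for x
    proof (rule UnionI)
      show "B {k. k < n \<and> \<xi> k x = -1} \<in> B ` Pow {..<n}" by (rule imageI) auto
      show "x \<in> B {k. k < n \<and> \<xi> k x = -1}" by (simp add: B_def)
    qed
    then show ?thesis by (intro UNIV_eq_I[symmetric])
  qed
  obtain V where V: "finite V" "\<And>S. S \<in> V \<Longrightarrow> open S" "\<Union>V = UNIV"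
      "\<And>S. S \<in> V \<Longrightarrow> \<exists>s. S \<subseteq> B s" "\<And>x. card {S\<in>V. x \<in> S} \<le> d + 1"

  proof -
    have "\<exists>V. finite V \<and> (\<forall>S\<in>V. openin euclidean S) \<and> \<Union>V = topspace euclidean \<and>
        (\<forall>S\<in>V. \<exists>S'\<in>B ` Pow {..<n}. S \<subseteq> S') \<and>
        (\<forall>x\<in>topspace euclidean. card {S\<in>V. x \<in> S} \<le> d + 1)"
    proof -
      have prem: "finite (B ` Pow {..<n}) \<and> (\<forall>S\<in>B ` Pow {..<n}. openin euclidean S) \<and>
          \<Union>(B ` Pow {..<n}) = topspace euclidean"
        using opB coverB by (simp add: open_openin[symmetric])
      show ?thesis
        by (rule mp[OF spec[OF dim[unfolded covering_dim_le_def]] prem])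
    qed
    then obtain V where V: "finite V" "\<forall>S\<in>V. openin euclidean S" "\<Union>V = topspace euclidean"
        "\<forall>S\<in>V. \<exists>S'\<in>B ` Pow {..<n}. S \<subseteq> S'" "\<forall>x\<in>topspace euclidean. card {S\<in>V. x \<in> S} \<le> d + 1"
      by (elim exE conjE)
    show thesis
    proof (rule that[of V])
      show "\<exists>s. S \<subseteq> B s" if "S \<in> V" for S using V(4) that by blast
      show "open S" if "S \<in> V" for S using bspec[OF V(2) that] by (simp only: open_openin)
      show "card {S\<in>V. x \<in> S} \<le> d + 1" for x using V(5) by simp
      show "finite V" by (rule V(1))
      show "\<Union>V = UNIV" using V(3) by simp
    qed
  qed
  have opp: "\<not> (\<xi> k x = 1 \<and> \<xi> k y = -1)" if "S \<in> V" "k < n" "x \<in> S" "y \<in> S" for S k x y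
    using V(4)[OF that(1)] that(2-4) unfolding B_def by blast
  have "\<exists>W. open W \<and> 0 \<in> W \<and> (\<forall>x. \<exists>S\<in>V. \<forall>w\<in>W. x + w \<in> S)"
    by (rule compact_group_lebesgue_number[OF compact_UNIV _ V(3)]) (rule V(2))
  then obtain W where W: "open W" "0 \<in> W" "\<forall>x. \<exists>S\<in>V. \<forall>w\<in>W. x + w \<in> S"
    by (elim exE conjE)
  from W(3) have "\<forall>x. \<exists>S. S \<in> V \<and> (\<forall>w\<in>W. x + w \<in> S)" by (simp add: Bex_def)
  from choice[OF this] obtain cov where "\<forall>x. cov x \<in> V \<and> (\<forall>w\<in>W. x + w \<in> cov x)" ..
  then have cov: "\<And>x. cov x \<in> V" "\<And>x w. w \<in> W \<Longrightarrow> x + w \<in> cov x" by simp_all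
  have cov_self: "x \<in> cov x" for x using cov(2)[OF W(2), of x] by simp
  from open_subset_sums[OF W(1,2), of n] obtain U where U: "open U" "0 \<in> U"
      "\<forall>A\<subseteq>{..<n}. \<forall>u. (\<forall>k\<in>A. u k \<in> U) \<longrightarrow> (\<Sum>k\<in>A. u k) \<in> W"
    by (elim exE conjE)
  from compact_group_small_multiple[OF compact_UNIV U(1,2)]
  obtain M where M: "M > 0" "\<forall>x. \<exists>c\<in>{1..M}. nmul c x \<in> U"
    by (elim exE conjE)
  \<comment> \<open>The factorial is a multiple of every possible \<open>c k\<close>, so that
    \<open>q k\<close> steps of length \<open>c k\<close> reach exactly \<open>p\<close>. It is
    fixed before the points \<open>x k\<close>, which depend on it.\<close>
  define p :: nat where "p = fact M"
  have p: "p > 0" by (simp add: p_def)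
  have "\<exists>x. \<forall>j<n. \<xi> j x = (if j = k then cis (pi / p) else 1)" for k
    by (rule independent_characters_surjective[OF ch ind]) auto
  then have "\<forall>k. \<exists>x. \<forall>j<n. \<xi> j x = (if j = k then cis (pi / p) else 1)" by blast
  from choice[OF this] obtain x
    where x: "\<And>k j. j < n \<Longrightarrow> \<xi> j (x k) = (if j = k then cis (pi / p) else 1)" by blast
  have "\<forall>k. \<exists>c. c \<in> {1..M} \<and> nmul c (x k) \<in> U" using M(2) by blast
  from choice[OF this] obtain c where c: "\<And>k. c k \<in> {1..M}" "\<And>k. nmul (c k) (x k) \<in> U" by blast
  define y where "y k = nmul (c k) (x k)" for k
  define q where "q k = p div c k" for k
  have cq: "c k * q k = p" for k
    using c(1)[of k] dvd_fact[of "c k" M] by (simp add: q_def p_def)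
  have q_le: "q k \<le> p" for k by (simp add: q_def)
  \<comment> \<open>Coordinate \<open>k\<close> arrives at the face \<open>\<xi> k = -1\<close>
    after \<open>q k\<close> steps. The truncation by \<open>min\<close> keeps it there on the rest
    of the cube, whose side is \<open>p\<close> in all directions.\<close>
  define grid where "grid g = (\<Sum>k<n. nmul (min (g k) (q k)) (y k))" for g :: "nat \<Rightarrow> nat"
  have char_grid: "\<xi> j (grid g) = cis (pi * (real (c j) * real (min (g j) (q j))) / p)" if j: "j < n" for j g
  proof -
    have "\<xi> j (grid g) = (\<Prod>k<n. if k = j then cis (pi / p) ^ (c j * min (g j) (q j)) else 1)"
      unfolding grid_def y_def character_sum[OF ch[OF j]]
      by (intro prod.cong refl) (auto simp: character_nmul[OF ch[OF j]] x[OF j] power_mult)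
    also have "\<dots> = cis (pi / p) ^ (c j * min (g j) (q j))" using j by simp
    finally show ?thesis by (simp add: Complex.DeMoivre mult_ac)
  qed
  \<comment> \<open>Label 1 marks the cover members that touch the face \<open>\<xi> k = -1\<close>;
    a member containing a point of the face \<open>\<xi> k = 1\<close> cannot do so and has label 0.
    These are the boundary conditions of Kuhn's lemma.\<close>
  define lab :: "'a set \<Rightarrow> nat \<Rightarrow> nat" where "lab S k = (if \<exists>x\<in>S. \<xi> k x = -1 then 1 else 0)" for S k
  have "odd (card {s. ksimplex p n s \<and> (reduced n \<circ> (\<lambda>g. lab (cov (grid g)))) ` s = {..n}})"
  proof (rule kuhn_combinatorial[OF p]; intro allI impI; elim conjE)
    fix g :: "nat \<Rightarrow> nat" and j assume j: "j < n" and g: "g j = 0"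
    have "\<xi> j (grid g) = 1" using char_grid[OF j] g by simp
    then show "lab (cov (grid g)) j = 0"
      using opp[OF cov(1) j cov_self] by (auto simp: lab_def)
  next
    fix g :: "nat \<Rightarrow> nat" and j assume j: "j < n" and g: "g j = p"
    have "real (c j) * real (min (g j) (q j)) = real p"
      using q_le[of j] g cq[of j] by (simp add: min_def flip: of_nat_mult)
    then have "\<xi> j (grid g) = -1" using char_grid[OF j, of g] p by simp
    then show "lab (cov (grid g)) j = 1"
      using cov_self by (auto simp: lab_def)
  qed
  then have "{s. ksimplex p n s \<and> (reduced n \<circ> (\<lambda>g. lab (cov (grid g)))) ` s = {..n}} \<noteq> {}"
    by (rule odd_card_imp_not_empty)
  then obtain s b u where ks: "kuhn_simplex p n b u s" and rl: "(reduced n \<circ> (\<lambda>g. lab (cov (grid g)))) ` s = {..n}"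
    by (auto elim: ksimplex.cases)
  interpret kuhn_simplex p n b u s by fact
  \<comment> \<open>Each vertex of the completely labelled simplex is \<open>b\<close> with some
    coordinates raised by 1. The corner with all coordinates raised differs from it by a sum of
    distinct \<open>y k\<close>, which lies in \<open>W\<close>. Hence \<open>n + 1\<close>
    differently labelled cover members all contain \<open>top\<close>.\<close>
  define top where "top = grid (\<lambda>k. Suc (b k))"
  have "top \<in> cov (grid g)" if "g \<in> s" for g
  proof -
    obtain A where g: "g = (\<lambda>j. if j \<in> A then Suc (b j) else b j)" using \<open>g \<in> s\<close> unfolding s_pre by blast
    have "top - grid g = (\<Sum>k<n. nmul (min (Suc (b k)) (q k)) (y k) - nmul (min (g k) (q k)) (y k))"
      by (simp add: top_def grid_def sum_subtractf)
    also have "\<dots> = (\<Sum>k<n. if k \<notin> A \<and> b k < q k then y k else 0)"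
    proof (rule sum.cong[OF refl])
      fix k
      show "nmul (min (Suc (b k)) (q k)) (y k) - nmul (min (g k) (q k)) (y k)
          = (if k \<notin> A \<and> b k < q k then y k else 0)"
      proof (cases "k \<notin> A \<and> b k < q k")
        case True
        then have "min (Suc (b k)) (q k) = Suc (b k)" "min (g k) (q k) = b k" by (auto simp: g)
        then show ?thesis using True by simp
      next
        case False
        then have "min (Suc (b k)) (q k) = min (g k) (q k)" by (auto simp: g)
        then show ?thesis by (simp only: if_not_P[OF False] diff_self)
      qed
    qed
    also have "\<dots> = (\<Sum>k\<in>{k\<in>{..<n}. k \<notin> A \<and> b k < q k}. y k)"
      by (rule sum.inter_filter[symmetric]) simp
    also have "\<dots> \<in> W" by (rule U(3)[rule_format]) (auto simp: y_def c(2))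
    finally have "top - grid g \<in> W" .
    from cov(2)[OF this, of "grid g"] show ?thesis by simp
  qed
  note top = this
  have fin: "finite {S\<in>V. top \<in> S}" using V(1) by simp
  have "{..n} \<subseteq> (\<lambda>S. reduced n (lab S)) ` {S\<in>V. top \<in> S}"
    unfolding rl[symmetric]
  proof
    fix k assume "k \<in> (reduced n \<circ> (\<lambda>g. lab (cov (grid g)))) ` s"
    then obtain g where "g \<in> s" "k = reduced n (lab (cov (grid g)))" by auto
    then show "k \<in> (\<lambda>S. reduced n (lab S)) ` {S\<in>V. top \<in> S}"
      using cov(1) top by (intro image_eqI[of _ _ "cov (grid g)"]) simp_all
  qed
  then have "card {..n} \<le> card ((\<lambda>S. reduced n (lab S)) ` {S\<in>V. top \<in> S})"
    by (rule card_mono[OF finite_imageI[OF fin]])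
  also have "\<dots> \<le> card {S\<in>V. top \<in> S}" by (rule card_image_le[OF fin])
  finally have "card {..n} \<le> card {S\<in>V. top \<in> S}" .
  then show ?thesis using V(5)[of top] by simp
qed

end


section \<open>Mixing in terms of characters\<close>

lemma epimorphism_id: "epimorphism id"
  by (auto simp: epimorphism_def continuous_on_id)

lemma epimorphism_funpow:
  assumes "epimorphism T"
  shows "epimorphism (T ^^ n)"
proof (induction n)
  case 0 then show ?case by (simp add: epimorphism_id[unfolded id_def] id_def)
next
  case (Suc n)
  have "cont (T \<circ> T ^^ n)"
    using assms Suc unfolding epimorphism_def
    by (intro continuous_on_compose) (auto intro: continuous_on_subset)
  moreover have "surj (T \<circ> T ^^ n)"
    using assms Suc unfolding epimorphism_def by (intro comp_surj) auto
  ultimately show ?case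
    using assms Suc unfolding epimorphism_def funpow.simps by simp
qed

abbreviation orbit_prod :: "('a \<Rightarrow> 'a) set \<Rightarrow> (('a \<Rightarrow> 'a) \<Rightarrow> 'a \<Rightarrow> 'b) \<Rightarrow> nat \<Rightarrow> 'a \<Rightarrow> 'b::comm_monoid_mult" where
  "orbit_prod F f n x \<equiv> (\<Prod>U\<in>F. f U ((U ^^ n) x))"

abbreviation orbit_inter :: "('a \<Rightarrow> 'a) set \<Rightarrow> (('a \<Rightarrow> 'a) \<Rightarrow> 'a set) \<Rightarrow> nat \<Rightarrow> 'a set" where
  "orbit_inter F B n \<equiv> (\<Inter>U\<in>F. (U ^^ n) -` B U)"

definition characters_free :: "('a::topological_ab_group_add \<Rightarrow> 'a) set \<Rightarrow> bool" where
  "characters_free F \<longleftrightarrow> (\<forall>\<xi>. (\<forall>U\<in>F. character (\<xi> U)) \<longrightarrow>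
     infinite {n. \<forall>x. orbit_prod F \<xi> n x = 1} \<longrightarrow> (\<forall>U\<in>F. \<forall>x. \<xi> U x = 1))"

section \<open>Mixing from freeness of characters\<close>

context haar_group
begin

lemma distr_epimorphism:
  assumes T: "epimorphism T"
  shows "distr m m T = m"
proof (rule measure_eqI)
  fix A assume "A \<in> sets (distr m m T)"
  then have A: "A \<in> sets m" by simp
  then have "emeasure (distr m m T) A = emeasure m (T -` A)"
    by (simp add: emeasure_distr epimorphism_measurable[OF T])
  also have "\<dots> = emeasure m A"
    using measure_vimage_epimorphism[OF T A] by (simp add: emeasure_eq_measure)
  finally show "emeasure (distr m m T) A = emeasure m A" .
qed simp

lemma integral_measurable_epimorphism:
  fixes f :: "'a \<Rightarrow> real"
  assumes T: "epimorphism T" and f: "f \<in> borel_measurable m"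
  shows "(\<integral>x. f (T x) \<partial>m) = (\<integral>x. f x \<partial>m)"
  using integral_distr[OF epimorphism_measurable[OF T] f] distr_epimorphism[OF T] by simp

lemma sets_completion_approx:
  assumes "A \<in> sets (completion m)"
  shows "\<exists>C N. C \<in> sets m \<and> N \<in> null_sets m \<and> (A - C) \<union> (C - A) \<subseteq> N"
proof -
  obtain S N N' where "A = S \<union> N" "N \<subseteq> N'" "N' \<in> null_sets m" "S \<in> sets m"
    using assms by (rule sets_completionE)
  then show ?thesis by (intro exI[of _ S] exI[of _ N']) auto
qed

lemma measure_completion_eq:
  assumes C: "C \<in> sets m" and N: "N \<in> null_sets m" and sub: "(A - C) \<union> (C - A) \<subseteq> N"
  shows "measure (completion m) A = measure m C"
proof -
  have "A = (C - N) \<union> (A \<inter> N)" using sub by blast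
  moreover have "C - N \<in> sets m" using C N by auto
  ultimately have A: "A \<in> sets (completion m)"
    using N by (intro sets_completionI[of A "C - N" "A \<inter> N" N]) auto
  have "AE x in completion m. x \<in> A \<longleftrightarrow> x \<in> C"
  proof (rule AE_completion[OF AE_mp[OF AE_not_in[OF N]]], rule AE_I2, rule impI)
    fix x assume "x \<notin> N"
    then show "x \<in> A \<longleftrightarrow> x \<in> C" using sub by blast
  qed
  then have "measure (completion m) A = measure (completion m) C"
    using A C by (intro measure_eq_AE) auto
  then show ?thesis using C by simp
qed

lemma character_product_epimorphisms:
  assumes "\<And>U. U \<in> F \<Longrightarrow> epimorphism U" "\<And>U. U \<in> F \<Longrightarrow> character (\<xi> U)"
  shows "character (\<lambda>x. \<Prod>U\<in>F. \<xi> U ((U ^^ n) x))"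
proof (rule character_prod)
  fix U assume "U \<in> F"
  then show "character (\<lambda>x. \<xi> U ((U ^^ n) x))"
    by (intro character_epimorphism[OF assms(2) epimorphism_funpow[OF assms(1)]])
qed

text \<open>For a nontrivial family, freeness makes the product a nontrivial character for all large
  \<open>n\<close>. Its integral is then 0, as is one factor of the limit.\<close>

lemma integral_characters_tendsto:
  assumes F: "finite F" and epi: "\<And>U. U \<in> F \<Longrightarrow> epimorphism U"
    and ch: "\<And>U. U \<in> F \<Longrightarrow> character (\<xi> U)"
    and free: "characters_free F"
  shows "(\<lambda>n. \<integral>x. orbit_prod F \<xi> n x \<partial>m) \<longlonglongrightarrow> (\<Prod>U\<in>F. \<integral>x. \<xi> U x \<partial>m)"
proof (cases "\<forall>U\<in>F. \<forall>x. \<xi> U x = 1")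
  case True
  then show ?thesis by simp
next
  case False
  then obtain U a where U: "U \<in> F" "\<xi> U a \<noteq> 1" by blast
  have "(\<integral>x. \<xi> U x \<partial>m) = 0" using integral_character[OF ch] U by blast
  then have zero: "(\<Prod>U\<in>F. \<integral>x. \<xi> U x \<partial>m) = 0" using F U(1) by (intro prod_zero) auto
  have "finite {n. \<forall>x. orbit_prod F \<xi> n x = 1}" 
  proof (rule ccontr)
    assume "infinite {n. \<forall>x. orbit_prod F \<xi> n x = 1}"
    then show False using False free ch unfolding characters_free_def by blast
  qed
  then obtain N where N: "\<And>n. \<forall>x. orbit_prod F \<xi> n x = 1 \<Longrightarrow> n < N"
    unfolding finite_nat_set_iff_bounded by blast
  have "(\<integral>x. orbit_prod F \<xi> n x \<partial>m) = 0" if "n \<ge> N" for n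
  proof -
    obtain a where "orbit_prod F \<xi> n a \<noteq> 1" using N[of n] \<open>n \<ge> N\<close> by fastforce
    moreover have "character (\<lambda>x. \<Prod>U\<in>F. \<xi> U ((U ^^ n) x))"
      by (rule character_product_epimorphisms) (simp_all add: epi ch)
    ultimately show ?thesis by (intro integral_character)
  qed
  then have "\<forall>\<^sub>F n in sequentially. (\<integral>x. orbit_prod F \<xi> n x \<partial>m) = 0"
    unfolding eventually_sequentially by blast
  then show ?thesis unfolding zero by (rule tendsto_eventually)
qed

text \<open>Multilinear expansion into families of characters; the index set of the sum does not
  depend on \<open>n\<close>, so the limit is taken term by term.\<close>

lemma integral_trig_tendsto:
  assumes F: "finite F" and epi: "\<And>U. U \<in> F \<Longrightarrow> epimorphism U"
    and f: "\<And>U. U \<in> F \<Longrightarrow> trig (f U)"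
    and free: "characters_free F"
  shows "(\<lambda>n. \<integral>x. orbit_prod F f n x \<partial>m) \<longlonglongrightarrow> (\<Prod>U\<in>F. \<integral>x. f U x \<partial>m)"
proof -
  have "\<forall>U. \<exists>K c. U \<in> F \<longrightarrow> finite K \<and> (\<forall>\<xi>\<in>K. character \<xi>) \<and> f U = (\<lambda>x. \<Sum>\<xi>\<in>K. c \<xi> * \<xi> x)"
    using trig_eq_sum[OF f] by blast
  from choice[OF this] obtain K where
    "\<forall>U. \<exists>c. U \<in> F \<longrightarrow> finite (K U) \<and> (\<forall>\<xi>\<in>K U. character \<xi>) \<and> f U = (\<lambda>x. \<Sum>\<xi>\<in>K U. c \<xi> * \<xi> x)" ..
  from choice[OF this] obtain c where
    "\<forall>U. U \<in> F \<longrightarrow> finite (K U) \<and> (\<forall>\<xi>\<in>K U. character \<xi>) \<and> f U = (\<lambda>x. \<Sum>\<xi>\<in>K U. c U \<xi> * \<xi> x)" ..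
  then have K: "\<And>U. U \<in> F \<Longrightarrow> finite (K U)" "\<And>U \<xi>. U \<in> F \<Longrightarrow> \<xi> \<in> K U \<Longrightarrow> character \<xi>"
      "\<And>U x. U \<in> F \<Longrightarrow> f U x = (\<Sum>\<xi>\<in>K U. c U \<xi> * \<xi> x)"
    by simp_all
  define C where "C g = (\<Prod>U\<in>F. c U (g U))" for g
  have chg: "character (g U)" if "g \<in> PiE F K" "U \<in> F" for g U
    using that K(2) by (auto simp: PiE_iff)
  have expand: "(\<Prod>U\<in>F. f U (y U)) = (\<Sum>g\<in>PiE F K. C g * (\<Prod>U\<in>F. g U (y U)))" for y
  proof -
    have "(\<Prod>U\<in>F. f U (y U)) = (\<Prod>U\<in>F. \<Sum>\<xi>\<in>K U. c U \<xi> * \<xi> (y U))"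
      by (rule prod.cong[OF refl]) (rule K(3))
    also have "\<dots> = (\<Sum>g\<in>PiE F K. \<Prod>U\<in>F. c U (g U) * g U (y U))"
      using F K(1) by (rule prod_sum_PiE)
    finally show ?thesis by (simp add: C_def prod.distrib)
  qed
  have int_eq: "(\<integral>x. orbit_prod F f n x \<partial>m)
      = (\<Sum>g\<in>PiE F K. C g * (\<integral>x. orbit_prod F g n x \<partial>m))" for n
  proof -
    have "cont (\<lambda>x. \<Prod>U\<in>F. g U ((U ^^ n) x))" if "g \<in> PiE F K" for g
      using character_product_epimorphisms[OF epi chg[OF that]] by (simp add: character_def)
    note cont = this
    have "integrable m (\<lambda>x. C g * orbit_prod F g n x)" if "g \<in> PiE F K" for g
      by (intro continuous_integrable continuous_on_mult continuous_on_const cont that)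
    from Bochner_Integration.integral_sum[OF this] show ?thesis
      unfolding expand by simp
  qed
  have "(\<lambda>n. \<Sum>g\<in>PiE F K. C g * (\<integral>x. orbit_prod F g n x \<partial>m))
      \<longlonglongrightarrow> (\<Sum>g\<in>PiE F K. C g * (\<Prod>U\<in>F. \<integral>x. g U x \<partial>m))"
  proof (rule tendsto_sum, rule tendsto_mult_left)
    fix g assume g: "g \<in> PiE F K"
    show "(\<lambda>n. \<integral>x. orbit_prod F g n x \<partial>m) \<longlonglongrightarrow> (\<Prod>U\<in>F. \<integral>x. g U x \<partial>m)"
      by (rule integral_characters_tendsto[OF F epi chg[OF g] free])
  qed
  also have "(\<Sum>g\<in>PiE F K. C g * (\<Prod>U\<in>F. \<integral>x. g U x \<partial>m)) = (\<Prod>U\<in>F. \<integral>x. f U x \<partial>m)"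
  proof -
    have "(\<integral>x. f U x \<partial>m) = (\<Sum>\<xi>\<in>K U. c U \<xi> * (\<integral>x. \<xi> x \<partial>m))" if "U \<in> F" for U
    proof -
      have "cont \<xi>" if "\<xi> \<in> K U" for \<xi>
        using K(2)[OF \<open>U \<in> F\<close> that] by (simp add: character_def)
      note cont = this
      have "integrable m (\<lambda>x. c U \<xi> * \<xi> x)" if "\<xi> \<in> K U" for \<xi>
        by (intro continuous_integrable continuous_on_mult continuous_on_const cont that)
      from Bochner_Integration.integral_sum[OF this] show ?thesis
        unfolding K(3)[OF \<open>U \<in> F\<close>] by simp
    qed
    then have "(\<Prod>U\<in>F. \<integral>x. f U x \<partial>m) = (\<Prod>U\<in>F. \<Sum>\<xi>\<in>K U. c U \<xi> * (\<integral>x. \<xi> x \<partial>m))"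
      by (intro prod.cong) auto
    also have "\<dots> = (\<Sum>g\<in>PiE F K. \<Prod>U\<in>F. c U (g U) * (\<integral>x. g U x \<partial>m))"
      using F K(1) by (rule prod_sum_PiE)
    finally show ?thesis by (simp add: C_def prod.distrib)
  qed
  finally show ?thesis unfolding int_eq .
qed

lemma indicator_trig_approx:
  assumes A: "A \<in> sets m" and e: "e > 0"
  shows "\<exists>h. trig (\<lambda>x. complex_of_real (h x)) \<and> (\<forall>x. \<bar>h x\<bar> \<le> 1) \<and> (\<integral>x. \<bar>indicator A x - h x\<bar> \<partial>m) \<le> e"
proof -
  \<comment> \<open>One \<open>d\<close> is spent on the continuous approximation and two on the
    rescaled trigonometric one. Division by \<open>1 + d\<close> restores the bound 1, which the
    later estimates of products require.\<close>
  define d where "d = e / 3"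
  have d: "d > 0" using e by (simp add: d_def)
  obtain g :: "'a \<Rightarrow> real" where g: "cont g" "\<And>x. 0 \<le> g x" "\<And>x. g x \<le> 1"
    "(\<integral>x. \<bar>indicator A x - g x\<bar> \<partial>m) < d"
    by (rule indicator_approx[OF A d]) blast
  obtain t where t: "trig (\<lambda>x. complex_of_real (t x))" "\<And>x. \<bar>g x - t x\<bar> < d"
    by (rule trig_dense[OF g(1) d]) blast
  define h where "h x = t x / (1 + d)" for x
  have t_le: "\<bar>t x\<bar> \<le> 1 + d" for x using t(2)[of x] g(2,3)[of x] by linarith
  have h_le: "\<bar>h x\<bar> \<le> 1" for x using t_le[of x] d by (simp add: h_def abs_divide)
  have h_trig: "trig (\<lambda>x. complex_of_real (h x))"
  proof -
    have eq: "(\<lambda>x. complex_of_real (h x)) = (\<lambda>x. of_real (1 / (1 + d)) * 1 * complex_of_real (t x))"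
      by (simp add: h_def fun_eq_iff)
    show ?thesis unfolding eq by (rule trig_mult[OF trig.monomial[OF character_one] t(1)])
  qed
  have hg: "\<bar>g x - h x\<bar> \<le> 2 * d" for x
  proof -
    have "t x - h x = h x * d" using d by (simp add: h_def field_simps)
    then have "\<bar>t x - h x\<bar> = \<bar>h x\<bar> * d" using d by (simp add: abs_mult)
    also have "\<dots> \<le> 1 * d" using h_le[of x] d by (intro mult_right_mono) auto
    finally show ?thesis using t(2)[of x] by linarith
  qed
  have hc: "cont h" using continuous_on_Re[OF trig_continuous[OF h_trig]] by simp
  have A_int: "integrable m (indicator A :: 'a \<Rightarrow> real)" using A by (rule integrable_indicator_set)
  have "(\<integral>x. \<bar>indicator A x - h x\<bar> \<partial>m) \<le> (\<integral>x. \<bar>indicator A x - g x\<bar> + 2 * d \<partial>m)"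
  proof (rule integral_mono)
    show "integrable m (\<lambda>x. \<bar>indicator A x - h x\<bar>)"
      by (intro integrable_abs Bochner_Integration.integrable_diff A_int continuous_integrable hc)
    show "integrable m (\<lambda>x. \<bar>indicator A x - g x\<bar> + 2 * d)"
      by (intro Bochner_Integration.integrable_add integrable_abs Bochner_Integration.integrable_diff
          A_int continuous_integrable g(1) continuous_on_const)
    show "\<bar>indicator A x - h x\<bar> \<le> \<bar>indicator A x - g x\<bar> + 2 * d" for x
      using hg[of x] by linarith
  qed
  also have "\<dots> = (\<integral>x. \<bar>indicator A x - g x\<bar> \<partial>m) + 2 * d"
  proof -
    have "integrable m (\<lambda>x. \<bar>indicator A x - g x\<bar>)"
      by (intro integrable_abs Bochner_Integration.integrable_diff A_int continuous_integrable g(1))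
    then show ?thesis by simp
  qed
  also have "\<dots> \<le> e" using g(4) by (simp add: d_def)
  finally show ?thesis using h_trig h_le by blast
qed

lemma vimage_funpow_sets: "epimorphism U \<Longrightarrow> A \<in> sets m \<Longrightarrow> (U ^^ n) -` A \<in> sets m"
  using measurable_sets[OF epimorphism_measurable[OF epimorphism_funpow]] by simp

lemma orbit_inter_sets:
  assumes "finite F" "\<And>U. U \<in> F \<Longrightarrow> epimorphism U" "\<And>U. U \<in> F \<Longrightarrow> B U \<in> sets m"
  shows "orbit_inter F B n \<in> sets m"
proof (cases "F = {}")
  case False
  then show ?thesis using assms by (intro sets.finite_INT vimage_funpow_sets)
qed simp

text \<open>For factors bounded by 1 the error of a product is at most the sum of the errors of its
  factors. Since each \<open>U ^^ n\<close> preserves \<open>m\<close>, these mean errors do not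
  depend on \<open>n\<close>.\<close>

lemma measure_multiple_intersection_tendsto:
  assumes F: "finite F" and epi: "\<And>U. U \<in> F \<Longrightarrow> epimorphism U"
    and B: "\<And>U. U \<in> F \<Longrightarrow> B U \<in> sets m"
    and free: "characters_free F"
  shows "(\<lambda>n. measure m (orbit_inter F B n)) \<longlonglongrightarrow> (\<Prod>U\<in>F. measure m (B U))"
proof (rule LIMSEQ_I)
  fix r :: real assume r: "r > 0"
  \<comment> \<open>Three error terms of at most \<open>r / 4\<close> each stay below
    \<open>r\<close>; the summand 1 covers an empty \<open>F\<close>.\<close>
  define e where "e = r / (4 * (real (card F) + 1))"
  have e: "e > 0" using r by (simp add: e_def)
  have ce: "real (card F) * e \<le> r / 4"
    unfolding e_def using r by (simp add: field_simps)
  have "\<forall>U. \<exists>h. U \<in> F \<longrightarrow> trig (\<lambda>x. complex_of_real (h x)) \<and> (\<forall>x. \<bar>h x\<bar> \<le> 1) \<and>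
      (\<integral>x. \<bar>indicator (B U) x - h x\<bar> \<partial>m) \<le> e"
    using indicator_trig_approx[OF B e] by blast
  from choice[OF this] obtain h where "\<forall>U. U \<in> F \<longrightarrow> trig (\<lambda>x. complex_of_real (h U x)) \<and>
      (\<forall>x. \<bar>h U x\<bar> \<le> 1) \<and> (\<integral>x. \<bar>indicator (B U) x - h U x\<bar> \<partial>m) \<le> e" ..
  then have h: "\<And>U. U \<in> F \<Longrightarrow> trig (\<lambda>x. complex_of_real (h U x))" "\<And>U x. U \<in> F \<Longrightarrow> \<bar>h U x\<bar> \<le> 1"
      "\<And>U. U \<in> F \<Longrightarrow> (\<integral>x. \<bar>indicator (B U) x - h U x\<bar> \<partial>m) \<le> e"
    by simp_all
  have hc: "cont (h U)" if "U \<in> F" for U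
    using continuous_on_Re[OF trig_continuous[OF h(1)[OF that]]] by simp
  have B_int: "integrable m (indicator (B U) :: 'a \<Rightarrow> real)" if "U \<in> F" for U using B[OF that] by (rule integrable_indicator_set)
  have diff_int: "integrable m (\<lambda>x. \<bar>indicator (B U) x - h U x\<bar>)" if "U \<in> F" for U
    by (intro integrable_abs Bochner_Integration.integrable_diff B_int continuous_integrable hc that)
  have "(\<lambda>n. \<integral>x. (\<Prod>U\<in>F. complex_of_real (h U ((U ^^ n) x))) \<partial>m)
      \<longlonglongrightarrow> (\<Prod>U\<in>F. \<integral>x. complex_of_real (h U x) \<partial>m)"
    using F epi h(1) free by (rule integral_trig_tendsto)
  then have "(\<lambda>n. complex_of_real (\<integral>x. orbit_prod F h n x \<partial>m))
      \<longlonglongrightarrow> complex_of_real (\<Prod>U\<in>F. \<integral>x. h U x \<partial>m)"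
    unfolding integral_complex_of_real of_real_prod[symmetric] .
  then have lim: "(\<lambda>n. \<integral>x. orbit_prod F h n x \<partial>m) \<longlonglongrightarrow> (\<Prod>U\<in>F. \<integral>x. h U x \<partial>m)"
    by (simp only: tendsto_of_real_iff)
  obtain N where N: "\<And>n. n \<ge> N \<Longrightarrow>
      \<bar>(\<integral>x. orbit_prod F h n x \<partial>m) - (\<Prod>U\<in>F. \<integral>x. h U x \<partial>m)\<bar> < r / 4"
    using LIMSEQ_D[OF lim, of "r / 4"] r by auto
  have lim_close: "\<bar>(\<Prod>U\<in>F. \<integral>x. h U x \<partial>m) - (\<Prod>U\<in>F. measure m (B U))\<bar> \<le> r / 4"
  proof -
    have "norm ((\<Prod>U\<in>F. \<integral>x. h U x \<partial>m) - (\<Prod>U\<in>F. measure m (B U)))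
        \<le> (\<Sum>U\<in>F. norm ((\<integral>x. h U x \<partial>m) - measure m (B U)))"
    proof (rule norm_prod_diff)
      show "norm (\<integral>x. h U x \<partial>m) \<le> 1" if "U \<in> F" for U
        by (rule norm_integral_le[OF continuous_measurable[OF hc[OF that]]]) (use h(2)[OF that] in simp)
      show "norm (measure m (B U)) \<le> 1" if "U \<in> F" for U
        using bounded_measure[of "B U"] by simp
    qed
    also have "\<dots> \<le> (\<Sum>U\<in>F. e)"
    proof (rule sum_mono)
      fix U assume U: "U \<in> F"
      have "(\<integral>x. h U x \<partial>m) - measure m (B U) = - (\<integral>x. indicator (B U) x - h U x \<partial>m)"
        using B[OF U] by (simp add: B_int[OF U] continuous_integrable hc[OF U])
      also have "norm \<dots> \<le> (\<integral>x. norm (indicator (B U) x - h U x) \<partial>m)"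
        unfolding norm_minus_cancel by (rule integral_norm_bound)
      finally show "norm ((\<integral>x. h U x \<partial>m) - measure m (B U)) \<le> e" using h(3)[OF U] by simp
    qed
    finally show ?thesis using ce by simp
  qed
  have close: "\<bar>measure m (orbit_inter F B n) - (\<integral>x. orbit_prod F h n x \<partial>m)\<bar> \<le> r / 4" for n
  proof -
    have mT: "(U ^^ n) \<in> measurable m m" if "U \<in> F" for U
      by (intro epimorphism_measurable epimorphism_funpow epi that)
    have ind_eq: "indicator (orbit_inter F B n) x = (\<Prod>U\<in>F. indicator (B U) ((U ^^ n) x) :: real)" for x
    proof (cases "x \<in> orbit_inter F B n")
      case True
      then show ?thesis by (simp add: indicator_def)
    next
      case False
      then obtain U where "U \<in> F" "(U ^^ n) x \<notin> B U" by auto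
      then have "(\<Prod>U\<in>F. indicator (B U) ((U ^^ n) x) :: real) = 0"
        using F by (intro prod_zero bexI[of _ U]) auto
      then show ?thesis using False by simp
    qed
    have sets: "orbit_inter F B n \<in> sets m" by (rule orbit_inter_sets[OF F epi B])
    define I where "I x = (indicator (orbit_inter F B n) x :: real)" for x
    have I_int: "integrable m I"
      unfolding I_def using sets by (rule integrable_indicator_set)
    have h_cont: "cont (\<lambda>x. h U ((U ^^ n) x))" if "U \<in> F" for U
      using epimorphism_funpow[OF epi[OF that], of n]
      by (intro continuous_UNIV_compose[OF hc[OF that]]) (simp add: epimorphism_def)
    have P_int: "integrable m (\<lambda>x. \<Prod>U\<in>F. h U ((U ^^ n) x))"
      by (intro continuous_integrable continuous_on_prod h_cont)
    have term_int: "integrable m (\<lambda>x. \<bar>indicator (B U) ((U ^^ n) x) - h U ((U ^^ n) x)\<bar>)" if "U \<in> F" for U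
      using diff_int[OF that] mT[OF that] epimorphism_funpow[OF epi[OF that], of n]
      by (subst (asm) distr_epimorphism[symmetric, of "U ^^ n"]) (auto dest: integrable_distr)
    have "measure m (orbit_inter F B n) - (\<integral>x. orbit_prod F h n x \<partial>m)
        = (\<integral>x. I x - orbit_prod F h n x \<partial>m)"
    proof -
      have "(\<integral>x. I x \<partial>m) = measure m (orbit_inter F B n)"
        unfolding I_def using sets by simp
      then show ?thesis using Bochner_Integration.integral_diff[OF I_int P_int] by simp
    qed
    also have "norm \<dots> \<le> (\<integral>x. norm (I x - orbit_prod F h n x) \<partial>m)"
      by (rule integral_norm_bound)
    also have "\<dots> \<le> (\<integral>x. (\<Sum>U\<in>F. \<bar>indicator (B U) ((U ^^ n) x) - h U ((U ^^ n) x)\<bar>) \<partial>m)"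
    proof (rule integral_mono)
      show "integrable m (\<lambda>x. norm (I x - orbit_prod F h n x))"
        using I_int P_int by (intro integrable_norm Bochner_Integration.integrable_diff)
      show "integrable m (\<lambda>x. \<Sum>U\<in>F. \<bar>indicator (B U) ((U ^^ n) x) - h U ((U ^^ n) x)\<bar>)"
        using term_int by (intro Bochner_Integration.integrable_sum)
      show "norm (I x - orbit_prod F h n x)
          \<le> (\<Sum>U\<in>F. \<bar>indicator (B U) ((U ^^ n) x) - h U ((U ^^ n) x)\<bar>)" for x
        unfolding I_def ind_eq real_norm_def[symmetric]
      proof (rule norm_prod_diff)
        show "norm (indicator (B U) ((U ^^ n) x) :: real) \<le> 1" for U by (simp add: indicator_def)
        show "norm (h U ((U ^^ n) x)) \<le> 1" if "U \<in> F" for U using h(2)[OF that] by simp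
      qed
    qed
    also have "\<dots> = (\<Sum>U\<in>F. \<integral>x. \<bar>indicator (B U) ((U ^^ n) x) - h U ((U ^^ n) x)\<bar> \<partial>m)"
      using term_int by (rule Bochner_Integration.integral_sum)
    also have "\<dots> = (\<Sum>U\<in>F. \<integral>x. \<bar>indicator (B U) x - h U x\<bar> \<partial>m)"
      using diff_int
      by (intro sum.cong refl integral_measurable_epimorphism[where f = "\<lambda>x. \<bar>indicator (B _) x - h _ x\<bar>"]
          epimorphism_funpow epi borel_measurable_integrable)
    also have "\<dots> \<le> (\<Sum>U\<in>F. e)" by (intro sum_mono h(3))
    finally show ?thesis using ce by simp
  qed
  have "norm (measure m (orbit_inter F B n) - (\<Prod>U\<in>F. measure m (B U))) < r" if "n \<ge> N" for n
    using N[OF that] close[of n] lim_close r unfolding real_norm_def by linarith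
  then show "\<exists>N. \<forall>n\<ge>N. norm (measure m (orbit_inter F B n) - (\<Prod>U\<in>F. measure m (B U))) < r"
    by blast
qed

text \<open>Sets of the completion are replaced by Borel sets up to null sets. Preimages of null
  sets under \<open>U ^^ n\<close> are null, so every intersection changes by a null set
  only.\<close>

lemma mixing_set_if_characters_free:
  assumes F: "finite F" and epi: "\<And>U. U \<in> F \<Longrightarrow> epimorphism U"
    and free: "characters_free F"
  shows "mixing_set (completion m) F"
  unfolding mixing_set_def
proof (intro conjI F allI impI)
  fix B assume B: "\<forall>U\<in>F. B U \<in> sets (completion m)"
  have "\<forall>U. \<exists>C N. U \<in> F \<longrightarrow> C \<in> sets m \<and> N \<in> null_sets m \<and> (B U - C) \<union> (C - B U) \<subseteq> N"
  proof
    fix U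
    show "\<exists>C N. U \<in> F \<longrightarrow> C \<in> sets m \<and> N \<in> null_sets m \<and> (B U - C) \<union> (C - B U) \<subseteq> N"
    proof (cases "U \<in> F")
      case True
      from sets_completion_approx[OF bspec[OF B True]] obtain C N
        where "C \<in> sets m \<and> N \<in> null_sets m \<and> (B U - C) \<union> (C - B U) \<subseteq> N" by (elim exE)
      then show ?thesis by (intro exI impI)
    qed simp
  qed
  from choice[OF this] obtain C where
    "\<forall>U. \<exists>N. U \<in> F \<longrightarrow> C U \<in> sets m \<and> N \<in> null_sets m \<and> (B U - C U) \<union> (C U - B U) \<subseteq> N" ..
  from choice[OF this] obtain N where
    "\<forall>U. U \<in> F \<longrightarrow> C U \<in> sets m \<and> N U \<in> null_sets m \<and> (B U - C U) \<union> (C U - B U) \<subseteq> N U" ..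
  then have C: "\<And>U. U \<in> F \<Longrightarrow> C U \<in> sets m" "\<And>U. U \<in> F \<Longrightarrow> N U \<in> null_sets m"
      "\<And>U. U \<in> F \<Longrightarrow> (B U - C U) \<union> (C U - B U) \<subseteq> N U"
    by simp_all
  have "measure (completion m) (B U) = measure m (C U)" if "U \<in> F" for U
    using C that by (intro measure_completion_eq)
  then have prod_eq: "(\<Prod>U\<in>F. measure (completion m) (B U)) = (\<Prod>U\<in>F. measure m (C U))"
    by (intro prod.cong) auto
  have inter_eq: "measure (completion m) (orbit_inter F B n) = measure m (orbit_inter F C n)" for n
  proof (rule measure_completion_eq)
    show "orbit_inter F C n \<in> sets m" by (rule orbit_inter_sets[OF F epi C(1)])
    have "(U ^^ n) -` N U \<in> null_sets m" if "U \<in> F" for U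
    proof -
      have "N U \<in> sets m" "measure m (N U) = 0"
        using C(2)[OF that] by (auto simp: null_sets_def measure_def)
      then have "measure m ((U ^^ n) -` N U) = 0"
        using measure_vimage_epimorphism[OF epimorphism_funpow[OF epi[OF that]]] by simp
      then show ?thesis
        using vimage_funpow_sets[OF epi[OF that] \<open>N U \<in> sets m\<close>] by (simp add: null_sets_def emeasure_eq_measure)
    qed
    then show "(\<Union>U\<in>F. (U ^^ n) -` N U) \<in> null_sets m"
      using F by (intro null_sets_UN' countable_finite)
    show "orbit_inter F B n - orbit_inter F C n \<union>
        (orbit_inter F C n - orbit_inter F B n) \<subseteq> (\<Union>U\<in>F. (U ^^ n) -` N U)"
      using C(3) by blast
  qed
  show "(\<lambda>n. measure (completion m) (orbit_inter F B n))
      \<longlonglongrightarrow> (\<Prod>U\<in>F. measure (completion m) (B U))"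
    unfolding prod_eq inter_eq
    using F epi C(1) free by (rule measure_multiple_intersection_tendsto)
qed


section \<open>Freeness of characters from mixing\<close>

lemma character_torsion_free:
  fixes \<xi> :: "'a \<Rightarrow> complex"
  assumes conn: "connected (UNIV :: 'a set)" and ch: "character \<xi>"
    and N: "N > 0" "\<And>x. \<xi> x ^ N = 1"
  shows "\<xi> x = 1"
proof -
  \<comment> \<open>A connected set of roots of unity of one fixed order is a single point.\<close>
  have "connected (range \<xi>)"
    using ch conn by (intro connected_continuous_image) (auto simp: character_def)
  moreover have "finite (range \<xi>)"
    using N by (intro finite_subset[OF _ finite_roots_unity[of N]]) auto
  ultimately obtain z where "range \<xi> = {z}"
    using connected_finite_iff_sing[of "range \<xi>"] by auto
  then have "\<xi> x = \<xi> 0" by (metis rangeI singletonD)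
  then show ?thesis using character_0[OF ch] by simp
qed

text \<open>By connectedness no power of \<open>\<xi>\<close> with nonzero exponent is trivial, so
  \<open>\<xi>\<close> alone is an independent family and maps onto the circle.\<close>

lemma nontrivial_character_minus_one:
  fixes \<xi> :: "'a \<Rightarrow> complex"
  assumes conn: "connected (UNIV :: 'a set)" and ch: "character \<xi>" and nt: "\<xi> b \<noteq> 1"
  shows "\<exists>a. \<xi> a = -1"
proof -
  have "char_indep 1 (\<lambda>_. \<xi>)"
    unfolding char_indep_def
  proof (intro ballI impI)
    fix v assume v: "v \<in> zvec 1" and one: "\<forall>x. char_comb 1 (\<lambda>_. \<xi>) v x = 1"
    have pw: "\<xi> x powi v 0 = 1" for x using one by (simp add: char_comb_def)
    have "\<xi> x ^ nat \<bar>v 0\<bar> = 1" for x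
    proof (cases "v 0 \<ge> 0")
      case True
      then show ?thesis using pw[of x] by (simp add: power_int_def)
    next
      case False
      then show ?thesis using pw[of x] by (simp add: power_int_def power_inverse)
    qed
    then have "\<not> nat \<bar>v 0\<bar> > 0" using character_torsion_free[OF conn ch] nt by blast
    then show "v = (\<lambda>_. 0)" using v by (auto simp: zvec_def fun_eq_iff) (metis Suc_leI neq0_conv)
  qed
  then have "\<exists>x. \<forall>j<1::nat. \<xi> x = -1"
    by (intro independent_characters_surjective[of 1 "\<lambda>_. \<xi>" "\<lambda>_. -1"] ch) auto
  then show ?thesis by auto
qed

text \<open>The set where \<open>Re (\<xi> x) > 0\<close> is invariant under \<open>T ^^ b\<close>,
  so mixing along the multiples of \<open>b\<close> makes its measure equal to its square. The set
  is open and nonempty, so the measure is 1; but translation by a point of value \<open>-1\<close>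
  produces a disjoint copy.\<close>

lemma mixing_character_not_periodic:
  fixes \<xi> :: "'a \<Rightarrow> complex"
  assumes conn: "connected (UNIV :: 'a set)" and mix: "mixing (completion m) T" and ch: "character \<xi>"
    and b: "b > 0" and inv: "\<And>x. \<xi> ((T ^^ b) x) = \<xi> x"
  shows "\<xi> x = 1"
proof (rule ccontr)
  assume "\<xi> x \<noteq> 1"
  then obtain a where a: "\<xi> a = -1" using nontrivial_character_minus_one[OF conn ch] by blast
  have cont: "cont \<xi>" using ch by (simp add: character_def)
  define A where "A = {x. Re (\<xi> x) > 0}"
  have A_open: "open A" unfolding A_def by (intro open_Collect_less continuous_intros cont)
  then have A_sets: "A \<in> sets m" by simp
  have inv_n: "\<xi> (((T ^^ b) ^^ n) x) = \<xi> x" for n x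
    by (induction n) (simp_all add: inv)
  have "(T ^^ (b * n)) -` A = A" for n
    using inv_n[of n] by (auto simp: A_def funpow_mult)
  then have const: "measure (completion m) (A \<inter> (T ^^ (b * n)) -` A) = measure m A" for n
    using A_sets by simp
  have "(\<lambda>n. measure (completion m) (A \<inter> (T ^^ n) -` A)) \<longlonglongrightarrow> measure m A * measure m A"
    using mix A_sets unfolding mixing_def by (auto dest!: bspec[of _ _ A])
  from LIMSEQ_subseq_LIMSEQ[OF this, of "\<lambda>n. b * n"]
  have "(\<lambda>n. measure m A) \<longlonglongrightarrow> measure m A * measure m A"
    using b by (simp add: comp_def const strict_mono_def)
  then have "measure m A = measure m A * measure m A" by (simp add: LIMSEQ_const_iff)
  moreover have "measure m A \<noteq> 0"
  proof
    assume "measure m A = 0"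
    then have "A = {}" by (rule open_null_empty[OF A_open])
    moreover have "0 \<in> A" using character_0[OF ch] by (simp add: A_def)
    ultimately show False by simp
  qed
  ultimately have one: "measure m A = 1" by simp
  have tA: "(\<lambda>x. a + x) ` A \<in> sets m"
  proof -
    have "(\<lambda>x. a + x) ` A = (\<lambda>x. - a + x) -` A" by (force simp: image_iff)
    then show ?thesis using A_open by (simp add: open_vimage continuous_intros)
  qed
  have "measure m ((\<lambda>x. a + x) ` A) = 1"
    using emeasure_translation[OF A_sets, of a] one by (simp add: measure_def)
  moreover have "A \<inter> (\<lambda>x. a + x) ` A = {}"
    by (auto simp: A_def character_add[OF ch] a)
  ultimately have "measure m (A \<union> (\<lambda>x. a + x) ` A) = 2"
    using finite_measure_Union[OF A_sets tA] one by simp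
  moreover have "measure m (A \<union> (\<lambda>x. a + x) ` A) \<le> 1"
    using bounded_measure[of "A \<union> (\<lambda>x. a + x) ` A"] by simp
  ultimately show False by simp
qed

text \<open>Mixing is tested on open sets where the characters are close to prescribed values with
  product \<open>-1\<close>. Whenever the orbit product is identically 1 the intersection is empty,
  although its measure tends to a positive number.\<close>

lemma mixing_set_characters_free:
  assumes conn: "connected (UNIV :: 'a set)" and mix: "mixing_set (completion m) F"
  shows "characters_free F"
  unfolding characters_free_def
proof (intro allI impI, rule ccontr)
  fix \<xi> :: "('a \<Rightarrow> 'a) \<Rightarrow> 'a \<Rightarrow> complex"
  assume "\<forall>U\<in>F. character (\<xi> U)" and inf: "infinite {n. \<forall>x. orbit_prod F \<xi> n x = 1}"
    and nt: "\<not> (\<forall>U\<in>F. \<forall>x. \<xi> U x = 1)"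
  then have ch: "character (\<xi> U)" if "U \<in> F" for U using that by blast
  from nt obtain \<delta> b where \<delta>: "\<delta> \<in> F" "\<xi> \<delta> b \<noteq> 1" by blast
  then obtain a where a: "\<xi> \<delta> a = -1" using nontrivial_character_minus_one[OF conn ch] by blast
  have F: "finite F" using mix by (simp add: mixing_set_def)
  define w :: "('a \<Rightarrow> 'a) \<Rightarrow> complex" where "w U = (if U = \<delta> then -1 else 1)" for U
  \<comment> \<open>With \<open>card F * e < 1\<close> the product of the characters stays within
    distance 1 of \<open>-1\<close>, hence away from 1.\<close>
  define e where "e = 1 / (real (card F) + 1)"
  have e: "e > 0" "real (card F) * e < 1" by (auto simp: e_def field_simps)
  define B where "B U = {x. norm (\<xi> U x - w U) < e}" for U
  have B_open: "open (B U)" if "U \<in> F" for U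
  proof -
    have "cont (\<xi> U)" using ch[OF that] by (simp add: character_def)
    then show ?thesis unfolding B_def by (intro open_Collect_less continuous_intros)
  qed
  have B_pos: "measure m (B U) > 0" if U: "U \<in> F" for U
  proof -
    have "(if U = \<delta> then a else 0) \<in> B U"
      using a e(1) character_0[OF ch[OF U]] by (auto simp: B_def w_def)
    then have "B U \<noteq> {}" by blast
    then have "measure m (B U) \<noteq> 0" using open_null_empty[OF B_open[OF U]] by blast
    then show ?thesis by (simp add: zero_less_measure_iff)
  qed
  have empty: "orbit_inter F B n = {}"
    if n: "\<forall>x. orbit_prod F \<xi> n x = 1" for n
  proof (rule ccontr)
    assume "orbit_inter F B n \<noteq> {}"
    then obtain x where x: "\<And>U. U \<in> F \<Longrightarrow> norm (\<xi> U ((U ^^ n) x) - w U) < e"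
      unfolding B_def by blast
    have "norm (orbit_prod F \<xi> n x - (\<Prod>U\<in>F. w U)) \<le> (\<Sum>U\<in>F. norm (\<xi> U ((U ^^ n) x) - w U))"
    proof (rule norm_prod_diff)
      show "norm (\<xi> U ((U ^^ n) x)) \<le> 1" if "U \<in> F" for U
        using ch[OF that] by (simp add: character_def)
      show "norm (w U) \<le> 1" for U by (simp add: w_def)
    qed
    also have "\<dots> \<le> (\<Sum>U\<in>F. e)" using x by (intro sum_mono less_imp_le)
    also have "\<dots> < 1" using e(2) by simp
    finally have "norm (1 - (\<Prod>U\<in>F. w U)) < 1" using n by simp
    moreover have "(\<Prod>U\<in>F. w U) = -1"
      unfolding w_def using F \<delta>(1) by simp
    ultimately show False by simp
  qed
  have lim: "(\<lambda>n. measure (completion m) (orbit_inter F B n)) \<longlonglongrightarrow> (\<Prod>U\<in>F. measure (completion m) (B U))"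
  proof -
    have "\<forall>U\<in>F. B U \<in> sets (completion m)" using B_open by auto
    then show ?thesis using mix unfolding mixing_set_def by blast
  qed
  have "(\<Prod>U\<in>F. measure (completion m) (B U)) > 0"
  proof (rule prod_pos)
    fix U assume U: "U \<in> F"
    then show "measure (completion m) (B U) > 0" using B_pos[OF U] B_open[OF U] by simp
  qed
  with lim have "\<forall>\<^sub>F n in sequentially. measure (completion m) (orbit_inter F B n) > 0"
    by (rule order_tendstoD)
  then obtain N where N: "\<And>n. n \<ge> N \<Longrightarrow> measure (completion m) (orbit_inter F B n) > 0"
    unfolding eventually_sequentially by blast
  obtain n where n: "n \<ge> N" "\<forall>x. orbit_prod F \<xi> n x = 1"
    using inf unfolding infinite_nat_iff_unbounded_le by blast
  show False using N[OF n(1)] unfolding empty[OF n(2)] by simp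
qed

end


section \<open>The dual group has finite rank\<close>

lemma char_comb_add:
  assumes "\<And>j. j < n \<Longrightarrow> \<eta> j x \<noteq> 0"
  shows "char_comb n \<eta> (\<lambda>k. v k + w k) x = char_comb n \<eta> v x * char_comb n \<eta> w x"
  unfolding char_comb_def prod.distrib[symmetric]
  using assms by (intro prod.cong refl) (simp add: power_int_add)

lemma char_comb_scale:
  "char_comb n \<eta> (\<lambda>k. c * v k) x = char_comb n \<eta> v x powi c"
  unfolding char_comb_def
  by (induction n) (simp_all add: power_int_mult_distrib power_int_mult[symmetric] mult.commute)

lemma char_comb_zero: "char_comb n \<eta> (\<lambda>k. 0) x = 1"
  by (simp add: char_comb_def)

lemma char_comb_sum:
  assumes "\<And>j. j < n \<Longrightarrow> \<eta> j x \<noteq> 0"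
  shows "char_comb n \<eta> (\<lambda>k. \<Sum>i\<in>I. u i k) x = (\<Prod>i\<in>I. char_comb n \<eta> (u i) x)"
  by (induction I rule: infinite_finite_induct) (simp_all add: char_comb_zero char_comb_add assms)

lemma char_comb_eqD:
  assumes ch: "\<And>j. j < n \<Longrightarrow> character (\<eta> j)" and ind: "char_indep n \<eta>"
    and vw: "v \<in> zvec n" "w \<in> zvec n" and eq: "\<And>x. char_comb n \<eta> v x = char_comb n \<eta> w x"
  shows "v = w"
proof -
  have nz: "\<eta> j x \<noteq> 0" if "j < n" for j x using character_nonzero[OF ch[OF that]] .
  have w_nz: "char_comb n \<eta> w x \<noteq> 0" for x using nz by (simp add: char_comb_def)
  have "(\<lambda>k. v k + (-1) * w k) \<in> zvec n" using vw by (simp add: zvec_def)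
  moreover have "char_comb n \<eta> (\<lambda>k. v k + (-1) * w k) x = 1" for x
  proof -
    have "char_comb n \<eta> (\<lambda>k. v k + (-1) * w k) x
        = char_comb n \<eta> v x * char_comb n \<eta> (\<lambda>k. (-1) * w k) x"
      by (rule char_comb_add) (rule nz)
    also have "\<dots> = char_comb n \<eta> w x * char_comb n \<eta> w x powi (-1)"
      unfolding char_comb_scale eq ..
    also have "\<dots> = 1" using w_nz by (simp add: power_int_minus)
    finally show ?thesis .
  qed
  ultimately have "(\<lambda>k. v k + (-1) * w k) = (\<lambda>_. 0)" using ind unfolding char_indep_def by blast
  then have "v k = w k" for k using fun_cong[of _ _ k] by fastforce
  then show ?thesis by blast
qed

text \<open>The row vector \<open>v\<close> times the matrix with rows \<open>A j\<close>.\<close>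

definition zact :: "nat \<Rightarrow> (nat \<Rightarrow> nat \<Rightarrow> int) \<Rightarrow> (nat \<Rightarrow> int) \<Rightarrow> nat \<Rightarrow> int" where
  "zact n A v k = (\<Sum>j<n. v j * A j k)"

lemma zlinear_zact: "(\<And>j. j < n \<Longrightarrow> A j \<in> zvec n) \<Longrightarrow> zlinear n (zact n A)"
  by (auto simp: zlinear_def zact_def zvec_def fun_eq_iff distrib_right sum.distrib sum_distrib_left mult.assoc)

lemma powi_power_commute: "(a ^ q) powi c = (a powi c) ^ q" for a :: "'a::field"
  by (metis mult.commute power_int_mult power_int_of_nat)

text \<open>Keeping the points \<open>x\<close> and \<open>y\<close> separate lets one statement
  serve both an epimorphism and its rational inverse; the denominator \<open>q\<close> of the matrix
  appears as an exponent.\<close>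

lemma char_comb_zact:
  assumes nz: "\<And>j. j < n \<Longrightarrow> \<eta> j x \<noteq> 0"
    and A: "\<And>j. j < n \<Longrightarrow> \<zeta> j y ^ q = char_comb n \<eta> (A j) x"
  shows "char_comb n \<eta> (zact n A v) x = char_comb n \<zeta> v y ^ q"
proof -
  have "char_comb n \<eta> (zact n A v) x = (\<Prod>j<n. char_comb n \<eta> (\<lambda>k. v j * A j k) x)"
    unfolding zact_def[abs_def] by (rule char_comb_sum) (rule nz)
  also have "\<dots> = (\<Prod>j<n. (\<zeta> j y powi v j) ^ q)"
    by (intro prod.cong refl) (simp add: char_comb_scale A[symmetric] powi_power_commute)
  also have "\<dots> = char_comb n \<zeta> v y ^ q"
    by (simp add: char_comb_def prod_power_distrib)
  finally show ?thesis .
qed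

text \<open>Independence of \<open>\<eta>\<close> forces a nonzero exponent of \<open>\<psi>\<close>
  in a nontrivial relation, which can then be solved for a power of \<open>\<psi>\<close>.\<close>

lemma dependent_character_power:
  fixes \<psi> :: "'a::topological_ab_group_add \<Rightarrow> complex"
  assumes ch: "\<And>j. j < n \<Longrightarrow> character (\<eta> j)" and ind: "char_indep n \<eta>" and \<psi>: "character \<psi>"
    and dep: "\<not> char_indep (Suc n) (\<lambda>j. if j < n then \<eta> j else \<psi>)"
  shows "\<exists>N>0. \<exists>v\<in>zvec n. \<forall>x. \<psi> x ^ N = char_comb n \<eta> v x"
proof -
  obtain v where v: "v \<in> zvec (Suc n)" "v \<noteq> (\<lambda>_. 0)"
      "\<And>x. char_comb (Suc n) (\<lambda>j. if j < n then \<eta> j else \<psi>) v x = 1"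
    using dep unfolding char_indep_def by blast
  have split: "char_comb n \<eta> v x * \<psi> x powi v n = 1" for x
    using v(3)[of x] by (simp add: char_comb_def)
  have vn: "v n \<noteq> 0"
  proof
    assume 0: "v n = 0"
    have "v k = 0" if "k \<ge> n" for k
      using v(1) 0 that by (cases "k = n") (auto simp: zvec_def)
    then have "v \<in> zvec n" by (simp add: zvec_def)
    moreover have "char_comb n \<eta> v x = 1" for x using split[of x] 0 by simp
    ultimately show False using ind v(2) unfolding char_indep_def by blast
  qed
  \<comment> \<open>The sign turns the exponent \<open>- v n\<close> into the natural number
    \<open>\<bar>v n\<bar>\<close>.\<close>
  define s where "s = - sgn (v n)"
  define w where "w k = (if k < n then s * v k else 0)" for k
  have "\<psi> x ^ nat \<bar>v n\<bar> = char_comb n \<eta> w x" for x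
  proof -
    have nz: "\<psi> x \<noteq> 0" by (rule character_nonzero[OF \<psi>])
    have "char_comb n \<eta> w x = char_comb n \<eta> (\<lambda>k. s * v k) x"
      unfolding char_comb_def by (intro prod.cong) (auto simp: w_def)
    also have "\<dots> = char_comb n \<eta> v x powi s" by (rule char_comb_scale)
    also have "char_comb n \<eta> v x = \<psi> x powi (- v n)"
      using split[of x] nz by (simp add: power_int_minus field_simps)
    also have "(\<psi> x powi (- v n)) powi s = \<psi> x powi (- v n * s)" by (rule power_int_mult[symmetric])
    also have "- v n * s = int (nat \<bar>v n\<bar>)" by (simp add: s_def sgn_if)
    finally show ?thesis by (simp only: power_int_of_nat)
  qed
  moreover have "w \<in> zvec n" by (simp add: w_def zvec_def)
  ultimately show ?thesis using vn by (intro exI[of _ "nat \<bar>v n\<bar>"]) auto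
qed

text \<open>A common denominator for finitely many rational vectors: the product of the separate
  ones.\<close>

lemma common_exponent:
  assumes I: "finite I"
    and ex: "\<And>i. i \<in> I \<Longrightarrow> \<exists>N>0. \<exists>v\<in>zvec n. \<forall>x. \<psi> i x ^ N = char_comb n (\<eta> i) v x"
  shows "\<exists>N>0. \<exists>v. \<forall>i\<in>I. v i \<in> zvec n \<and> (\<forall>x. \<psi> i x ^ N = char_comb n (\<eta> i) (v i) x)"
proof -
  have "\<forall>i. \<exists>N v. i \<in> I \<longrightarrow> N > 0 \<and> v \<in> zvec n \<and> (\<forall>x. \<psi> i x ^ N = char_comb n (\<eta> i) v x)"
    using ex by blast
  from choice[OF this] obtain N where
    "\<forall>i. \<exists>v. i \<in> I \<longrightarrow> N i > 0 \<and> v \<in> zvec n \<and> (\<forall>x. \<psi> i x ^ N i = char_comb n (\<eta> i) v x)" ..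
  from choice[OF this] obtain v where
    "\<forall>i. i \<in> I \<longrightarrow> N i > 0 \<and> v i \<in> zvec n \<and> (\<forall>x. \<psi> i x ^ N i = char_comb n (\<eta> i) (v i) x)" ..
  then have Nv: "\<And>i. i \<in> I \<Longrightarrow> N i > 0" "\<And>i. i \<in> I \<Longrightarrow> v i \<in> zvec n"
      "\<And>i x. i \<in> I \<Longrightarrow> \<psi> i x ^ N i = char_comb n (\<eta> i) (v i) x"
    by simp_all
  define M where "M = (\<Prod>i\<in>I. N i)"
  have "M > 0" using Nv(1) by (auto simp: M_def intro: prod_pos)
  moreover have "\<psi> i x ^ M = char_comb n (\<eta> i) (\<lambda>k. int (M div N i) * v i k) x" if i: "i \<in> I" for i x
  proof -
    have "N i dvd M" unfolding M_def using I i by (rule dvd_prodI)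
    then have "M = N i * (M div N i)" by simp
    then have "\<psi> i x ^ M = (\<psi> i x ^ N i) ^ (M div N i)" by (metis power_mult)
    then show ?thesis by (simp add: Nv(3)[OF i] char_comb_scale)
  qed
  moreover have "(\<lambda>k. int (M div N i) * v i k) \<in> zvec n" if "i \<in> I" for i
    using Nv(2)[OF that] by (simp add: zvec_def)
  ultimately show ?thesis
    by (intro exI[of _ M] conjI exI[of _ "\<lambda>i k. int (M div N i) * v i k"]) auto
qed

section \<open>Relations along an arithmetic progression\<close>

context haar_group
begin

lemma characters_free_insert_id:
  assumes conn: "connected (UNIV :: 'a set)" and dim: "finite_covering_dim (euclidean :: 'a topology)"
    and F: "finite F" "id \<notin> F" and epi: "\<And>U. U \<in> F \<Longrightarrow> epimorphism U"
    and mix: "\<And>U. U \<in> F \<Longrightarrow> mixing (completion m) U"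
    and mixF: "mixing_set (completion m) F"
  shows "characters_free (insert id F)"
  unfolding characters_free_def
proof (intro allI impI)
  fix \<xi> :: "('a \<Rightarrow> 'a) \<Rightarrow> 'a \<Rightarrow> complex"
  assume ch: "\<forall>U\<in>insert id F. character (\<xi> U)"
    and inf: "infinite {t. \<forall>x. orbit_prod (insert id F) \<xi> t x = 1}"
  define I where "I = insert id F"
  have I: "finite I" using F by (simp add: I_def)
  have epiI: "epimorphism U" if "U \<in> I" for U
    using that epi epimorphism_id by (auto simp: I_def)
  have chI: "character (\<xi> U)" if "U \<in> I" for U using bspec[OF ch] that by (simp only: I_def)
  obtain d where d: "covering_dim_le (euclidean :: 'a topology) d"
    using dim unfolding finite_covering_dim_def by blast
  \<comment> \<open>\<open>P n\<close> says that the dual group has rank at least \<open>n\<close>;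
    the covering dimension bounds such \<open>n\<close>, so a largest one exists.\<close>
  define P where "P n \<longleftrightarrow> (\<exists>\<eta> :: nat \<Rightarrow> 'a \<Rightarrow> complex. (\<forall>j<n. character (\<eta> j)) \<and> char_indep n \<eta>)" for n
  have P_le: "n \<le> d" if Pn: "P n" for n
  proof -
    obtain \<eta> :: "nat \<Rightarrow> 'a \<Rightarrow> complex" where "\<forall>j<n. character (\<eta> j)" "char_indep n \<eta>"
      using Pn unfolding P_def by blast
    then show ?thesis by (intro covering_dim_ge_independent[OF _ _ d]) simp_all
  qed
  have "P 0" by (auto simp: P_def char_indep_def zvec_def)
  define n where "n = Greatest P"
  have Pn: "P n" unfolding n_def using \<open>P 0\<close> P_le by (rule GreatestI_nat)
  have nP: "\<not> P (Suc n)"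
  proof
    assume "P (Suc n)"
    then have "Suc n \<le> n" unfolding n_def using P_le by (rule Greatest_le_nat)
    then show False by simp
  qed
  obtain \<eta> :: "nat \<Rightarrow> 'a \<Rightarrow> complex" where \<eta>: "\<And>j. j < n \<Longrightarrow> character (\<eta> j)" and ind: "char_indep n \<eta>"
    using Pn unfolding P_def by blast
  have nz: "\<eta> j x \<noteq> 0" if "j < n" for j x using character_nonzero[OF \<eta>[OF that]] .
  \<comment> \<open>By maximality of \<open>n\<close>, any \<open>n\<close> independent characters
    span in the sense of powers. This is needed for \<open>\<eta>\<close> and also for its pullback
    under each \<open>U\<close>.\<close>
  have dep: "\<exists>N>0. \<exists>v\<in>zvec n. \<forall>x. \<psi> x ^ N = char_comb n \<zeta> v x"
    if \<zeta>: "\<And>j. j < n \<Longrightarrow> character (\<zeta> j)" "char_indep n \<zeta>" and \<psi>: "character \<psi>"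
    for \<zeta> :: "nat \<Rightarrow> 'a \<Rightarrow> complex" and \<psi>
  proof (rule dependent_character_power[OF \<zeta>(1) \<zeta>(2) \<psi>])
    have chars: "\<forall>j<Suc n. character (if j < n then \<zeta> j else \<psi>)" using \<zeta>(1) \<psi> by simp
    show "\<not> char_indep (Suc n) (\<lambda>j. if j < n then \<zeta> j else \<psi>)"
    proof
      assume "char_indep (Suc n) (\<lambda>j. if j < n then \<zeta> j else \<psi>)"
      with chars have "P (Suc n)"
        unfolding P_def by (intro exI[of _ "\<lambda>j. if j < n then \<zeta> j else \<psi>"] conjI)
      with nP show False by (rule notE)
    qed
  qed
  have surj: "\<exists>x. y = U x" if "U \<in> I" for U y
    by (rule surjD) (use epiI[OF that] in \<open>simp add: epimorphism_def\<close>)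
  have \<eta>U: "character (\<lambda>x. \<eta> j (U x))" if "U \<in> I" "j < n" for U j
    by (rule character_epimorphism[OF \<eta>[OF that(2)] epiI[OF that(1)]])
  have indU: "char_indep n (\<lambda>j x. \<eta> j (U x))" if U: "U \<in> I" for U
    unfolding char_indep_def
  proof (intro ballI impI)
    fix v assume v: "v \<in> zvec n" and one: "\<forall>x. char_comb n (\<lambda>j x. \<eta> j (U x)) v x = 1"
    have "char_comb n \<eta> v y = 1" for y
    proof -
      obtain x where "y = U x" using surj[OF U] by blast
      then show ?thesis using one by (simp add: char_comb_def)
    qed
    then show "v = (\<lambda>_. 0)" using ind v unfolding char_indep_def by blast
  qed
  have "\<exists>N>0. \<exists>v. \<forall>i\<in>I \<times> {..<n}. v i \<in> zvec n \<and> (\<forall>x. \<eta> (snd i) (fst i x) ^ N = char_comb n \<eta> (v i) x)"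
  proof (rule common_exponent)
    fix i assume "i \<in> I \<times> {..<n}"
    then have "fst i \<in> I" "snd i < n" by auto
    then have "character (\<lambda>x. \<eta> (snd i) (fst i x))" by (rule \<eta>U)
    then show "\<exists>N>0. \<exists>v\<in>zvec n. \<forall>x. \<eta> (snd i) (fst i x) ^ N = char_comb n \<eta> v x"
      by (intro dep[OF \<eta> ind])
  qed (use I in simp)
  then obtain q A0 where q: "q > 0" and A0: "\<forall>i\<in>I \<times> {..<n}. A0 i \<in> zvec n \<and>
      (\<forall>x. \<eta> (snd i) (fst i x) ^ q = char_comb n \<eta> (A0 i) x)"
    by (elim exE conjE)
  define A where "A U j = A0 (U, j)" for U j
  have A: "A U j \<in> zvec n" "\<eta> j (U x) ^ q = char_comb n \<eta> (A U j) x" if "U \<in> I" "j < n" for U j x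
    using bspec[OF A0, of "(U, j)"] that by (simp_all add: A_def)
  have "\<exists>N>0. \<exists>v. \<forall>i\<in>I \<times> {..<n}. v i \<in> zvec n \<and>
      (\<forall>x. \<eta> (snd i) x ^ N = char_comb n (\<lambda>j x. \<eta> j (fst i x)) (v i) x)"
  proof (rule common_exponent)
    fix i assume i: "i \<in> I \<times> {..<n}"
    then have i': "fst i \<in> I" "snd i < n" by auto
    show "\<exists>N>0. \<exists>v\<in>zvec n. \<forall>x. \<eta> (snd i) x ^ N = char_comb n (\<lambda>j x. \<eta> j (fst i x)) v x"
      by (rule dep[OF \<eta>U[OF i'(1)] indU[OF i'(1)] \<eta>[OF i'(2)]])
  qed (use I in simp)
  then obtain r G0 where r: "r > 0" and G0: "\<forall>i\<in>I \<times> {..<n}. G0 i \<in> zvec n \<and>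
      (\<forall>x. \<eta> (snd i) x ^ r = char_comb n (\<lambda>j x. \<eta> j (fst i x)) (G0 i) x)"
    by (elim exE conjE)
  \<comment> \<open>\<open>G U\<close> is \<open>r\<close> times the rational inverse of the matrix
    of \<open>U\<close>. It exists because pullback under a surjection keeps independence, so that
    \<open>\<eta>\<close> is expressed through its own pullbacks.\<close>
  define G where "G U j = G0 (U, j)" for U j
  have G: "G U j \<in> zvec n" "\<eta> j x ^ r = char_comb n \<eta> (G U j) (U x)" if "U \<in> I" "j < n" for U j x
    using bspec[OF G0, of "(U, j)"] that by (simp_all add: G_def char_comb_def)
  have "\<exists>N>0. \<exists>v. \<forall>U\<in>I. v U \<in> zvec n \<and> (\<forall>x. \<xi> U x ^ N = char_comb n \<eta> (v U) x)"
    using I by (rule common_exponent) (intro dep[OF \<eta> ind] chI)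
  then obtain N v where N: "N > 0"
    and v0: "\<forall>U\<in>I. v U \<in> zvec n \<and> (\<forall>x. \<xi> U x ^ N = char_comb n \<eta> (v U) x)"
    by (elim exE conjE)
  have v: "v U \<in> zvec n" "\<xi> U x ^ N = char_comb n \<eta> (v U) x" if "U \<in> I" for U x
    using bspec[OF v0 that] by simp_all
  define f where "f U = zact n (A U)" for U
  have f_lin: "zlinear n (f U)" if "U \<in> I" for U
    unfolding f_def by (rule zlinear_zact) (rule A(1)[OF that])
  have f_comb: "char_comb n \<eta> (f U u) x = char_comb n \<eta> u (U x) ^ q" if "U \<in> I" for U u x
    unfolding f_def by (rule char_comb_zact) (simp_all add: nz A(2)[OF that])
  have f_pow_comb: "char_comb n \<eta> ((f U ^^ t) u) x = char_comb n \<eta> u ((U ^^ t) x) ^ (q ^ t)"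
    if "U \<in> I" for U u x t
  proof (induction t arbitrary: x)
    case (Suc t)
    have "char_comb n \<eta> ((f U ^^ Suc t) u) x = (char_comb n \<eta> u ((U ^^ t) (U x)) ^ (q ^ t)) ^ q"
      using f_comb[OF that] Suc by simp
    then show ?case by (simp add: funpow_swap1 power_mult[symmetric] mult.commute)
  qed simp
  \<comment> \<open>\<open>S t\<close> is the coordinate vector of the orbit product raised to the
    power \<open>N * q ^ t\<close>. This exponent is common to all \<open>U\<close>, and torsion
    freeness removes it, so \<open>S t\<close> vanishes exactly when the relation holds at time
    \<open>t\<close>.\<close>
  define S where "S t k = (\<Sum>U\<in>I. (f U ^^ t) (v U) k)" for t k
  have S_zvec: "S t \<in> zvec n" for t
    using zlinear_funpow_zvec[OF f_lin v(1)] by (simp add: zvec_def S_def)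
  have S_comb: "char_comb n \<eta> (S t) x = orbit_prod I \<xi> t x ^ (N * q ^ t)" for t x
  proof -
    have "char_comb n \<eta> (S t) x = (\<Prod>U\<in>I. char_comb n \<eta> ((f U ^^ t) (v U)) x)"
      unfolding S_def[abs_def] by (rule char_comb_sum) (rule nz)
    also have "\<dots> = (\<Prod>U\<in>I. \<xi> U ((U ^^ t) x) ^ (N * q ^ t))"
      by (intro prod.cong refl) (simp add: f_pow_comb v(2)[symmetric] power_mult)
    finally show ?thesis by (simp add: prod_power_distrib)
  qed
  have S_iff: "(\<forall>k. S t k = 0) \<longleftrightarrow> (\<forall>x. orbit_prod I \<xi> t x = 1)" for t
  proof
    assume "\<forall>k. S t k = 0"
    then have "S t = (\<lambda>_. 0)" by blast
    then have pow: "orbit_prod I \<xi> t x ^ (N * q ^ t) = 1" for x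
      using S_comb[of t x] by (simp add: char_comb_zero)
    have c: "character (\<lambda>x. \<Prod>U\<in>I. \<xi> U ((U ^^ t) x))"
      by (rule character_product_epimorphisms) (simp_all add: epiI chI)
    have "N * q ^ t > 0" using N q by simp
    from character_torsion_free[OF conn c this pow]
    show "\<forall>x. orbit_prod I \<xi> t x = 1" ..
  next
    assume "\<forall>x. orbit_prod I \<xi> t x = 1"
    then have "\<forall>x. char_comb n \<eta> (S t) x = 1" by (simp add: S_comb)
    then have "S t = (\<lambda>_. 0)" using ind S_zvec unfolding char_indep_def by blast
    then show "\<forall>k. S t k = 0" by simp
  qed
  \<comment> \<open>\<open>zact n (G U)\<close> undoes \<open>f U\<close> up to the factor
    \<open>q * r\<close>; a prime exceeding this factor makes \<open>f U\<close> injective modulo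
    \<open>p ^ 2\<close>.\<close>
  obtain p :: nat where p: "prime p" "q * r < p" using bigger_prime by blast
  have f_inj: "\<forall>k. int (p ^ 2) dvd u k"
    if U: "U \<in> I" and u: "u \<in> zvec n" and dvd: "\<forall>k. int (p ^ 2) dvd f U u k" for U u
  proof -
    define w where "w = zact n (G U) (f U u)"
    have "zlinear n (zact n (G U))" by (rule zlinear_zact) (rule G(1)[OF U])
    then have w_zvec: "w \<in> zvec n" by (simp add: w_def zlinear_def)
    have w_comb: "char_comb n \<eta> w (U x) = char_comb n \<eta> (\<lambda>k. int (q * r) * u k) (U x)" for x
    proof -
      have "char_comb n \<eta> w (U x) = char_comb n \<eta> (f U u) x ^ r"
        unfolding w_def by (rule char_comb_zact) (simp_all add: nz G(2)[OF U])
      also have "\<dots> = char_comb n \<eta> u (U x) ^ (q * r)" by (simp add: f_comb[OF U] power_mult)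
      also have "\<dots> = char_comb n \<eta> (\<lambda>k. int (q * r) * u k) (U x)"
        unfolding char_comb_scale power_int_of_nat ..
      finally show ?thesis .
    qed
    have "w = (\<lambda>k. int (q * r) * u k)"
    proof (rule char_comb_eqD[OF \<eta> ind w_zvec])
      show "(\<lambda>k. int (q * r) * u k) \<in> zvec n" using u by (simp add: zvec_def)
      show "char_comb n \<eta> w y = char_comb n \<eta> (\<lambda>k. int (q * r) * u k) y" for y
        using surj[OF U, of y] w_comb by blast
    qed
    moreover have "int (p ^ 2) dvd w k" for k
      unfolding w_def zact_def using dvd by (intro dvd_sum dvd_mult2) blast
    ultimately have "int (p ^ 2) dvd int (q * r) * u k" for k by (simp only: fun_eq_iff)
    moreover have "coprime (int (p ^ 2)) (int (q * r))"
    proof -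
      have "\<not> p dvd q * r" using p(2) q r by (auto dest: dvd_imp_le)
      then have "coprime p (q * r)" using p(1) prime_imp_coprime by blast
      then show ?thesis unfolding coprime_int_iff by simp
    qed
    ultimately show ?thesis using coprime_dvd_mult_right_iff by blast
  qed
  have "\<exists>a b. b > 0 \<and> (\<forall>t k. (\<Sum>U\<in>I. (f U ^^ (a + b * t)) (v U) k) = 0)"
  proof (rule skolem_mahler_lech[OF I p(1) f_lin f_inj v(1)])
    have "{t. \<forall>k. (\<Sum>U\<in>I. (f U ^^ t) (v U) k) = 0} = {t. \<forall>x. orbit_prod I \<xi> t x = 1}"
      using S_iff unfolding S_def by blast
    then show "infinite {t. \<forall>k. (\<Sum>U\<in>I. (f U ^^ t) (v U) k) = 0}"
      using inf unfolding I_def by simp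
  qed
  then obtain a b where b: "b > 0" and "\<forall>t k. (\<Sum>U\<in>I. (f U ^^ (a + b * t)) (v U) k) = 0"
    by (elim exE conjE)
  then have S0: "S (a + b * t) k = 0" for t k by (simp add: S_def)
  have prog: "orbit_prod I \<xi> (a + b * t) x = 1" for t x
    using S_iff[of "a + b * t"] S0 by simp
  define \<zeta> where "\<zeta> U x = \<xi> U ((U ^^ b) x) * cnj (\<xi> U x)" for U x
  have \<zeta>_ch: "character (\<zeta> U)" if "U \<in> I" for U
    unfolding \<zeta>_def[abs_def]
    by (intro character_mult character_cnj chI[OF that]
        character_epimorphism[OF chI[OF that] epimorphism_funpow[OF epiI[OF that]]])
  have "orbit_prod F \<zeta> (a + b * t) x = 1" for t x
  proof -
    have shift: "(U ^^ b) ((U ^^ (a + b * t)) x) = (U ^^ (a + b * Suc t)) x" for U :: "'a \<Rightarrow> 'a"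
    proof -
      have "(U ^^ (b + (a + b * t))) x = (U ^^ b) ((U ^^ (a + b * t)) x)" by (simp add: funpow_add)
      moreover have "b + (a + b * t) = a + b * Suc t" by simp
      ultimately show ?thesis by simp
    qed
    have "orbit_prod I \<zeta> (a + b * t) x
        = orbit_prod I \<xi> (a + b * Suc t) x * cnj (orbit_prod I \<xi> (a + b * t) x)"
      unfolding \<zeta>_def shift by (simp add: prod.distrib)
    also have "\<dots> = 1" by (simp only: prog) simp
    also have "orbit_prod I \<zeta> (a + b * t) x
        = \<zeta> id ((id ^^ (a + b * t)) x) * orbit_prod F \<zeta> (a + b * t) x"
      unfolding I_def using F by (rule prod.insert)
    also have "\<zeta> id y = 1" for y
      using character_cnj_mult[OF chI[of id], of y] by (simp add: \<zeta>_def I_def mult.commute)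
    finally show ?thesis by simp
  qed
  then have "range (\<lambda>t. a + b * t) \<subseteq> {t. \<forall>x. orbit_prod F \<zeta> t x = 1}" by blast
  moreover have "infinite (range (\<lambda>t. a + b * t))"
    using b by (intro range_inj_infinite) (auto simp: inj_def)
  ultimately have "infinite {t. \<forall>x. orbit_prod F \<zeta> t x = 1}"
    using finite_subset by blast
  then have \<zeta>_one: "\<forall>U\<in>F. \<forall>x. \<zeta> U x = 1"
    using mixing_set_characters_free[OF conn mixF] \<zeta>_ch unfolding characters_free_def I_def by blast
  have \<xi>_F: "\<xi> U x = 1" if U: "U \<in> F" for U x
  proof (rule mixing_character_not_periodic[OF conn mix[OF U] _ b])
    show c: "character (\<xi> U)" using U ch by simp
    fix x
    have "\<xi> U ((U ^^ b) x) = \<zeta> U x * \<xi> U x"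
      using character_cnj_mult[OF c, of x] by (simp add: \<zeta>_def mult.assoc)
    then show "\<xi> U ((U ^^ b) x) = \<xi> U x" using \<zeta>_one U by simp
  qed
  \<comment> \<open>With the other characters trivial, the relation at time \<open>a\<close> reduces
    to the character that belongs to \<open>id\<close>.\<close>
  have "\<xi> id x = 1" for x
  proof -
    have "\<xi> id ((id ^^ (a + b * 0)) x) * orbit_prod F \<xi> (a + b * 0) x = 1"
      using prog[of 0 x] unfolding I_def prod.insert[OF F] .
    moreover have "(id ^^ (a + b * 0)) x = x" by simp
    ultimately show ?thesis using \<xi>_F by simp
  qed
  then show "\<forall>U\<in>insert id F. \<forall>x. \<xi> U x = 1" using \<xi>_F by blast
qed

section \<open>Restriction of mixing sets to subsets\<close>

lemma mixing_set_subset: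
  assumes mix: "mixing_set (completion m) F" and "E \<subseteq> F"
  shows "mixing_set (completion m) E"
  unfolding mixing_set_def
proof (intro conjI allI impI)
  have F: "finite F" using mix by (simp add: mixing_set_def)
  show E: "finite E" using F assms(2) finite_subset by blast
  fix B assume B: "\<forall>U\<in>E. B U \<in> sets (completion m)"
  \<comment> \<open>The whole group in the remaining places changes neither the intersection nor the
    product.\<close>
  define C where "C U = (if U \<in> E then B U else UNIV)" for U
  have "\<forall>U\<in>F. C U \<in> sets (completion m)"
    using B sets.top[of "completion m"] by (auto simp: C_def)
  then have lim: "(\<lambda>n. measure (completion m) (orbit_inter F C n)) \<longlonglongrightarrow> (\<Prod>U\<in>F. measure (completion m) (C U))"
    using mix unfolding mixing_set_def by blast
  have inter: "orbit_inter F C n = orbit_inter E B n" for n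
    using assms(2) by (auto simp: C_def split: if_splits)
  have "(\<Prod>U\<in>F. measure (completion m) (C U)) = (\<Prod>U\<in>E. measure (completion m) (C U))"
    using F assms(2) by (intro prod.mono_neutral_right) (auto simp: C_def)
  also have "\<dots> = (\<Prod>U\<in>E. measure (completion m) (B U))"
    by (intro prod.cong) (auto simp: C_def)
  finally show "(\<lambda>n. measure (completion m) (orbit_inter E B n)) \<longlonglongrightarrow> (\<Prod>U\<in>E. measure (completion m) (B U))"
    using lim unfolding inter by simp
qed

lemma mixing_if_mixing_set_id:
  assumes mix: "mixing_set (completion m) {T, id}" and T: "T \<noteq> id"
  shows "mixing (completion m) T"
  unfolding mixing_def
proof (intro ballI)
  fix A B assume A: "A \<in> sets (completion m)" and B: "B \<in> sets (completion m)"
  \<comment> \<open>The set assigned to \<open>id\<close> is never moved, which turns the double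
    intersection into that of \<open>mixing\<close>; distinctness of \<open>T\<close> and
    \<open>id\<close> keeps the two assignments apart.\<close>
  define C where "C U = (if U = id then A else B)" for U :: "'a \<Rightarrow> 'a"
  have "\<forall>U\<in>{T, id}. C U \<in> sets (completion m)" using A B by (simp add: C_def)
  then have "(\<lambda>n. measure (completion m) (\<Inter>U\<in>{T, id}. (U ^^ n) -` C U))
      \<longlonglongrightarrow> (\<Prod>U\<in>{T, id}. measure (completion m) (C U))"
    using mix unfolding mixing_set_def by blast
  moreover have "(\<Inter>U\<in>{T, id}. (U ^^ n) -` C U) = A \<inter> (T ^^ n) -` B" for n
    using T by (auto simp: C_def)
  moreover have "(\<Prod>U\<in>{T, id}. measure (completion m) (C U)) = measure (completion m) A * measure (completion m) B"
    using T by (simp add: C_def)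
  ultimately show "(\<lambda>n. measure (completion m) (A \<inter> (T ^^ n) -` B))
      \<longlonglongrightarrow> measure (completion m) A * measure (completion m) B"
    by simp
qed

end

theorem corollary1p12:
  fixes m :: "'a::{topological_ab_group_add, t2_space} measure"
    and s :: nat
    and T :: "nat \<Rightarrow> 'a \<Rightarrow> 'a"
  assumes "compact (UNIV :: 'a set)"
    and "connected (UNIV :: 'a set)"
    and "finite_covering_dim (euclidean :: 'a topology)"
    and "normalized_haar m"
    and "s \<ge> 2"
    and "\<And>i. i \<in> {1..s-1} \<Longrightarrow> epimorphism (T i)"
    and "inj_on T {1..s-1}"
    and "\<And>i. i \<in> {1..s-1} \<Longrightarrow> T i \<noteq> id"
  shows "mixing_set (completion m) (T ` {1..s-1} \<union> {id}) \<longleftrightarrow>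
         (\<forall>i\<in>{1..s-1}. mixing (completion m) (T i)) \<and>
         mixing_set (completion m) (T ` {1..s-1})"
proof -
  interpret haar_group m by (rule haar_group.intro) (use assms in auto)
  define F where "F = T ` {1..s-1}"
  have F: "finite F" "id \<notin> F" using assms(8) unfolding F_def by (simp, metis imageE)
  have epi: "epimorphism U" if "U \<in> F" for U using that assms(6) by (auto simp: F_def)
  show ?thesis
  proof
    assume mix: "mixing_set (completion m) (T ` {1..s-1} \<union> {id})"
    have "mixing (completion m) (T i)" if "i \<in> {1..s-1}" for i
      using mixing_set_subset[OF mix, of "{T i, id}"] that assms(8)
      by (intro mixing_if_mixing_set_id) auto
    moreover have "mixing_set (completion m) (T ` {1..s-1})"
      by (rule mixing_set_subset[OF mix]) blast
    ultimately show "(\<forall>i\<in>{1..s-1}. mixing (completion m) (T i)) \<and> mixing_set (completion m) (T ` {1..s-1})"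
      by blast
  next
    assume mix: "(\<forall>i\<in>{1..s-1}. mixing (completion m) (T i)) \<and> mixing_set (completion m) (T ` {1..s-1})"
    have "mixing_set (completion m) (insert id F)"
    proof (rule mixing_set_if_characters_free)
      show "finite (insert id F)" using F by simp
      show "epimorphism U" if "U \<in> insert id F" for U
        using that epi epimorphism_id by blast
      show "characters_free (insert id F)"
        by (rule characters_free_insert_id[OF assms(2,3) F epi]) (use mix in \<open>auto simp: F_def\<close>)
    qed
    then show "mixing_set (completion m) (T ` {1..s-1} \<union> {id})" by (simp add: F_def)
  qed
qed

end
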